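(* Let $\Phi:\Sigma\to\mathbb{S}^3$ be an immersion of a connected surface $\Sigma$. Suppose that $\Phi$ is a minimal immersion with respect to every Berger metric, i.e. $\Phi:\Sigma\to\mathbb{S}^3_b(\kappa,\tau)$ is minimal for all $\kappa>0$ and $\tau\neq 0$. Then there is $c\in\mathbb{R}$ such that $\Phi$ is congruent to a piece of $\Phi_c:\mathbb{R}^2\to\mathbb{S}^3$ given by \[ \Phi_c(s,t)=\bigl(\cos(s)\,e^{ict},\ \sin(s)\,e^{it}\bigr). \]
   Context: Let $\mathbb{S}^3=\{(z,w)\in\mathbb{C}^2: |z|^2+|w|^2=1\}$ and let $\langle\,,\,\rangle$ be its standard round metric. Let $V_{(z,w)}=(iz,iw)$. For $\kappa>0$, $\tau\neq 0$, the Berger sphere $\mathbb{S}^3_b(\kappa,\tau)$ is $\mathbb{S}^3$ with the Berger metric $g(X,Y)=\frac{4}{\kappa}\left[\langle X,Y\rangle+\left(\frac{4\tau^2}{\kappa}-1\right)\langle X,V\rangle\langle Y,V\rangle\right]$. For $\kappa\neq4\tau^2$ its isometry group is $\{A\in \mathrm{O}(4): AJ=\pm JA\}$, where $J$ is multiplication by $i$ on $\mathbb{C}^2=\mathbb{R}^4$; these maps are isometries of all Berger spheres. "Congruent to a piece of $\Phi_c$" means that there is $A$ in this group such that $A(\Phi(\Sigma))\subseteq\Phi_c(\mathbb{R}^2)$. For $c=0$ the image $\Phi_0(\mathbb{R}^2)$ is the equator $\{(z,w)\in\mathbb{S}^3:\operatorname{Im}(z)=0\}$ (the parametrization $\Phi_0$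 degenerates where $\sin s=0$). *)

theory Defs
  imports "HOL-Analysis.Analysis"
begin

section \<open>Smooth maps, surfaces and immersions\<close>

text \<open>To be used on open sets \<open>S\<close> only.\<close>

primrec k_smooth_on :: "nat \<Rightarrow> 'a::real_normed_vector set \<Rightarrow> ('a \<Rightarrow> 'b::real_normed_vector) \<Rightarrow> bool" where
  "k_smooth_on 0 S f \<longleftrightarrow> continuous_on S f"
| "k_smooth_on (Suc k) S f \<longleftrightarrow>
     f differentiable_on S \<and> (\<forall>v. k_smooth_on k S (\<lambda>x. frechet_derivative f (at x) v))"

definition smooth_on :: "'a::real_normed_vector set \<Rightarrow> ('a \<Rightarrow> 'b::real_normed_vector) \<Rightarrow> bool" where
  "smooth_on S f \<longleftrightarrow> (\<forall>k. k_smooth_on k S f)"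

text \<open>A chart is a pair \<open>(U, \<phi>)\<close>; the values of \<open>\<phi>\<close> outside \<open>U\<close> are irrelevant. The surface
  \<open>S\<close> carries the subspace topology of the (arbitrary) ambient type; \<open>S = UNIV\<close> gives an abstract
  surface.\<close>

type_synonym 'a chart = "'a set \<times> ('a \<Rightarrow> real^2)"

definition smooth_surface :: "'a::{t2_space,second_countable_topology} set \<Rightarrow> 'a chart set \<Rightarrow> bool" where
  "smooth_surface S \<A> \<longleftrightarrow>
     S = (\<Union>(U, \<phi>)\<in>\<A>. U) \<and>
     (\<forall>(U, \<phi>)\<in>\<A>. openin (top_of_set S) U \<and> open (\<phi> ` U) \<and>
        homeomorphism U (\<phi> ` U) \<phi> (inv_into U \<phi>)) \<and>
     (\<forall>(U, \<phi>)\<in>\<A>. \<forall>(U', \<phi>')\<in>\<A>. smooth_on (\<phi> ` (U \<inter> U')) (\<phi>' \<circ> inv_into U \<phi>))"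

type_synonym C2 = "complex \<times> complex"

abbreviation S3 :: "C2 set" where
  "S3 \<equiv> sphere 0 1"

text \<open>A map into \<open>S3\<close> is an immersion into \<open>S3\<close> iff it is an immersion into the
  ambient space \<open>\<complex> \<times> \<complex>\<close>.\<close>

definition immersion_S3 :: "'a set \<Rightarrow> 'a chart set \<Rightarrow> ('a \<Rightarrow> C2) \<Rightarrow> bool" where
  "immersion_S3 S \<A> \<Phi> \<longleftrightarrow>
     \<Phi> ` S \<subseteq> S3 \<and>
     (\<forall>(U, \<phi>)\<in>\<A>. smooth_on (\<phi> ` U) (\<Phi> \<circ> inv_into U \<phi>) \<and>
        (\<forall>x\<in>\<phi> ` U. inj (frechet_derivative (\<Phi> \<circ> inv_into U \<phi>) (at x))))"

section \<open>Riemannian geometry of the 3-sphere and of its surfaces\<close>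

text \<open>A Riemannian metric on \<open>S3\<close> is given by bilinear forms \<open>g p\<close> on the ambient space, depending
  smoothly on \<open>p\<close>; only their restriction to the tangent spaces of \<open>S3\<close> matters.\<close>

type_synonym metric = "C2 \<Rightarrow> C2 \<Rightarrow> C2 \<Rightarrow> real"

definition tangent_S3 :: "C2 \<Rightarrow> C2 set" where
  "tangent_S3 p = {v. v \<bullet> p = 0}"

text \<open>The Christoffel symbol of the first kind: for constant fields \<open>u\<close>, \<open>v\<close>, \<open>w\<close> on the ambient
  space the Koszul formula reads \<open>g (\<nabla>\<^sub>u v) w = koszul g p u v w\<close>.\<close>

definition koszul :: "metric \<Rightarrow> C2 \<Rightarrow> C2 \<Rightarrow> C2 \<Rightarrow> C2 \<Rightarrow> real" where
  "koszul g p u v w =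
     (frechet_derivative (\<lambda>q. g q v w) (at p) u
      + frechet_derivative (\<lambda>q. g q u w) (at p) v
      - frechet_derivative (\<lambda>q. g q u v) (at p) w) / 2"

definition partial :: "2 \<Rightarrow> (real^2 \<Rightarrow> C2) \<Rightarrow> real^2 \<Rightarrow> C2" where
  "partial i f x = frechet_derivative f (at x) (axis i 1)"

text \<open>The covariant derivative \<open>\<nabla>\<^bsub>\<partial>i\<^esub> Y\<close>, for the Levi-Civita connection of \<open>(S3, g)\<close>, of a field
  \<open>Y\<close> along \<open>f\<close> that is tangent to \<open>S3\<close>. Since \<open>S3\<close> is a submanifold of the ambient space, it is
  the \<open>g\<close>-orthogonal projection onto the tangent space of \<open>S3\<close> of the ambient covariant derivative;
  testing against tangent vectors \<open>w\<close> makes it independent of the extension of \<open>g\<close> off \<open>S3\<close>.\<close>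

definition covariant_deriv :: "metric \<Rightarrow> (real^2 \<Rightarrow> C2) \<Rightarrow> 2 \<Rightarrow> (real^2 \<Rightarrow> C2) \<Rightarrow> real^2 \<Rightarrow> C2" where
  "covariant_deriv g f i Y x =
     (THE b. b \<in> tangent_S3 (f x) \<and>
        (\<forall>w\<in>tangent_S3 (f x).
           g (f x) b w = g (f x) (partial i Y x) w + koszul g (f x) (partial i f x) (Y x) w))"

definition first_fundamental_form :: "metric \<Rightarrow> (real^2 \<Rightarrow> C2) \<Rightarrow> real^2 \<Rightarrow> real^2^2" where
  "first_fundamental_form g f x = (\<chi> i j. g (f x) (partial i f x) (partial j f x))"

definition unit_normal :: "metric \<Rightarrow> (real^2 \<Rightarrow> C2) \<Rightarrow> real^2 \<Rightarrow> C2 \<Rightarrow> bool" where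
  "unit_normal g f x N \<longleftrightarrow>
     N \<in> tangent_S3 (f x) \<and> (\<forall>i. g (f x) (partial i f x) N = 0) \<and> g (f x) N N = 1"

definition second_fundamental_form :: "metric \<Rightarrow> (real^2 \<Rightarrow> C2) \<Rightarrow> real^2 \<Rightarrow> C2 \<Rightarrow> real^2^2" where
  "second_fundamental_form g f x N = (\<chi> i j. g (f x) (covariant_deriv g f i (partial j f) x) N)"

definition mean_curvature :: "metric \<Rightarrow> (real^2 \<Rightarrow> C2) \<Rightarrow> real^2 \<Rightarrow> C2 \<Rightarrow> real" where
  "mean_curvature g f x N =
     trace (matrix_inv (first_fundamental_form g f x) ** second_fundamental_form g f x N) / 2"

text \<open>The unit normal at a point is unique up to sign, and the sign does not affect the vanishing of
  the mean curvature; so no orientability is needed.\<close>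

definition minimal_immersion :: "metric \<Rightarrow> 'a set \<Rightarrow> 'a chart set \<Rightarrow> ('a \<Rightarrow> C2) \<Rightarrow> bool" where
  "minimal_immersion g S \<A> \<Phi> \<longleftrightarrow>
     immersion_S3 S \<A> \<Phi> \<and>
     (\<forall>(U, \<phi>)\<in>\<A>. \<forall>x\<in>\<phi> ` U. \<forall>N.
        unit_normal g (\<Phi> \<circ> inv_into U \<phi>) x N \<longrightarrow>
        mean_curvature g (\<Phi> \<circ> inv_into U \<phi>) x N = 0)"

section \<open>Berger spheres\<close>

text \<open>Multiplication by \<open>\<i>\<close>; as a vector field on \<open>S3\<close> this is the Hopf field \<open>V\<close>.\<close>

definition J :: "C2 \<Rightarrow> C2" where
  "J p = (\<i> * fst p, \<i> * snd p)"

definition berger_metric :: "real \<Rightarrow> real \<Rightarrow> metric" where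
  "berger_metric \<kappa> \<tau> p X Y =
     4 / \<kappa> * (X \<bullet> Y + (4 * \<tau>\<^sup>2 / \<kappa> - 1) * (X \<bullet> J p) * (Y \<bullet> J p))"

text \<open>The isometry group of the Berger spheres with \<open>\<kappa> \<noteq> 4 * \<tau>\<^sup>2\<close>. For \<open>\<kappa> = 4 * \<tau>\<^sup>2\<close> the metric is
  round and has more isometries; these are not allowed in a congruence.\<close>

definition berger_isometries :: "(C2 \<Rightarrow> C2) set" where
  "berger_isometries =
     {A. orthogonal_transformation A \<and> ((\<forall>p. A (J p) = J (A p)) \<or> (\<forall>p. A (J p) = - J (A p)))}"

definition Phi :: "real \<Rightarrow> real \<times> real \<Rightarrow> C2" where
  "Phi c = (\<lambda>(s, t). (of_real (cos s) * cis (c * t), of_real (sin s) * cis t))"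

definition congruent_to_piece :: "C2 set \<Rightarrow> C2 set \<Rightarrow> bool" where
  "congruent_to_piece M M' \<longleftrightarrow> (\<exists>A\<in>berger_isometries. A ` M \<subseteq> M')"

section \<open>Well-definedness\<close>

text \<open>Symmetry of \<open>koszul\<close> in its first two arguments is torsion-freeness, and the second lemma is
  compatibility with the metric.\<close>

lemma berger_metric_commute: "berger_metric \<kappa> \<tau> p X Y = berger_metric \<kappa> \<tau> p Y X"
  by (simp add: berger_metric_def inner_commute mult_ac)

lemma koszul_commute: "koszul (berger_metric \<kappa> \<tau>) p u v w = koszul (berger_metric \<kappa> \<tau>) p v u w"
  using berger_metric_commute[of \<kappa> \<tau> _ u v] by (simp add: koszul_def)

lemma koszul_metric:
  "koszul (berger_metric \<kappa> \<tau>) p u v w + koszul (berger_metric \<kappa> \<tau>) p u w v =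
   frechet_derivative (\<lambda>q. berger_metric \<kappa> \<tau> q v w) (at p) u"
  using berger_metric_commute[of \<kappa> \<tau> _ w v]
  by (simp add: koszul_def field_simps)

lemma linear_J: "linear J"
  by (rule linearI) (auto simp: J_def algebra_simps scaleR_conv_of_real)

lemma J_tangent: "J p \<bullet> p = 0"
  by (simp add: J_def inner_prod_def inner_complex_def)

lemma norm_J: "J p \<bullet> J p = p \<bullet> p"
  by (simp add: J_def inner_prod_def inner_complex_def)

lemma berger_metric_pos:
  assumes "\<kappa> > 0" "\<tau> \<noteq> 0" "p \<in> S3" "X \<noteq> 0"
  shows "berger_metric \<kappa> \<tau> p X X > 0"
proof -
  have J1: "norm (J p) = 1"
    using norm_J[of p] assms(3) by (simp add: norm_eq_sqrt_inner)
  have le: "(X \<bullet> J p)\<^sup>2 \<le> X \<bullet> X"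
    using Cauchy_Schwarz_ineq[of X "J p"] J1 by (simp add: dot_square_norm)
  have pos: "X \<bullet> X > 0" using assms(4) by simp
  have l: "4 * \<tau>\<^sup>2 / \<kappa> > 0" using assms by simp
  have "X \<bullet> X + (4 * \<tau>\<^sup>2 / \<kappa> - 1) * (X \<bullet> J p)\<^sup>2
      = (X \<bullet> X - (X \<bullet> J p)\<^sup>2) + 4 * \<tau>\<^sup>2 / \<kappa> * (X \<bullet> J p)\<^sup>2"
    by (simp add: algebra_simps)
  also have "\<dots> > 0"
  proof (cases "X \<bullet> J p = 0")
    case False
    then have "4 * \<tau>\<^sup>2 / \<kappa> * (X \<bullet> J p)\<^sup>2 > 0" using l by (intro mult_pos_pos) auto
    then show ?thesis using le by linarith
  qed (use pos in simp)
  finally show ?thesis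
    using assms(1) by (simp add: berger_metric_def power2_eq_square mult.assoc)
qed

lemma differentiable_berger_metric: "(\<lambda>q. berger_metric \<kappa> \<tau> q X Y) differentiable (at p)"
proof -
  have "J differentiable (at p)"
    using linear_J by (rule linear_imp_differentiable)
  then show ?thesis
    unfolding berger_metric_def by (intro derivative_intros differentiable_inner) auto
qed

lemma berger_metric_add:
  "berger_metric \<kappa> \<tau> p X (w + w') = berger_metric \<kappa> \<tau> p X w + berger_metric \<kappa> \<tau> p X w'"
  by (simp only: berger_metric_def inner_add_left inner_add_right) algebra

lemma linear_berger_metric: "linear (berger_metric \<kappa> \<tau> p X)"
  by (rule linearI) (simp_all add: berger_metric_add, simp add: berger_metric_def algebra_simps)

lemma linear_koszul: "linear (koszul (berger_metric \<kappa> \<tau>) p u v)"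
proof -
  have lin: "linear (\<lambda>w. frechet_derivative (\<lambda>q. berger_metric \<kappa> \<tau> q X w) (at p) Y)" for X Y
  proof -
    note D = differentiable_berger_metric[unfolded frechet_derivative_works]
    have add: "frechet_derivative (\<lambda>q. berger_metric \<kappa> \<tau> q X (w + w')) (at p) Y =
       frechet_derivative (\<lambda>q. berger_metric \<kappa> \<tau> q X w) (at p) Y +
       frechet_derivative (\<lambda>q. berger_metric \<kappa> \<tau> q X w') (at p) Y" for w w'
      using fun_cong[OF frechet_derivative_at[OF
          has_derivative_add[OF D[of \<kappa> \<tau> X w p] D[of \<kappa> \<tau> X w' p]]], of Y]
      by (simp only: berger_metric_add)
    have scale: "frechet_derivative (\<lambda>q. berger_metric \<kappa> \<tau> q X (r *\<^sub>R w)) (at p) Y =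
       r *\<^sub>R frechet_derivative (\<lambda>q. berger_metric \<kappa> \<tau> q X w) (at p) Y" for r w
      using fun_cong[OF frechet_derivative_at[OF
          has_derivative_scaleR_right[OF D[of \<kappa> \<tau> X w p], of r]], of Y]
      by (simp only: linear_scale[OF linear_berger_metric])
    show ?thesis by (rule linearI) (simp_all add: add scale)
  qed
  have lin3: "linear (frechet_derivative (\<lambda>q. berger_metric \<kappa> \<tau> q u v) (at p))"
    using differentiable_berger_metric by (rule linear_frechet_derivative)
  have "linear (\<lambda>w. (1 / 2) *\<^sub>R
     (frechet_derivative (\<lambda>q. berger_metric \<kappa> \<tau> q v w) (at p) u
      + frechet_derivative (\<lambda>q. berger_metric \<kappa> \<tau> q u w) (at p) v
      - frechet_derivative (\<lambda>q. berger_metric \<kappa> \<tau> q u v) (at p) w))"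
    by (intro linear_compose_scale_right linear_compose_sub linear_compose_add lin lin3)
  then show ?thesis
    by (simp add: koszul_def[abs_def])
qed

lemma berger_representation:
  assumes "\<kappa> > 0" "\<tau> \<noteq> 0" "p \<in> S3" "linear (l :: C2 \<Rightarrow> real)"
  shows "\<exists>!b. b \<in> tangent_S3 p \<and> (\<forall>w\<in>tangent_S3 p. berger_metric \<kappa> \<tau> p b w = l w)"
proof -
  define k where "k = 4 * \<tau>\<^sup>2 / \<kappa>"
  have k: "k > 0" using assms by (simp add: k_def)
  define L where "L = adjoint l 1"
  have L: "L \<bullet> w = l w" for w
    using adjoint_works[OF assms(4), of w 1] by (simp add: L_def inner_commute)
  have pp: "p \<bullet> p = 1" using assms(3) by (simp add: dot_square_norm)
  have JJ: "J p \<bullet> J p = 1" using pp norm_J by simp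
  have pJ: "p \<bullet> J p = 0" using J_tangent[of p] by (simp only: inner_commute)
  define b where "b = (\<kappa> / 4) *\<^sub>R (L - (L \<bullet> p) *\<^sub>R p - ((1 - 1/k) * (L \<bullet> J p)) *\<^sub>R J p)"
  have b: "b \<in> tangent_S3 p"
    by (simp add: tangent_S3_def b_def inner_diff_left J_tangent pp)
  have bJ: "b \<bullet> J p = \<kappa> / 4 * (1/k * (L \<bullet> J p))"
    by (simp add: b_def inner_diff_left pJ JJ algebra_simps)
  have rep: "berger_metric \<kappa> \<tau> p b w = l w" if "w \<in> tangent_S3 p" for w
  proof -
    have "p \<bullet> w = 0" using that by (simp add: tangent_S3_def inner_commute)
    then have bw: "b \<bullet> w = \<kappa> / 4 * (l w - (1 - 1/k) * (L \<bullet> J p) * (w \<bullet> J p))"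
      by (simp add: b_def inner_diff_left L inner_commute[of "J p" w])
    have "berger_metric \<kappa> \<tau> p b w = 4 / \<kappa> * (b \<bullet> w + (k - 1) * (b \<bullet> J p) * (w \<bullet> J p))"
      by (simp add: berger_metric_def k_def)
    also have "\<dots> = l w"
      unfolding bw bJ using assms(1) k by (simp add: field_simps)
    finally show ?thesis .
  qed
  have uniq: "b' = b" if "b' \<in> tangent_S3 p" "\<forall>w\<in>tangent_S3 p. berger_metric \<kappa> \<tau> p b' w = l w" for b'
  proof (rule ccontr)
    assume ne: "b' \<noteq> b"
    have t: "b' - b \<in> tangent_S3 p"
      using that b by (simp add: tangent_S3_def inner_diff_left)
    have "berger_metric \<kappa> \<tau> p (b' - b) (b' - b) =
        berger_metric \<kappa> \<tau> p b' (b' - b) - berger_metric \<kappa> \<tau> p b (b' - b)"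
      using linear_diff[OF linear_berger_metric, of \<kappa> \<tau> p "b' - b" b' b]
      by (simp only: berger_metric_commute[of \<kappa> \<tau> p b' "b' - b"]
          berger_metric_commute[of \<kappa> \<tau> p b "b' - b"])
    also have "\<dots> = 0" using that(2) rep t by simp
    finally show False
      using berger_metric_pos[OF assms(1-3), of "b' - b"] ne by simp
  qed
  show ?thesis using b rep uniq by blast
qed

lemma covariant_deriv_berger:
  assumes "\<kappa> > 0" "\<tau> \<noteq> 0" "f x \<in> S3"
  shows "covariant_deriv (berger_metric \<kappa> \<tau>) f i Y x \<in> tangent_S3 (f x)"
    and "w \<in> tangent_S3 (f x) \<Longrightarrow>
      berger_metric \<kappa> \<tau> (f x) (covariant_deriv (berger_metric \<kappa> \<tau>) f i Y x) w =
      berger_metric \<kappa> \<tau> (f x) (partial i Y x) w +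
      koszul (berger_metric \<kappa> \<tau>) (f x) (partial i f x) (Y x) w"
proof -
  have lin: "linear (\<lambda>w. berger_metric \<kappa> \<tau> (f x) (partial i Y x) w
      + koszul (berger_metric \<kappa> \<tau>) (f x) (partial i f x) (Y x) w)"
    by (rule linear_compose_add[OF linear_berger_metric linear_koszul])
  note spec = theI'[OF berger_representation[OF assms lin], folded covariant_deriv_def]
  show "covariant_deriv (berger_metric \<kappa> \<tau>) f i Y x \<in> tangent_S3 (f x)"
    by (rule conjunct1[OF spec])
  show "berger_metric \<kappa> \<tau> (f x) (covariant_deriv (berger_metric \<kappa> \<tau>) f i Y x) w =
      berger_metric \<kappa> \<tau> (f x) (partial i Y x) w +
      koszul (berger_metric \<kappa> \<tau>) (f x) (partial i f x) (Y x) w"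
    if "w \<in> tangent_S3 (f x)"
    by (rule bspec[OF conjunct2[OF spec] that])
qed

end

theory Submission
  imports Defs
begin

text \<open>For a fixed surface, the mean curvature in the Berger metrics is, up to a positive factor, an affine
  function of \<open>4 \<tau>\<^sup>2 / \<kappa> - 1\<close>. Its coefficients show that the surface is minimal in the round sphere
  and that the horizontal direction \<open>E\<close> of its tangent planes is asymptotic; hence so is the direction
  \<open>T\<close> orthogonal to it. The integral curves of \<open>E\<close> are horizontal great circles. Away from umbilic points,
  the asymptotic directions extend \<open>E\<close> smoothly across the points where the whole tangent plane is
  horizontal.

  For a point \<open>p\<close> of the surface, \<open>(p, E)\<close> is a unitary frame of \<open>\<complex>\<^sup>2\<close>, whose derivative in the direction \<open>T\<close> is
  \<open>\<i>\<close> times a real symmetric matrix. The structure equations imply that the Hermitian operator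
  given by this matrix in the frame \<open>(p, E)\<close>, divided by its Frobenius norm, is locally constant. In an
  orthonormal eigenbasis, the great circles through \<open>p\<close> and \<open>E\<close> move along the one-parameter group generated
  by this operator, and this is the description of \<open>\<Phi>\<^sub>c\<close>, where \<open>c\<close> is the ratio of the two eigenvalues.
  They also imply that an umbilic point has an umbilic neighbourhood, so that either there are none or the
  surface is totally geodesic, the case \<open>c = 0\<close>.\<close>

section \<open>Calculus of smooth maps\<close>

text \<open>Where the tangent plane is not horizontal, its horizontal direction is unique up to
  sign, and this ties together the frames of two charts. In a horizontal plane either asymptotic
  direction could serve as \<open>E\<close>. Frames are therefore compared at transversal points,
  which are dense, and the leaf data are carried from there to the other points by a frame on a
  ball.

  The number \<open>k * k - d * s\<close> has two readings: it is the second fundamental form on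
  \<open>E\<close> and \<open>T\<close>, and it is minus the determinant of the matrix that
  generates the motion. Divided by the squared Frobenius norm it is locally constant. Hence without
  umbilic points both eigenvalues are nonzero and their ratio makes sense, while near an umbilic
  point the second form cannot jump from zero to a fixed positive size. An umbilic point with a
  horizontal plane is isolated among the points with horizontal plane, so a punctured ball around it
  still carries a frame.\<close>

abbreviation fderiv :: "('a::real_normed_vector \<Rightarrow> 'b::real_normed_vector) \<Rightarrow> 'a \<Rightarrow> 'a \<Rightarrow> 'b" where
  "fderiv f x \<equiv> frechet_derivative f (at x)"

section \<open>Smoothness of finite order under algebraic operations\<close>

lemma k_smooth_on_SucD:
  assumes "open S" "k_smooth_on (Suc k) S f" "x \<in> S"
  shows "(f has_derivative fderiv f x) (at x)"
  using assms by (simp add: differentiable_on_eq_differentiable_at flip: frechet_derivative_works)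

lemma k_smooth_on_cong:
  assumes "open S" "\<And>x. x \<in> S \<Longrightarrow> f x = g x" "k_smooth_on k S f"
  shows "k_smooth_on k S g"
  using assms(2-)
proof (induction k arbitrary: f g)
  case 0
  then show ?case using continuous_on_cong[of S S f g] by simp
next
  case (Suc k)
  have D: "(g has_derivative fderiv f x) (at x)" if "x \<in> S" for x
    using k_smooth_on_SucD[OF assms(1) Suc.prems(2) that] Suc.prems(1)
    by (rule has_derivative_transform_within_open[OF _ assms(1) that])
  then have "g differentiable_on S"
    by (meson differentiable_at_imp_differentiable_on differentiable_def)
  moreover have "fderiv f x v = fderiv g x v" if "x \<in> S" for x v
    using fun_cong[OF frechet_derivative_at[OF D[OF that]]] .
  then have "k_smooth_on k S (\<lambda>x. fderiv g x v)" for v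
    by (rule Suc.IH) (use Suc.prems(2) in simp_all)
  ultimately show ?case by simp
qed

lemma k_smooth_on_SucI:
  assumes "open S" "\<And>x. x \<in> S \<Longrightarrow> (f has_derivative f' x) (at x)"
    and "\<And>v. k_smooth_on k S (\<lambda>x. f' x v)"
  shows "k_smooth_on (Suc k) S f"
proof -
  have "f differentiable_on S"
    using assms(2) by (meson differentiable_at_imp_differentiable_on differentiable_def)
  moreover have "k_smooth_on k S (\<lambda>x. fderiv f x v)" for v
    by (rule k_smooth_on_cong[OF assms(1) _ assms(3)[of v]]) (rule fun_cong[OF frechet_derivative_at[OF assms(2)]])
  ultimately show ?thesis by simp
qed

lemma k_smooth_on_Suc_imp: "k_smooth_on (Suc k) S f \<Longrightarrow> k_smooth_on k S f"
proof (induction k arbitrary: f)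
  case 0
  then show ?case using differentiable_imp_continuous_on by auto
next
  case (Suc k)
  from Suc.prems have "f differentiable_on S"
    and "\<And>v. k_smooth_on (Suc k) S (\<lambda>x. fderiv f x v)" by simp_all
  then show ?case using Suc.IH unfolding k_smooth_on.simps(2)[of k S f] by blast
qed

lemma k_smooth_on_const: "open S \<Longrightarrow> k_smooth_on k S (\<lambda>x. c)"
proof (induction k arbitrary: c)
  case (Suc k)
  then show ?case
    by (intro k_smooth_on_SucI[where f' = "\<lambda>_ _. 0"]) auto
qed simp

lemma k_smooth_on_bounded_linear:
  assumes "open S" "bounded_linear L" "k_smooth_on k S f"
  shows "k_smooth_on k S (\<lambda>x. L (f x))"
  using assms(3)
proof (induction k arbitrary: f)
  case 0
  then show ?case using bounded_linear.continuous_on[OF assms(2)] by simp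
next
  case (Suc k)
  show ?case
  proof (rule k_smooth_on_SucI[OF assms(1)])
    show "((\<lambda>x. L (f x)) has_derivative (\<lambda>v. L (fderiv f x v))) (at x)" if "x \<in> S" for x
      using bounded_linear.has_derivative[OF assms(2) k_smooth_on_SucD[OF assms(1) Suc.prems that]] .
  qed (use Suc assms in auto)
qed

lemma k_smooth_on_add:
  assumes "open S" "k_smooth_on k S f" "k_smooth_on k S g"
  shows "k_smooth_on k S (\<lambda>x. f x + g x)"
  using assms(2,3)
proof (induction k arbitrary: f g)
  case 0
  then show ?case by (simp add: continuous_on_add)
next
  case (Suc k)
  show ?case
  proof (rule k_smooth_on_SucI[OF assms(1)])
    show "((\<lambda>x. f x + g x) has_derivative
      (\<lambda>v. fderiv f x v + fderiv g x v)) (at x)" if "x \<in> S" for x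
      using k_smooth_on_SucD[OF assms(1) Suc.prems(1) that] k_smooth_on_SucD[OF assms(1) Suc.prems(2) that]
      by (rule has_derivative_add)
  qed (use Suc assms in auto)
qed

text \<open>The product rule gives a sum of terms of the same shape with one factor differentiated,
  so the induction runs over all pairs of functions; the other factor is lowered by one
  order.\<close>

lemma k_smooth_on_bilinear:
  assumes "open S" "bounded_bilinear B" "k_smooth_on k S f" "k_smooth_on k S g"
  shows "k_smooth_on k S (\<lambda>x. B (f x) (g x))"
  using assms(3,4)
proof (induction k arbitrary: f g)
  case 0
  then show ?case using bounded_bilinear.continuous_on[OF assms(2)] by simp
next
  case (Suc k)
  show ?case
  proof (rule k_smooth_on_SucI[OF assms(1)])
    show "((\<lambda>x. B (f x) (g x)) has_derivative
      (\<lambda>v. B (f x) (fderiv g x v) + B (fderiv f x v) (g x))) (at x)"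
      if "x \<in> S" for x
      using k_smooth_on_SucD[OF assms(1) Suc.prems(1) that] k_smooth_on_SucD[OF assms(1) Suc.prems(2) that]
      by (rule bounded_bilinear.FDERIV[OF assms(2)])
    show "k_smooth_on k S
      (\<lambda>x. B (f x) (fderiv g x v) + B (fderiv f x v) (g x))" for v
      using Suc.prems by (intro k_smooth_on_add[OF assms(1)] Suc.IH k_smooth_on_Suc_imp[of k S f]
        k_smooth_on_Suc_imp[of k S g]) auto
  qed
qed

text \<open>The derivative is a polynomial in \<open>inverse (f x)\<close> and the derivative of
  \<open>f\<close>, so the induction hypothesis for the same \<open>f\<close>, one order lower,
  suffices.\<close>

lemma k_smooth_on_inverse:
  fixes f :: "'a::real_normed_vector \<Rightarrow> real"
  assumes "open S" "k_smooth_on k S f" "\<And>x. x \<in> S \<Longrightarrow> f x \<noteq> 0"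
  shows "k_smooth_on k S (\<lambda>x. inverse (f x))"
  using assms(2)
proof (induction k)
  case 0
  then show ?case using assms(3) by (auto intro: continuous_on_inverse)
next
  case (Suc k)
  show ?case
  proof (rule k_smooth_on_SucI[OF assms(1)])
    show "((\<lambda>x. inverse (f x)) has_derivative
      (\<lambda>v. - (inverse (f x) * fderiv f x v * inverse (f x)))) (at x)" if "x \<in> S" for x
      by (rule Deriv.has_derivative_inverse[OF assms(3)[OF that] k_smooth_on_SucD[OF assms(1) Suc.prems that]])
    have "k_smooth_on k S (\<lambda>x. inverse (f x))" using Suc k_smooth_on_Suc_imp by blast
    then show "k_smooth_on k S (\<lambda>x. - (inverse (f x) * fderiv f x v * inverse (f x)))" for v
      using Suc.prems by (intro k_smooth_on_bounded_linear[OF assms(1) bounded_linear_minus[OF bounded_linear_ident]]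
        k_smooth_on_bilinear[OF assms(1) bounded_bilinear_mult]) auto
  qed
qed

lemma k_smooth_on_sqrt:
  fixes f :: "'a::real_normed_vector \<Rightarrow> real"
  assumes "open S" "k_smooth_on k S f" "\<And>x. x \<in> S \<Longrightarrow> f x > 0"
  shows "k_smooth_on k S (\<lambda>x. sqrt (f x))"
  using assms(2)
proof (induction k)
  case 0
  then show ?case by (auto intro: continuous_on_real_sqrt)
next
  case (Suc k)
  show ?case
  proof (rule k_smooth_on_SucI[OF assms(1)])
    show "((\<lambda>x. sqrt (f x)) has_derivative
      (\<lambda>v. (1/2) *\<^sub>R (fderiv f x v * inverse (sqrt (f x))))) (at x)" if "x \<in> S" for x
      using k_smooth_on_SucD[OF assms(1) Suc.prems that] assms(3)[OF that]
      by (auto intro!: derivative_eq_intros simp: field_simps)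
    have "k_smooth_on k S (\<lambda>x. sqrt (f x))" using Suc k_smooth_on_Suc_imp by blast
    then show "k_smooth_on k S (\<lambda>x. (1/2) *\<^sub>R (fderiv f x v * inverse (sqrt (f x))))" for v
      using Suc.prems assms(3) by (intro k_smooth_on_bounded_linear[OF assms(1) bounded_linear_scaleR_right]
        k_smooth_on_bilinear[OF assms(1) bounded_bilinear_mult] k_smooth_on_inverse[OF assms(1)]) force+
  qed
qed

lemma smooth_on_subset:
  assumes "smooth_on S f" "T \<subseteq> S"
  shows "smooth_on T f"
proof -
  have "k_smooth_on k S f \<Longrightarrow> k_smooth_on k T f" for k
    by (induction k arbitrary: f) (use assms(2) differentiable_on_subset continuous_on_subset in auto)
  then show ?thesis using assms(1) by (simp add: smooth_on_def)
qed

lemma smooth_on_cong: "open S \<Longrightarrow> (\<And>x. x \<in> S \<Longrightarrow> f x = g x) \<Longrightarrow> smooth_on S f \<Longrightarrow> smooth_on S g"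
  unfolding smooth_on_def by (meson k_smooth_on_cong)

lemma smooth_on_const: "open S \<Longrightarrow> smooth_on S (\<lambda>x. c)"
  by (simp add: smooth_on_def k_smooth_on_const)

lemma smooth_on_bounded_linear: "open S \<Longrightarrow> bounded_linear L \<Longrightarrow> smooth_on S f \<Longrightarrow> smooth_on S (\<lambda>x. L (f x))"
  by (simp add: smooth_on_def k_smooth_on_bounded_linear)

lemma smooth_on_bilinear:
  "open S \<Longrightarrow> bounded_bilinear B \<Longrightarrow> smooth_on S f \<Longrightarrow> smooth_on S g \<Longrightarrow> smooth_on S (\<lambda>x. B (f x) (g x))"
  by (simp add: smooth_on_def k_smooth_on_bilinear)

lemma smooth_on_add: "open S \<Longrightarrow> smooth_on S f \<Longrightarrow> smooth_on S g \<Longrightarrow> smooth_on S (\<lambda>x. f x + g x)"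
  by (simp add: smooth_on_def k_smooth_on_add)

lemma smooth_on_minus: "open S \<Longrightarrow> smooth_on S f \<Longrightarrow> smooth_on S (\<lambda>x. - f x)"
  by (rule smooth_on_bounded_linear[OF _ bounded_linear_minus[OF bounded_linear_ident]])

lemma smooth_on_diff: "open S \<Longrightarrow> smooth_on S f \<Longrightarrow> smooth_on S g \<Longrightarrow> smooth_on S (\<lambda>x. f x - g x)"
  using smooth_on_add[of S f "\<lambda>x. - g x"] smooth_on_minus[of S g] by simp

lemma smooth_on_mult:
  fixes f g :: "'a::real_normed_vector \<Rightarrow> 'b::real_normed_algebra"
  shows "open S \<Longrightarrow> smooth_on S f \<Longrightarrow> smooth_on S g \<Longrightarrow> smooth_on S (\<lambda>x. f x * g x)"
  by (rule smooth_on_bilinear[OF _ bounded_bilinear_mult])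

lemma smooth_on_scaleR:
  "open S \<Longrightarrow> smooth_on S f \<Longrightarrow> smooth_on S g \<Longrightarrow> smooth_on S (\<lambda>x. f x *\<^sub>R g x)"
  by (rule smooth_on_bilinear[OF _ bounded_bilinear_scaleR])

lemma smooth_on_inner:
  "open S \<Longrightarrow> smooth_on S f \<Longrightarrow> smooth_on S g \<Longrightarrow> smooth_on S (\<lambda>x. f x \<bullet> g x)"
  by (rule smooth_on_bilinear[OF _ bounded_bilinear_inner])

lemma smooth_on_power2:
  fixes f :: "'a::real_normed_vector \<Rightarrow> real"
  shows "open S \<Longrightarrow> smooth_on S f \<Longrightarrow> smooth_on S (\<lambda>x. (f x)\<^sup>2)"
  by (simp add: power2_eq_square smooth_on_mult)

lemma smooth_on_divide:
  fixes f g :: "'a::real_normed_vector \<Rightarrow> real"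
  shows "open S \<Longrightarrow> smooth_on S f \<Longrightarrow> smooth_on S g \<Longrightarrow> (\<And>x. x \<in> S \<Longrightarrow> g x \<noteq> 0) \<Longrightarrow> smooth_on S (\<lambda>x. f x / g x)"
  unfolding divide_inverse
  by (intro smooth_on_mult) (auto simp: smooth_on_def k_smooth_on_inverse)

lemma smooth_on_sqrt:
  fixes f :: "'a::real_normed_vector \<Rightarrow> real"
  shows "open S \<Longrightarrow> smooth_on S f \<Longrightarrow> (\<And>x. x \<in> S \<Longrightarrow> f x > 0) \<Longrightarrow> smooth_on S (\<lambda>x. sqrt (f x))"
  by (simp add: smooth_on_def k_smooth_on_sqrt)

lemma smooth_on_sum:
  assumes "open S" "finite I" "\<And>i. i \<in> I \<Longrightarrow> smooth_on S (f i)"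
  shows "smooth_on S (\<lambda>x. \<Sum>i\<in>I. f i x)"
  using assms(2,3) by (induction I) (auto intro: smooth_on_add smooth_on_const assms(1))

lemma smooth_has_fderiv:
  "open S \<Longrightarrow> smooth_on S f \<Longrightarrow> x \<in> S \<Longrightarrow> (f has_derivative fderiv f x) (at x)"
  unfolding smooth_on_def using k_smooth_on_SucD by blast

lemma smooth_continuous_on: "smooth_on S f \<Longrightarrow> continuous_on S f"
  unfolding smooth_on_def using k_smooth_on.simps(1) by blast

lemma smooth_on_fderiv:
  "smooth_on S f \<Longrightarrow> smooth_on S (\<lambda>x. fderiv f x v)"
  unfolding smooth_on_def by (metis k_smooth_on.simps(2))

section \<open>Derivatives along vector fields and symmetry of second derivatives\<close>

definition lie :: "('a::real_normed_vector \<Rightarrow> 'a) \<Rightarrow> ('a \<Rightarrow> 'b::real_normed_vector) \<Rightarrow> 'a \<Rightarrow> 'b" where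
  "lie X u x = fderiv u x (X x)"

text \<open>Smoothness is defined through derivatives in constant directions; the expansion in a
  basis reduces a varying direction to those.\<close>

lemma fderiv_expand:
  fixes u :: "'a::euclidean_space \<Rightarrow> 'b::real_normed_vector"
  assumes "open S" "smooth_on S u" "x \<in> S"
  shows "fderiv u x v = (\<Sum>b\<in>Basis. (v \<bullet> b) *\<^sub>R fderiv u x b)"
proof -
  have l: "linear (fderiv u x)"
    using smooth_has_fderiv[OF assms] has_derivative_linear by blast
  show ?thesis
    by (subst euclidean_representation[symmetric]) (simp only: linear_sum[OF l] linear_scale[OF l])
qed

lemma smooth_on_lie:
  fixes u :: "'a::euclidean_space \<Rightarrow> 'b::real_normed_vector"
  assumes "open S" "smooth_on S u" "smooth_on S X"
  shows "smooth_on S (lie X u)"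
proof (rule smooth_on_cong[OF assms(1)])
  show "smooth_on S (\<lambda>x. \<Sum>b\<in>Basis. (X x \<bullet> b) *\<^sub>R fderiv u x b)"
    by (intro smooth_on_sum smooth_on_scaleR smooth_on_inner smooth_on_const smooth_on_fderiv assms) auto
qed (simp add: lie_def flip: fderiv_expand[OF assms(1,2)])

lemma fderiv_eqI: "(f has_derivative f') (at x) \<Longrightarrow> fderiv f x v = f' v"
  using fun_cong[OF frechet_derivative_at, of f f' x v] by simp

lemma fderiv_cong:
  assumes "open S" "smooth_on S u" "x \<in> S" "\<And>y. y \<in> S \<Longrightarrow> u y = w y"
  shows "fderiv u x = fderiv w x"
  using smooth_has_fderiv[OF assms(1-3)] assms
  by (meson frechet_derivative_at has_derivative_transform_within_open)

text \<open>The mean value theorem is applied twice: to the increment along \<open>w\<close> as a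
  function of the position along \<open>v\<close>, then to the derivative along \<open>v\<close>.
  The left side is symmetric in \<open>v\<close> and \<open>w\<close>, which is what the symmetry of
  second derivatives rests on. The margin \<open>e\<close> keeps the endpoints inside the open
  ball.\<close>

lemma second_difference:
  fixes u :: "'a::real_normed_vector \<Rightarrow> real"
  assumes S: "open S" "smooth_on S u" and h: "h > 0"
    and sub: "ball x (h * (norm v + norm w) + e) \<subseteq> S" "e > 0"
  shows "\<exists>y. norm (y - x) \<le> h * (norm v + norm w) \<and>
     u (x + h *\<^sub>R v + h *\<^sub>R w) - u (x + h *\<^sub>R v) - u (x + h *\<^sub>R w) + u x =
     h\<^sup>2 * fderiv (\<lambda>x. fderiv u x v) y w"
proof -
  have inS: "x + a *\<^sub>R v + b *\<^sub>R w \<in> S" and bd: "norm (a *\<^sub>R v + b *\<^sub>R w) \<le> h * (norm v + norm w)"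
    if "0 \<le> a" "a \<le> h" "0 \<le> b" "b \<le> h" for a b
  proof -
    have "norm (a *\<^sub>R v + b *\<^sub>R w) \<le> a * norm v + b * norm w"
      using norm_triangle_ineq[of "a *\<^sub>R v" "b *\<^sub>R w"] that by simp
    also have "\<dots> \<le> h * norm v + h * norm w" using that by (intro add_mono mult_right_mono) auto
    finally show le: "norm (a *\<^sub>R v + b *\<^sub>R w) \<le> h * (norm v + norm w)" by (simp add: algebra_simps)
    show "x + a *\<^sub>R v + b *\<^sub>R w \<in> S"
      using sub le by (intro set_mp[OF sub(1)]) (auto simp: dist_norm norm_minus_commute add.assoc
        simp flip: norm_minus_cancel[of "a *\<^sub>R v + b *\<^sub>R w"])
  qed
  note D = smooth_has_fderiv[OF S]
  define W where "W = (\<lambda>x. fderiv u x v)"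
  have W: "smooth_on S W" unfolding W_def by (rule smooth_on_fderiv[OF S(2)])
  note DW = smooth_has_fderiv[OF S(1) W]
  have lin: "fderiv u y (r *\<^sub>R z) = r * fderiv u y z" if "y \<in> S" for y r z
    using linear_scale[OF has_derivative_linear[OF D[OF that]]] by simp
  have linW: "fderiv W y (r *\<^sub>R z) = r * fderiv W y z" if "y \<in> S" for y r z
    using linear_scale[OF has_derivative_linear[OF DW[OF that]]] by simp
  have "\<exists>z>0. z < h \<and> (u (x + h *\<^sub>R v + h *\<^sub>R w) - u (x + h *\<^sub>R v)) -
       (u (x + 0 *\<^sub>R v + h *\<^sub>R w) - u (x + 0 *\<^sub>R v)) = (h - 0) * (W (x + z *\<^sub>R v + h *\<^sub>R w) - W (x + z *\<^sub>R v))"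
  proof (rule MVT2[OF h])
    fix t assume t: "0 \<le> t" "t \<le> h"
    have 1: "((\<lambda>t. x + t *\<^sub>R v + h *\<^sub>R w) has_derivative (\<lambda>s. s *\<^sub>R v)) (at t)"
      and 2: "((\<lambda>t. x + t *\<^sub>R v) has_derivative (\<lambda>s. s *\<^sub>R v)) (at t)"
      by (auto intro!: derivative_eq_intros)
    have i: "x + t *\<^sub>R v + h *\<^sub>R w \<in> S" "x + t *\<^sub>R v \<in> S" using inS[of t h] inS[of t 0] t h by auto
    have "((\<lambda>t. u (x + t *\<^sub>R v + h *\<^sub>R w) - u (x + t *\<^sub>R v)) has_derivative
      (\<lambda>s. fderiv u (x + t *\<^sub>R v + h *\<^sub>R w) (s *\<^sub>R v) -
           fderiv u (x + t *\<^sub>R v) (s *\<^sub>R v))) (at t)"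
      by (intro has_derivative_diff has_derivative_compose[OF 1] has_derivative_compose[OF 2] D i)
    then show "((\<lambda>t. u (x + t *\<^sub>R v + h *\<^sub>R w) - u (x + t *\<^sub>R v)) has_real_derivative
        W (x + t *\<^sub>R v + h *\<^sub>R w) - W (x + t *\<^sub>R v)) (at t)"
      unfolding has_field_derivative_def
      by (rule has_derivative_eq_rhs) (use i in \<open>simp add: lin W_def fun_eq_iff algebra_simps\<close>)
  qed
  then obtain a where a: "0 < a" "a < h" "u (x + h *\<^sub>R v + h *\<^sub>R w) - u (x + h *\<^sub>R v) -
       (u (x + h *\<^sub>R w) - u x) = h * (W (x + a *\<^sub>R v + h *\<^sub>R w) - W (x + a *\<^sub>R v))" by auto
  have "\<exists>z>0. z < h \<and> W (x + a *\<^sub>R v + h *\<^sub>R w) - W (x + a *\<^sub>R v + 0 *\<^sub>R w) =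
      (h - 0) * fderiv W (x + a *\<^sub>R v + z *\<^sub>R w) w"
  proof (rule MVT2[OF h])
    fix t assume t: "0 \<le> t" "t \<le> h"
    have 1: "((\<lambda>t. x + a *\<^sub>R v + t *\<^sub>R w) has_derivative (\<lambda>s. s *\<^sub>R w)) (at t)"
      by (auto intro!: derivative_eq_intros)
    have i: "x + a *\<^sub>R v + t *\<^sub>R w \<in> S" using inS[of a t] t a by auto
    have "((\<lambda>t. W (x + a *\<^sub>R v + t *\<^sub>R w)) has_derivative
      (\<lambda>s. fderiv W (x + a *\<^sub>R v + t *\<^sub>R w) (s *\<^sub>R w))) (at t)"
      by (intro has_derivative_compose[OF 1] DW i)
    then show "((\<lambda>t. W (x + a *\<^sub>R v + t *\<^sub>R w)) has_real_derivative
        fderiv W (x + a *\<^sub>R v + t *\<^sub>R w) w) (at t)"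
      unfolding has_field_derivative_def
      by (rule has_derivative_eq_rhs) (use i in \<open>simp add: linW fun_eq_iff\<close>)
  qed
  then obtain b where b: "0 < b" "b < h" "W (x + a *\<^sub>R v + h *\<^sub>R w) - W (x + a *\<^sub>R v) =
      h * fderiv W (x + a *\<^sub>R v + b *\<^sub>R w) w" by auto
  show ?thesis
    apply (rule exI[of _ "x + a *\<^sub>R v + b *\<^sub>R w"])
    using a b bd[of a b] by (simp add: W_def power2_eq_square algebra_simps)
qed

lemma fderiv_symmetric_real:
  fixes u :: "'a::real_normed_vector \<Rightarrow> real"
  assumes S: "open S" "smooth_on S u" "x \<in> S"
  shows "fderiv (\<lambda>x. fderiv u x v) x w =
    fderiv (\<lambda>x. fderiv u x w) x v"
proof (rule ccontr)
  let ?A = "\<lambda>y. fderiv (\<lambda>x. fderiv u x v) y w"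
  let ?B = "\<lambda>y. fderiv (\<lambda>x. fderiv u x w) y v"
  assume ne: "?A x \<noteq> ?B x"
  \<comment> \<open>Half the distance, so that one estimate at each of the two intermediate points
    contradicts it.\<close>
  define e where "e = dist (?A x) (?B x) / 2"
  have e: "e > 0" using ne by (simp add: e_def)
  have cA: "continuous_on S ?A" and cB: "continuous_on S ?B"
    by (intro smooth_continuous_on smooth_on_fderiv S)+
  from continuous_on_iff[THEN iffD1, OF cA, rule_format, OF S(3) e] obtain d1 where
    d1: "d1 > 0" "\<And>y. y \<in> S \<Longrightarrow> dist y x < d1 \<Longrightarrow> dist (?A y) (?A x) < e" by auto
  from continuous_on_iff[THEN iffD1, OF cB, rule_format, OF S(3) e] obtain d2 where
    d2: "d2 > 0" "\<And>y. y \<in> S \<Longrightarrow> dist y x < d2 \<Longrightarrow> dist (?B y) (?B x) < e" by auto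
  obtain r where r: "r > 0" "ball x r \<subseteq> S" using S open_contains_ball by blast
  define m where "m = min r (min d1 d2) / 2"
  have m: "m > 0" "m < r" "m < d1" "m < d2" using r d1 d2 by (auto simp: m_def)
  \<comment> \<open>The summand 1 keeps the quotient meaningful when \<open>v\<close> and
    \<open>w\<close> both vanish.\<close>
  define h where "h = m / (norm v + norm w + 1)"
  have pos: "norm v + norm w + 1 > 0" by (simp add: add_nonneg_pos)
  have h: "h > 0" using m pos by (simp add: h_def)
  have hm: "h * (norm v + norm w) \<le> m"
    using m pos by (simp add: h_def field_simps)
  have sub: "ball x (h * (norm v + norm w) + (r - m)) \<subseteq> S"
    by (rule subset_trans[OF subset_ball r(2)]) (use hm in simp)
  have sub': "ball x (h * (norm w + norm v) + (r - m)) \<subseteq> S" using sub by (simp add: add.commute)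
  obtain y where y: "norm (y - x) \<le> h * (norm v + norm w)"
     "u (x + h *\<^sub>R v + h *\<^sub>R w) - u (x + h *\<^sub>R v) - u (x + h *\<^sub>R w) + u x = h\<^sup>2 * ?A y"
    using second_difference[OF S(1,2) h sub] m by auto
  obtain z where z: "norm (z - x) \<le> h * (norm w + norm v)"
     "u (x + h *\<^sub>R w + h *\<^sub>R v) - u (x + h *\<^sub>R w) - u (x + h *\<^sub>R v) + u x = h\<^sup>2 * ?B z"
    using second_difference[OF S(1,2) h sub'] m by auto
  have "h\<^sup>2 * ?A y = h\<^sup>2 * ?B z" using y(2) z(2) by (simp add: algebra_simps)
  then have eq: "?A y = ?B z" using h by simp
  have "norm (z - x) \<le> m" using z(1) hm by (simp add: add.commute)
  then have "y \<in> S" "z \<in> S" "dist y x < d1" "dist z x < d2"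
    using y z hm m r by (auto simp: dist_norm norm_minus_commute subset_iff)
  then have "dist (?A y) (?A x) < e" "dist (?B z) (?B x) < e" using d1(2) d2(2) by auto
  then have "dist (?A x) (?B x) < e + e"
    using eq unfolding dist_real_def by linarith
  then show False by (simp add: e_def)
qed

lemma fderiv_symmetric:
  fixes u :: "'a::real_normed_vector \<Rightarrow> 'b::euclidean_space"
  assumes S: "open S" "smooth_on S u" "x \<in> S"
  shows "fderiv (\<lambda>x. fderiv u x v) x w =
    fderiv (\<lambda>x. fderiv u x w) x v"
proof (rule euclidean_eqI)
  fix b :: 'b assume "b \<in> Basis"
  have 1: "fderiv (\<lambda>x. fderiv (\<lambda>x. u x \<bullet> b) x v) x w =
     fderiv (\<lambda>x. fderiv u x v) x w \<bullet> b" for v w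
  proof -
    have i: "fderiv (\<lambda>x. u x \<bullet> b) y v = fderiv u y v \<bullet> b" if "y \<in> S" for y
      using has_derivative_inner_left[OF smooth_has_fderiv[OF S(1,2) that]]
      by (rule fderiv_eqI)
    have s: "smooth_on S (\<lambda>x. fderiv u x v)" by (rule smooth_on_fderiv[OF S(2)])
    have "fderiv (\<lambda>x. fderiv u x v \<bullet> b) x w =
        fderiv (\<lambda>x. fderiv u x v) x w \<bullet> b"
      using has_derivative_inner_left[OF smooth_has_fderiv[OF S(1) s S(3)]]
      by (rule fderiv_eqI)
    moreover have "fderiv (\<lambda>x. fderiv (\<lambda>x. u x \<bullet> b) x v) x =
       fderiv (\<lambda>x. fderiv u x v \<bullet> b) x"
      using i S by (intro fderiv_cong[of S]) (auto intro!: smooth_on_fderiv smooth_on_inner smooth_on_const)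
    ultimately show ?thesis by simp
  qed
  have "smooth_on S (\<lambda>x. u x \<bullet> b)" by (intro smooth_on_inner smooth_on_const S)
  from fderiv_symmetric_real[OF S(1) this S(3), of v w] show
   "fderiv (\<lambda>x. fderiv u x v) x w \<bullet> b =
    fderiv (\<lambda>x. fderiv u x w) x v \<bullet> b"
    by (simp only: 1)
qed

text \<open>In \<open>fderiv u z (X z)\<close> the point \<open>z\<close> enters twice, which
  produces a Hessian term and the derivative of \<open>u\<close> along the change of
  \<open>X\<close>. The sum over \<open>Basis\<close> separates the two.\<close>

lemma lie_lie:
  fixes u :: "'a::euclidean_space \<Rightarrow> 'b::euclidean_space"
  assumes S: "open S" "smooth_on S u" "smooth_on S X" "x \<in> S"
  shows "lie Y (lie X u) x =
     fderiv (\<lambda>z. fderiv u z (X x)) x (Y x) +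
     fderiv u x (lie Y X x)"
proof -
  let ?D = "\<lambda>b z. fderiv u z b"
  have sD: "smooth_on S (?D b)" for b by (rule smooth_on_fderiv[OF S(2)])
  note DD = smooth_has_fderiv[OF S(1) sD S(4)]
  note DX = smooth_has_fderiv[OF S(1,3,4)]
  have c: "fderiv (lie X u) x =
      fderiv (\<lambda>z. \<Sum>b\<in>Basis. (X z \<bullet> b) *\<^sub>R ?D b z) x"
    by (rule fderiv_cong[OF S(1) smooth_on_lie[OF S(1-3)] S(4)])
      (simp add: lie_def flip: fderiv_expand[OF S(1,2)])
  have "((\<lambda>z. \<Sum>b\<in>Basis. (X z \<bullet> b) *\<^sub>R ?D b z) has_derivative
     (\<lambda>v. \<Sum>b\<in>Basis. (X x \<bullet> b) *\<^sub>R fderiv (?D b) x v + (fderiv X x v \<bullet> b) *\<^sub>R ?D b x)) (at x)"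
    by (intro has_derivative_sum has_derivative_scaleR has_derivative_inner_left DX DD)
  then have 1: "lie Y (lie X u) x =
      (\<Sum>b\<in>Basis. (X x \<bullet> b) *\<^sub>R fderiv (?D b) x (Y x)) + ?D (lie Y X x) x"
    unfolding lie_def[of Y "lie X u"] c
    by (subst fderiv_eqI, assumption)
       (simp add: sum.distrib lie_def flip: fderiv_expand[OF S(1,2,4)])
  have "fderiv (\<lambda>z. ?D (X x) z) x = fderiv (\<lambda>z. \<Sum>b\<in>Basis. (X x \<bullet> b) *\<^sub>R ?D b z) x"
    by (rule fderiv_cong[OF S(1) sD S(4)])
      (simp flip: fderiv_expand[OF S(1,2)])
  moreover have "((\<lambda>z. \<Sum>b\<in>Basis. (X x \<bullet> b) *\<^sub>R ?D b z) has_derivative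
     (\<lambda>v. \<Sum>b\<in>Basis. (X x \<bullet> b) *\<^sub>R fderiv (?D b) x v)) (at x)"
    by (intro has_derivative_sum has_derivative_scaleR_right DD)
  ultimately show ?thesis unfolding 1 by (simp add: fderiv_eqI)
qed

text \<open>The Hessian terms cancel by symmetry; what remains is the derivative along the Lie
  bracket.\<close>

lemma lie_commutator:
  fixes u :: "'a::euclidean_space \<Rightarrow> 'b::euclidean_space"
  assumes S: "open S" "smooth_on S u" "smooth_on S X" "smooth_on S Y" "x \<in> S"
  shows "lie Y (lie X u) x - lie X (lie Y u) x =
     fderiv u x (lie Y X x - lie X Y x)"
  using lie_lie[OF S(1,2,3,5), of Y] lie_lie[OF S(1,2,4,5), of X]
    fderiv_symmetric[OF S(1,2,5), of "X x" "Y x"]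
    linear_diff[OF has_derivative_linear[OF smooth_has_fderiv[OF S(1,2,5)]]]
  by simp

lemma lie_add: "open S \<Longrightarrow> x \<in> S \<Longrightarrow> smooth_on S u \<Longrightarrow> smooth_on S w \<Longrightarrow>
    lie X (\<lambda>y. u y + w y) x = lie X u x + lie X w x"
  unfolding lie_def
  by (rule fderiv_eqI) (intro has_derivative_add smooth_has_fderiv)

lemma lie_diff: "open S \<Longrightarrow> x \<in> S \<Longrightarrow> smooth_on S u \<Longrightarrow> smooth_on S w \<Longrightarrow>
    lie X (\<lambda>y. u y - w y) x = lie X u x - lie X w x"
  unfolding lie_def
  by (rule fderiv_eqI) (intro has_derivative_diff smooth_has_fderiv)

lemma lie_bilinear: "open S \<Longrightarrow> x \<in> S \<Longrightarrow> bounded_bilinear B \<Longrightarrow> smooth_on S u \<Longrightarrow> smooth_on S w \<Longrightarrow>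
    lie X (\<lambda>y. B (u y) (w y)) x = B (u x) (lie X w x) + B (lie X u x) (w x)"
  unfolding lie_def
  by (rule fderiv_eqI[OF bounded_bilinear.FDERIV]) (intro smooth_has_fderiv | assumption)+

lemmas lie_inner = lie_bilinear[OF _ _ bounded_bilinear_inner]
lemmas lie_mult = lie_bilinear[OF _ _ bounded_bilinear_mult]
lemmas lie_scaleR = lie_bilinear[OF _ _ bounded_bilinear_scaleR]

lemma lie_bounded_linear: "open S \<Longrightarrow> x \<in> S \<Longrightarrow> bounded_linear L \<Longrightarrow> smooth_on S u \<Longrightarrow>
    lie X (\<lambda>y. L (u y)) x = L (lie X u x)"
  unfolding lie_def
  by (rule fderiv_eqI[OF bounded_linear.has_derivative]) (intro smooth_has_fderiv | assumption)+

lemma lie_const [simp]: "lie X (\<lambda>y. c) x = 0"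
  by (simp add: lie_def)

lemma lie_cong:
  assumes "open S" "x \<in> S" "smooth_on S u" "\<And>y. y \<in> S \<Longrightarrow> u y = w y"
  shows "lie X u x = lie X w x"
  unfolding lie_def using fderiv_cong[OF assms(1,3,2,4)] by simp

lemma zero_if_mult_zero_dense:
  fixes g s :: "'a::metric_space \<Rightarrow> real"
  assumes "continuous_on M g" "\<And>y. y \<in> M \<Longrightarrow> s y * g y = 0"
    and "\<And>x e. x \<in> M \<Longrightarrow> e > 0 \<Longrightarrow> \<exists>z\<in>M \<inter> ball x e. s z \<noteq> 0" "x \<in> M"
  shows "g x = 0"
proof (rule ccontr)
  assume ne: "g x \<noteq> 0"
  from continuous_on_iff[THEN iffD1, OF assms(1), rule_format, OF assms(4), of "\<bar>g x\<bar>"]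
  obtain e where e: "e > 0" "\<And>y. y \<in> M \<Longrightarrow> dist y x < e \<Longrightarrow> dist (g y) (g x) < \<bar>g x\<bar>"
    using ne by auto
  obtain z where z: "z \<in> M" "dist z x < e" "s z \<noteq> 0"
    using assms(3)[OF assms(4) e(1)] by (auto simp: dist_commute)
  then have "g z = 0" using assms(2) by force
  then show False using e(2)[OF z(1,2)] by (simp add: dist_real_def)
qed

section \<open>Linear algebra of \<open>\<complex>\<^sup>2\<close>\<close>

lemma J_add: "J (a + b) = J a + J b" and J_scaleR: "J (r *\<^sub>R a) = r *\<^sub>R J a"
  and J_minus: "J (- a) = - J a"
  using linear_add[OF linear_J] linear_scale[OF linear_J] linear_neg[OF linear_J]
  by auto

lemma J_J: "J (J a) = - a"
  by (simp add: J_def prod_eq_iff)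

lemma inner_J_left: "J a \<bullet> b = - (a \<bullet> J b)"
  by (simp add: J_def inner_prod_def inner_complex_def algebra_simps)

lemma inner_J_J: "J a \<bullet> J b = a \<bullet> b"
  by (simp add: inner_J_left J_J)

lemma inner_J_self: "a \<bullet> J a = 0"
  using J_tangent[of a] by (simp only: inner_commute)

lemma bounded_linear_J: "bounded_linear J"
  using linear_J by (simp add: linear_conv_bounded_linear)

lemma orthonormal_eqI:
  fixes p q r s :: C2
  assumes "p \<bullet> p = 1" "q \<bullet> q = 1" "r \<bullet> r = 1" "s \<bullet> s = 1"
    and "p \<bullet> q = 0" "p \<bullet> r = 0" "p \<bullet> s = 0" "q \<bullet> r = 0" "q \<bullet> s = 0" "r \<bullet> s = 0"
    and "u \<bullet> p = w \<bullet> p" "u \<bullet> q = w \<bullet> q" "u \<bullet> r = w \<bullet> r" "u \<bullet> s = w \<bullet> s"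
  shows "u = w"
proof -
  let ?B = "{p, q, r, s}"
  have nz: "0 \<notin> ?B" using assms(1-4) by auto
  have po: "pairwise orthogonal ?B"
    using assms(5-10) by (auto simp: pairwise_def orthogonal_def inner_commute)
  have ind: "independent ?B" using pairwise_orthogonal_independent[OF po nz] .
  have dist: "p \<noteq> q" "p \<noteq> r" "p \<noteq> s" "q \<noteq> r" "q \<noteq> s" "r \<noteq> s" using assms by auto
  have "card ?B = DIM(C2)" using dist by simp
  then have span: "span ?B = UNIV"
    using card_ge_dim_independent[of ?B UNIV] ind by (auto simp: dim_UNIV)
  have "orthogonal (u - w) (u - w)"
    by (rule orthogonal_to_span[of _ ?B])
       (use span assms(11-14) in \<open>auto simp: orthogonal_def inner_diff_left inner_diff_right inner_commute\<close>)
  then show ?thesis by (simp add: orthogonal_def)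
qed

text \<open>If \<open>(p, e)\<close> is a unitary frame, then \<open>p\<close>, \<open>e\<close>,
  \<open>J p\<close>, \<open>J e\<close> form a real orthonormal basis.\<close>

lemma unitary_basis_eqI:
  assumes "p \<bullet> p = 1" "e \<bullet> e = 1" "p \<bullet> e = 0" "e \<bullet> J p = 0"
    and "u \<bullet> p = w \<bullet> p" "u \<bullet> e = w \<bullet> e" "u \<bullet> J p = w \<bullet> J p" "u \<bullet> J e = w \<bullet> J e"
  shows "u = w"
proof (rule orthonormal_eqI[of p e "J p" "J e"])
  show "p \<bullet> J e = 0" using assms(4) inner_J_left[of p e] by (simp add: inner_commute)
qed (use assms in \<open>simp_all add: inner_J_J inner_J_self\<close>)

text \<open>Since \<open>L a\<close> and \<open>L b\<close> are orthonormal, \<open>a\<close> and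
  \<open>b\<close> are a basis of the plane, and coordinates can be measured in the image.\<close>

lemma span_pair:
  fixes L :: "real^2 \<Rightarrow> C2"
  assumes "linear L" "L a \<bullet> L a = 1" "L b \<bullet> L b = 1" "L a \<bullet> L b = 0"
  shows "z = (L z \<bullet> L a) *\<^sub>R a + (L z \<bullet> L b) *\<^sub>R b"
proof -
  have ne: "a \<noteq> b" using assms by auto
  have c0: "\<alpha> = 0 \<and> \<beta> = 0" if "\<alpha> *\<^sub>R a + \<beta> *\<^sub>R b = 0" for \<alpha> \<beta>
  proof -
    have "\<alpha> *\<^sub>R L a + \<beta> *\<^sub>R L b = 0"
      using that assms(1) by (metis linear_0 linear_add linear_scale)
    then have "(\<alpha> *\<^sub>R L a + \<beta> *\<^sub>R L b) \<bullet> L a = 0" "(\<alpha> *\<^sub>R L a + \<beta> *\<^sub>R L b) \<bullet> L b = 0" by simp_all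
    then show ?thesis using assms by (simp add: inner_add_left inner_commute[of "L b" "L a"])
  qed
  have "independent {a, b}"
  proof (rule independent_if_scalars_zero)
    fix g x assume "(\<Sum>x\<in>{a, b}. g x *\<^sub>R x) = 0" "x \<in> {a, b}"
    then show "g x = 0" using ne c0[of "g a" "g b"] by auto
  qed simp
  then have "span {a, b} = UNIV"
    using card_ge_dim_independent[of "{a, b}" UNIV] ne by (auto simp: dim_UNIV)
  then obtain \<alpha> \<beta> where z: "z = \<alpha> *\<^sub>R a + \<beta> *\<^sub>R b"
    unfolding span_insert by (force simp: algebra_simps)
  then have "L z = \<alpha> *\<^sub>R L a + \<beta> *\<^sub>R L b"
    using assms(1) by (simp add: linear_add linear_scale)
  then show ?thesis using assms z by (simp add: inner_add_left inner_commute[of "L b" "L a"])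
qed

lemma fderiv_span_pair:
  fixes f :: "real^2 \<Rightarrow> C2" and u :: "real^2 \<Rightarrow> 'b::real_normed_vector"
  assumes "linear (fderiv f x)" "linear (fderiv u x)"
    and "lie X f x \<bullet> lie X f x = 1" "lie Y f x \<bullet> lie Y f x = 1" "lie X f x \<bullet> lie Y f x = 0"
  shows "fderiv u x v = (fderiv f x v \<bullet> lie X f x) *\<^sub>R lie X u x + (fderiv f x v \<bullet> lie Y f x) *\<^sub>R lie Y u x"
proof -
  have "v = (fderiv f x v \<bullet> lie X f x) *\<^sub>R X x + (fderiv f x v \<bullet> lie Y f x) *\<^sub>R Y x"
    unfolding lie_def by (rule span_pair[OF assms(1)]) (use assms(3-) in \<open>simp_all add: lie_def\<close>)
  then have "fderiv u x v = fderiv u x ((fderiv f x v \<bullet> lie X f x) *\<^sub>R X x + (fderiv f x v \<bullet> lie Y f x) *\<^sub>R Y x)"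
    by (rule arg_cong)
  then show ?thesis by (simp only: linear_add[OF assms(2)] linear_scale[OF assms(2)] lie_def)
qed

text \<open>The standard Hermitian product, antilinear in the second argument; \<open>hm_eq\<close>
  gives its real and imaginary parts.\<close>

definition hm :: "C2 \<Rightarrow> C2 \<Rightarrow> complex" where
  "hm u v = fst u * cnj (fst v) + snd u * cnj (snd v)"

lemma bounded_linear_hm: "bounded_linear (\<lambda>u. hm u v)"
  unfolding hm_def
  by (intro bounded_linear_add bounded_linear_compose[OF bounded_linear_mult_left]
    bounded_linear_fst bounded_linear_snd)

lemma hm_add: "hm (a + b) v = hm a v + hm b v" and hm_scaleR: "hm (r *\<^sub>R a) v = r *\<^sub>R hm a v"
  and hm_minus: "hm (- a) v = - hm a v" and hm_J: "hm (J a) v = \<i> * hm a v"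
  and hm_add_right: "hm v (a + b) = hm v a + hm v b" and hm_scaleR_right: "hm v (r *\<^sub>R a) = r *\<^sub>R hm v a"
  and cnj_hm: "cnj (hm a v) = hm v a"
  by (simp_all add: hm_def J_def algebra_simps scaleR_conv_of_real)

lemma hm_eq: "hm u v = Complex (u \<bullet> v) (u \<bullet> J v)"
  by (simp add: hm_def J_def inner_prod_def inner_complex_def complex_eq_iff)

section \<open>Adapted frames\<close>

lemma smooth_on_J: "open S \<Longrightarrow> smooth_on S u \<Longrightarrow> smooth_on S (\<lambda>x. J (u x))"
  by (rule smooth_on_bounded_linear[OF _ bounded_linear_J])

lemma smooth_on_hm: "open S \<Longrightarrow> smooth_on S u \<Longrightarrow> smooth_on S (\<lambda>x. hm (u x) v)"
  by (rule smooth_on_bounded_linear[OF _ bounded_linear_hm])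

lemma smooth_on_cnj: "open S \<Longrightarrow> smooth_on S u \<Longrightarrow> smooth_on S (\<lambda>x. cnj (u x))"
  by (rule smooth_on_bounded_linear[OF _ bounded_linear_cnj])

lemmas smooth_intros = smooth_on_J smooth_on_hm smooth_on_cnj smooth_on_add smooth_on_diff smooth_on_minus
  smooth_on_mult smooth_on_scaleR smooth_on_inner smooth_on_power2 smooth_on_const smooth_on_lie

lemmas lie_J = lie_bounded_linear[OF _ _ bounded_linear_J]
lemmas lie_hm = lie_bounded_linear[OF _ _ bounded_linear_hm]
lemmas lie_cnj = lie_bounded_linear[OF _ _ bounded_linear_cnj]
lemmas lie_minus = lie_bounded_linear[OF _ _ bounded_linear_minus[OF bounded_linear_ident]]
lemmas lie_simps = lie_add lie_diff lie_minus lie_inner lie_mult lie_scaleR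
  lie_J lie_hm lie_cnj

text \<open>The field \<open>E\<close> is horizontal, and \<open>k J f - s J E\<close> is the unit normal of the surface, so that the
  assumptions on second derivatives say that \<open>E\<close> and \<open>T\<close> are asymptotic directions.\<close>

locale adapted_frame =
  fixes M :: "(real^2) set" and f :: "real^2 \<Rightarrow> C2" and X Y :: "real^2 \<Rightarrow> real^2"
    and E T :: "real^2 \<Rightarrow> C2" and s k d :: "real^2 \<Rightarrow> real"
  defines "E \<equiv> lie X f" and "T \<equiv> lie Y f"
    and "s \<equiv> \<lambda>x. T x \<bullet> J (f x)" and "k \<equiv> \<lambda>x. T x \<bullet> J (E x)" and "d \<equiv> \<lambda>x. lie Y E x \<bullet> J (E x)"
  assumes op: "open M" and smf: "smooth_on M f" and smX: "smooth_on M X" and smY: "smooth_on M Y"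
    and ff: "x \<in> M \<Longrightarrow> f x \<bullet> f x = 1" and EE: "x \<in> M \<Longrightarrow> E x \<bullet> E x = 1"
    and TT: "x \<in> M \<Longrightarrow> T x \<bullet> T x = 1" and ET: "x \<in> M \<Longrightarrow> E x \<bullet> T x = 0"
    and EJf: "x \<in> M \<Longrightarrow> E x \<bullet> J (f x) = 0"
    and XX: "x \<in> M \<Longrightarrow> lie X E x \<bullet> (k x *\<^sub>R J (f x) - s x *\<^sub>R J (E x)) = 0"
    and YY: "x \<in> M \<Longrightarrow> lie Y T x \<bullet> (k x *\<^sub>R J (f x) - s x *\<^sub>R J (E x)) = 0"
    and dense: "x \<in> M \<Longrightarrow> e > 0 \<Longrightarrow> \<exists>z\<in>M \<inter> ball x e. s z \<noteq> 0"
begin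

lemma smE: "smooth_on M E" and smT: "smooth_on M T"
  unfolding E_def T_def by (intro smooth_on_lie op smf smX smY)+

lemma sms: "smooth_on M s" and smk: "smooth_on M k" and smd: "smooth_on M d"
  unfolding s_def k_def d_def by (intro smooth_intros op smf smE smT smX smY)+

lemmas sm = op smf smE smT smX smY sms smk smd

lemma lie_zero:
  assumes "x \<in> M" "smooth_on M u" "\<And>y. y \<in> M \<Longrightarrow> u y = c"
  shows "lie Z u x = 0"
  using lie_cong[OF op assms(1,2), of "\<lambda>_. c" Z] assms(3) by simp

text \<open>Division by \<open>s\<close> even at points where it vanishes, by density and
  continuity.\<close>

lemma zero_if_mult_zero:
  assumes "continuous_on M g" "\<And>y. y \<in> M \<Longrightarrow> s y * g y = 0" "x \<in> M"
  shows "g x = (0::real)"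
  by (rule zero_if_mult_zero_dense[OF assms(1,2) dense assms(3)])

context
  fixes x assumes x: "x \<in> M"
begin

lemma fE: "f x \<bullet> E x = 0" and fT: "f x \<bullet> T x = 0"
proof -
  have "lie Z (\<lambda>y. f y \<bullet> f y) x = 2 * (f x \<bullet> lie Z f x)" for Z
    using lie_inner[OF op x smf smf, of Z] by (simp add: inner_commute)
  moreover have "lie Z (\<lambda>y. f y \<bullet> f y) x = 0" for Z
    by (rule lie_zero[OF x, of _ 1]) (intro smooth_intros sm | simp add: ff)+
  ultimately show "f x \<bullet> E x = 0" "f x \<bullet> T x = 0"
    unfolding E_def T_def by (metis mult_eq_0_iff zero_neq_numeral)+
qed

lemmas vec_eqI = unitary_basis_eqI[OF ff[OF x] EE[OF x] fE EJf[OF x]]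

lemma inner_values:
  "f x \<bullet> f x = 1" "E x \<bullet> E x = 1" "f x \<bullet> E x = 0" "E x \<bullet> f x = 0" "E x \<bullet> J (f x) = 0" "f x \<bullet> J (E x) = 0"
  "J (f x) \<bullet> f x = 0" "J (E x) \<bullet> E x = 0" "f x \<bullet> J (f x) = 0" "E x \<bullet> J (E x) = 0"
  "J (f x) \<bullet> E x = 0" "J (E x) \<bullet> f x = 0" "J (f x) \<bullet> J (f x) = 1" "J (E x) \<bullet> J (E x) = 1"
  "J (f x) \<bullet> J (E x) = 0" "J (E x) \<bullet> J (f x) = 0"
  using ff[OF x] EE[OF x] fE EJf[OF x] inner_J_left[of "f x" "E x"]
  by (simp_all add: inner_J_J inner_J_self J_tangent inner_commute)

lemma T_eq: "T x = s x *\<^sub>R J (f x) + k x *\<^sub>R J (E x)"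
proof -
  have "T x \<bullet> f x = 0" "T x \<bullet> E x = 0" using fT ET[OF x] by (simp_all add: inner_commute)
  then show ?thesis
    by (intro vec_eqI) (simp_all add: inner_add_left inner_values s_def k_def)
qed

lemma sk: "(s x)\<^sup>2 + (k x)\<^sup>2 = 1"
  using TT[OF x] unfolding T_eq by (simp add: inner_add_left inner_add_right inner_values power2_eq_square)

end

section \<open>Structure equations of an adapted frame\<close>

lemma E_inner:
  assumes x: "x \<in> M"
  shows "lie Z E x \<bullet> f x = - (E x \<bullet> lie Z f x)" "lie Z E x \<bullet> E x = 0"
    "lie Z E x \<bullet> J (f x) = - (E x \<bullet> J (lie Z f x))"
proof -
  have 1: "lie Z (\<lambda>y. E y \<bullet> f y) x = 0"
    by (rule lie_zero[OF x, of _ 0]) (intro smooth_intros sm | simp add: inner_values)+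
  have 2: "lie Z (\<lambda>y. E y \<bullet> E y) x = 0"
    by (rule lie_zero[OF x, of _ 1]) (intro smooth_intros sm | simp add: inner_values)+
  have 3: "lie Z (\<lambda>y. E y \<bullet> J (f y)) x = 0"
    by (rule lie_zero[OF x, of _ 0]) (intro smooth_intros sm | simp add: inner_values)+
  show "lie Z E x \<bullet> f x = - (E x \<bullet> lie Z f x)"
    using 1 lie_inner[OF op x smE smf, of Z] by simp
  show "lie Z E x \<bullet> E x = 0"
    using 2 lie_inner[OF op x smE smE, of Z] by (simp add: inner_commute)
  show "lie Z E x \<bullet> J (f x) = - (E x \<bullet> J (lie Z f x))"
    using 3 lie_inner[OF op x smE smooth_on_J[OF op smf], of Z] lie_J[OF op x smf, of Z] by simp
qed

text \<open>This is the equation of a great circle. The \<open>J f\<close> component vanishes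
  because \<open>E\<close> is horizontal, and the asymptotic condition gives \<open>s\<close> times
  the \<open>J E\<close> component.\<close>

lemma E_X: assumes x: "x \<in> M" shows "lie X E x = - f x"
proof -
  let ?g = "\<lambda>x. lie X E x \<bullet> J (E x)"
  have "?g x = 0"
  proof (rule zero_if_mult_zero[OF _ _ x])
    show "continuous_on M ?g" by (intro smooth_continuous_on smooth_intros sm)
    show "s y * ?g y = 0" if "y \<in> M" for y
      using XX[OF that] E_inner(3)[OF that, of X] by (simp add: inner_diff_right inner_J_self flip: E_def)
  qed
  then show ?thesis
    by (intro vec_eqI[OF x]) (use E_inner[OF x, of X] x in \<open>simp_all add: inner_values flip: E_def\<close>)
qed

lemma E_Y: assumes x: "x \<in> M" shows "lie Y E x = k x *\<^sub>R J (f x) + d x *\<^sub>R J (E x)"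
  by (rule vec_eqI[OF x])
    (use E_inner[OF x, of Y] x in \<open>simp_all add: inner_values inner_add_left inner_add_right inner_diff_right J_add J_scaleR J_J T_eq d_def
      flip: T_def\<close>)

lemma s_k_lie: assumes x: "x \<in> M" shows "s x * lie Z s x + k x * lie Z k x = 0"
proof -
  have "lie Z (\<lambda>y. s y * s y + k y * k y) x = 0"
    by (rule lie_zero[OF x, of _ 1]) (intro smooth_intros sm | use sk in \<open>simp add: power2_eq_square\<close>)+
  then show ?thesis
    using x by (simp add: lie_simps[OF op x] smooth_intros sm)
qed

lemma T_lie: assumes x: "x \<in> M"
  shows "lie Z T x = lie Z s x *\<^sub>R J (f x) + s x *\<^sub>R J (lie Z f x)
      + lie Z k x *\<^sub>R J (E x) + k x *\<^sub>R J (lie Z E x)"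
proof -
  have "lie Z T x = lie Z (\<lambda>y. s y *\<^sub>R J (f y) + k y *\<^sub>R J (E y)) x"
    by (rule lie_cong[OF op x smT T_eq])
  then show ?thesis using x by (simp add: lie_simps[OF op x] smooth_intros sm)
qed

lemma lin: "smooth_on M u \<Longrightarrow> x \<in> M \<Longrightarrow> linear (fderiv u x)"
  using smooth_has_fderiv[OF op] has_derivative_linear by blast

lemma frame_expand:
  fixes u :: "real^2 \<Rightarrow> 'b::real_normed_vector"
  assumes x: "x \<in> M" and u: "smooth_on M u"
  shows "fderiv u x v = (fderiv f x v \<bullet> E x) *\<^sub>R lie X u x + (fderiv f x v \<bullet> T x) *\<^sub>R lie Y u x"
  using fderiv_span_pair[OF lin[OF smf x] lin[OF u x]] EE[OF x] TT[OF x] ET[OF x] unfolding E_def T_def by blast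

lemma commutator:
  fixes u :: "real^2 \<Rightarrow> 'b::euclidean_space"
  assumes x: "x \<in> M" and u: "smooth_on M u"
  defines "W \<equiv> fderiv f x (lie Y X x - lie X Y x)"
  shows "lie Y (lie X u) x - lie X (lie Y u) x = (W \<bullet> E x) *\<^sub>R lie X u x + (W \<bullet> T x) *\<^sub>R lie Y u x"
  unfolding lie_commutator[OF op u smX smY x] W_def by (rule frame_expand[OF x u])

text \<open>The bracket of \<open>Y\<close> and \<open>X\<close> turns out to be \<beta> times
  \<open>Y\<close>, by the last two claims of \<open>structure_X\<close>.\<close>

definition \<beta> :: "real^2 \<Rightarrow> real" where "\<beta> x = k x * (s x + d x)"

text \<open>Equality of the mixed derivatives of \<open>f\<close> up to the bracket, compared along
  \<open>E\<close>, \<open>J f\<close> and \<open>J E\<close>. The coefficient \<open>b\<close> is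
  found by eliminating the derivatives of \<open>s\<close> and \<open>k\<close> by means of
  \<open>s_k_lie\<close>.\<close>

lemma structure_X:
  assumes x: "x \<in> M"
  shows "lie X s x = 2 * k x - s x * \<beta> x" "lie X k x = d x - s x - k x * \<beta> x"
    "fderiv f x (lie Y X x - lie X Y x) \<bullet> E x = 0"
    "fderiv f x (lie Y X x - lie X Y x) \<bullet> T x = \<beta> x"
proof -
  define a where "a = fderiv f x (lie Y X x - lie X Y x) \<bullet> E x"
  define b where "b = fderiv f x (lie Y X x - lie X Y x) \<bullet> T x"
  have eq: "lie Y E x - lie X T x = a *\<^sub>R E x + b *\<^sub>R T x"
    using commutator[OF x smf] by (simp add: a_def b_def flip: E_def T_def)
  have TX: "lie X T x = (lie X s x - k x) *\<^sub>R J (f x) + (s x + lie X k x) *\<^sub>R J (E x)"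
    using T_lie[OF x, of X] E_X[OF x] by (simp add: J_minus algebra_simps flip: E_def)
  note eq' = eq[unfolded TX E_Y[OF x] T_eq[OF x]]
  have a0: "a = 0"
    using arg_cong[OF eq', of "\<lambda>v. v \<bullet> E x"] x
    by (simp add: inner_values inner_add_left inner_diff_left)
  have e1: "2 * k x - lie X s x = b * s x"
    using arg_cong[OF eq', of "\<lambda>v. v \<bullet> J (f x)"] x
    by (simp add: inner_values inner_add_left inner_diff_left)
  have e2: "d x - s x - lie X k x = b * k x"
    using arg_cong[OF eq', of "\<lambda>v. v \<bullet> J (E x)"] x
    by (simp add: inner_values inner_add_left inner_diff_left)
  have "b * ((s x)\<^sup>2 + (k x)\<^sup>2) = s x * (2 * k x - lie X s x) + k x * (d x - s x - lie X k x)"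
    unfolding e1 e2 by (simp add: power2_eq_square algebra_simps)
  also have "\<dots> = \<beta> x" using s_k_lie[OF x, of X] by (simp add: \<beta>_def algebra_simps)
  finally have b': "b = \<beta> x" using sk[OF x] by simp
  show "lie X s x = 2 * k x - s x * \<beta> x" "lie X k x = d x - s x - k x * \<beta> x"
    using e1 e2 b' by (simp_all add: algebra_simps)
  show "fderiv f x (lie Y X x - lie X Y x) \<bullet> E x = 0"
    "fderiv f x (lie Y X x - lie X Y x) \<bullet> T x = \<beta> x"
    using a0 a_def b' b_def by simp_all
qed

lemma commutator':
  fixes u :: "real^2 \<Rightarrow> 'b::euclidean_space"
  assumes x: "x \<in> M" and u: "smooth_on M u"
  shows "lie Y (lie X u) x - lie X (lie Y u) x = \<beta> x *\<^sub>R lie Y u x"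
  using commutator[OF x u] structure_X(3,4)[OF x] by simp

text \<open>The same comparison for \<open>E\<close> in place of \<open>f\<close>; the component
  along \<open>J E\<close> is the new information.\<close>

lemma d_X: assumes x: "x \<in> M" shows "lie X d x = - 2 * k x - d x * \<beta> x"
proof -
  have "lie Y (lie X E) x = lie Y (\<lambda>y. - f y) x"
    by (rule lie_cong[OF op x]) (intro smooth_intros sm | simp add: E_X)+
  then have 1: "lie Y (lie X E) x = - T x"
    using x by (simp add: lie_simps[OF op x] sm T_def)
  have "lie X (lie Y E) x = lie X (\<lambda>y. k y *\<^sub>R J (f y) + d y *\<^sub>R J (E y)) x"
    by (rule lie_cong[OF op x]) (intro smooth_intros sm | simp add: E_Y)+
  also have "\<dots> = lie X k x *\<^sub>R J (f x) + k x *\<^sub>R J (E x) + lie X d x *\<^sub>R J (E x) - d x *\<^sub>R J (f x)"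
    using x by (simp add: lie_simps[OF op x] smooth_intros sm E_X J_minus flip: E_def)
  finally have "- T x - (lie X k x *\<^sub>R J (f x) + k x *\<^sub>R J (E x) + lie X d x *\<^sub>R J (E x) - d x *\<^sub>R J (f x))
     = \<beta> x *\<^sub>R (k x *\<^sub>R J (f x) + d x *\<^sub>R J (E x))"
    using commutator'[OF x smE] 1 E_Y[OF x] by simp
  from arg_cong[OF this, of "\<lambda>v. v \<bullet> J (E x)"] show ?thesis
    using x by (simp add: inner_values inner_add_left inner_diff_left T_eq algebra_simps)
qed

text \<open>The asymptotic condition on \<open>T\<close> makes the derivative of
  \<open>(s, k)\<close> along \<open>Y\<close> parallel to \<open>(s, k)\<close>, while the unit
  length of \<open>(s, k)\<close> makes it orthogonal.\<close>

lemma s_Y: "x \<in> M \<Longrightarrow> lie Y s x = 0" and k_Y: "x \<in> M \<Longrightarrow> lie Y k x = 0"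
proof -
  assume x: "x \<in> M"
  have J_T: "J (T x) = - s x *\<^sub>R f x - k x *\<^sub>R E x"
    using T_eq[OF x] by (simp add: J_add J_scaleR J_J)
  have J_EY: "J (lie Y E x) = - k x *\<^sub>R f x - d x *\<^sub>R E x"
    using E_Y[OF x] by (simp add: J_add J_scaleR J_J)
  have "lie Y T x = lie Y s x *\<^sub>R J (f x) + s x *\<^sub>R J (T x)
      + lie Y k x *\<^sub>R J (E x) + k x *\<^sub>R J (lie Y E x)"
    using T_lie[OF x, of Y] by (simp flip: T_def)
  then have 1: "k x * lie Y s x = s x * lie Y k x"
    using YY[OF x] x unfolding J_T J_EY
    by (simp add: inner_values inner_add_left inner_diff_left inner_diff_right)
  have 2: "s x * lie Y s x + k x * lie Y k x = 0" using s_k_lie[OF x] .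
  have "((s x)\<^sup>2 + (k x)\<^sup>2) * lie Y s x = s x * (s x * lie Y s x + k x * lie Y k x)
     + k x * (k x * lie Y s x - s x * lie Y k x)" by (simp add: power2_eq_square algebra_simps)
  then show "lie Y s x = 0" using 1 2 sk[OF x] by simp
  have "((s x)\<^sup>2 + (k x)\<^sup>2) * lie Y k x = k x * (s x * lie Y s x + k x * lie Y k x)
     - s x * (k x * lie Y s x - s x * lie Y k x)" by (simp add: power2_eq_square algebra_simps)
  then show "lie Y k x = 0" using 1 2 sk[OF x] by simp
qed

text \<open>If a function is constant along \<open>Y\<close>, so is its derivative along
  \<open>X\<close>, because the bracket is a multiple of \<open>Y\<close>. Applied to
  \<open>k\<close>, whose derivative along \<open>X\<close> contains \<open>d\<close>, this leaves
  \<open>(s x)\<^sup>2\<close> times the wanted derivative.\<close>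

lemma d_Y: assumes x: "x \<in> M" shows "lie Y d x = 0"
proof (rule zero_if_mult_zero[OF _ _ x])
  show "continuous_on M (lie Y d)" by (intro smooth_continuous_on smooth_intros sm)
  fix x assume x: "x \<in> M"
  have YX0: "lie Y (lie X u) x = 0" if "smooth_on M u" "\<And>y. y \<in> M \<Longrightarrow> lie Y u y = 0" for u :: "real^2 \<Rightarrow> real"
  proof -
    have "lie X (lie Y u) x = 0"
      by (rule lie_zero[OF x, of _ 0]) (intro smooth_intros sm that)+
    then show ?thesis using commutator'[OF x that(1)] that(2)[OF x] by simp
  qed
  have "lie Y (lie X s) x = lie Y (\<lambda>y. 2 * k y - s y * (k y * (s y + d y))) x"
    by (rule lie_cong[OF op x]) (intro smooth_intros sm | simp add: structure_X \<beta>_def)+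
  then have 1: "s x * (k x * lie Y d x) = 0"
    using YX0[OF sms s_Y] x by (simp add: lie_simps[OF op x] smooth_intros sm s_Y k_Y)
  have "lie Y (lie X k) x = lie Y (\<lambda>y. d y - s y - k y * (k y * (s y + d y))) x"
    by (rule lie_cong[OF op x]) (intro smooth_intros sm | simp add: structure_X \<beta>_def)+
  then have "lie Y d x - k x * (k x * lie Y d x) = 0"
    using YX0[OF smk k_Y] x by (simp add: lie_simps[OF op x] smooth_intros sm s_Y k_Y)
  then have 2: "(1 - (k x)\<^sup>2) * lie Y d x = 0" by (simp add: power2_eq_square algebra_simps)
  have "1 - (k x)\<^sup>2 = (s x)\<^sup>2" using sk[OF x] by simp
  then show "s x * lie Y d x = 0" using 2 by simp
qed

end

section \<open>Invariants of adapted frames\<close>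

definition unitary :: "C2 \<Rightarrow> C2 \<Rightarrow> bool" where
  "unitary u v \<longleftrightarrow> u \<bullet> u = 1 \<and> v \<bullet> v = 1 \<and> u \<bullet> v = 0 \<and> v \<bullet> J u = 0"

lemma hm_unitary:
  assumes "unitary u v"
  shows "hm u u = 1" "hm v v = 1" "hm u v = 0" "hm v u = 0"
proof -
  have "u \<bullet> J v = 0" using assms inner_J_left[of u v] by (simp add: unitary_def inner_commute)
  then show "hm u u = 1" "hm v v = 1" "hm u v = 0" "hm v u = 0"
    using assms by (simp_all add: hm_eq unitary_def inner_J_self inner_commute complex_eq_iff)
qed

lemma hm_parseval:
  assumes "unitary u v"
  shows "hm a u * cnj (hm b u) + hm a v * cnj (hm b v) = hm a b"
proof -
  note u = assms[unfolded unitary_def]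
  have uJv: "u \<bullet> J v = 0" using u inner_J_left[of u v] by (simp add: inner_commute)
  have "a = (a \<bullet> u) *\<^sub>R u + (a \<bullet> J u) *\<^sub>R J u + (a \<bullet> v) *\<^sub>R v + (a \<bullet> J v) *\<^sub>R J v"
    by (rule unitary_basis_eqI[of u v])
      (use u uJv in \<open>simp_all add: inner_add_left inner_J_J inner_J_self inner_J_left inner_commute[of v u] J_tangent J_J\<close>)
  then have "hm a b = hm ((a \<bullet> u) *\<^sub>R u + (a \<bullet> J u) *\<^sub>R J u + (a \<bullet> v) *\<^sub>R v + (a \<bullet> J v) *\<^sub>R J v) b" by simp
  also have "\<dots> = hm a u * hm u b + hm a v * hm v b"
    by (simp add: hm_add hm_scaleR hm_J hm_eq[of a u] hm_eq[of a v] scaleR_conv_of_real complex_eq_iff algebra_simps)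
  finally show ?thesis by (simp add: cnj_hm)
qed

text \<open>With respect to the unitary frame \<open>(p, e)\<close> of \<open>\<complex>\<^sup>2\<close>, \<open>Pform\<close> is the Hermitian form whose matrix
  is the symmetric matrix with entries \<open>s\<close>, \<open>k\<close>, \<open>d\<close>, divided by its Frobenius norm; for adapted frames,
  \<open>s\<^sup>2 + k\<^sup>2 = 1\<close>.\<close>

definition Pform :: "real \<Rightarrow> real \<Rightarrow> real \<Rightarrow> complex \<Rightarrow> complex \<Rightarrow> complex \<Rightarrow> complex \<Rightarrow> complex" where
  "Pform s k d z z' w w' = (1 / sqrt (1 + k\<^sup>2 + d\<^sup>2)) *\<^sub>R
     (s *\<^sub>R (z * cnj w) + k *\<^sub>R (z * cnj w' + z' * cnj w) + d *\<^sub>R (z' * cnj w'))"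

text \<open>The first three equations below say that \<open>Pform\<close> is diagonal in the basis \<open>(u, v)\<close>, up to the sign
  \<open>\<epsilon>\<close> by which it depends on the frame. In this basis, the last two equations are the diagonal entries
  of the symmetric matrix \<open>p p\<^sup>T + e e\<^sup>T\<close>, which determines the great circle through \<open>p\<close> and \<open>e\<close>
  and moves along the one-parameter group generated by \<open>Pform\<close>.\<close>

definition on_leaf :: "C2 \<Rightarrow> C2 \<Rightarrow> real \<Rightarrow> real \<Rightarrow> C2 \<Rightarrow> C2 \<Rightarrow> real \<Rightarrow> real \<Rightarrow> real \<Rightarrow> bool" where
  "on_leaf u v m1 m2 p e s k d \<longleftrightarrow> (\<exists>\<epsilon>\<in>{1, -1}. \<exists>t.
     Pform s k d (hm p u) (hm e u) (hm p u) (hm e u) = of_real (\<epsilon> * m1) \<and>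
     Pform s k d (hm p u) (hm e u) (hm p v) (hm e v) = 0 \<and>
     Pform s k d (hm p v) (hm e v) (hm p v) (hm e v) = of_real (\<epsilon> * m2) \<and>
     (hm p u)\<^sup>2 + (hm e u)\<^sup>2 = cis (2 * m1 * t) \<and> (hm p v)\<^sup>2 + (hm e v)\<^sup>2 = cis (2 * m2 * t))"

text \<open>Reversing \<open>E\<close> by \<sigma> and \<open>T\<close> by \<sigma>' changes the
  entries by these signs; \<open>d\<close> contains \<open>E\<close> twice. The sign \<sigma>' is
  absorbed by \<epsilon> and the squares do not see \<sigma>, so the leaf data are independent of
  the orientation of the frame.\<close>

lemma on_leaf_flip:
  assumes "on_leaf u v m1 m2 p e s k d" "\<sigma> \<in> {1, -1}" "\<sigma>' \<in> {1, -1}"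
  shows "on_leaf u v m1 m2 p (\<sigma> *\<^sub>R e) (\<sigma>' * s) (\<sigma> * \<sigma>' * k) (\<sigma>' * d)"
proof -
  obtain \<epsilon> t where \<epsilon>: "\<epsilon> \<in> {1, -1}" and h: "Pform s k d (hm p u) (hm e u) (hm p u) (hm e u) = of_real (\<epsilon> * m1)"
     "Pform s k d (hm p u) (hm e u) (hm p v) (hm e v) = 0"
     "Pform s k d (hm p v) (hm e v) (hm p v) (hm e v) = of_real (\<epsilon> * m2)"
     "(hm p u)\<^sup>2 + (hm e u)\<^sup>2 = cis (2 * m1 * t)" "(hm p v)\<^sup>2 + (hm e v)\<^sup>2 = cis (2 * m2 * t)"
    using assms(1) unfolding on_leaf_def by blast
  have P: "Pform (\<sigma>' * s) (\<sigma> * \<sigma>' * k) (\<sigma>' * d) z (\<sigma> *\<^sub>R z') w (\<sigma> *\<^sub>R w') = of_real \<sigma>' * Pform s k d z z' w w'" for z z' w w'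
    using assms(2,3) by (auto simp: Pform_def algebra_simps)
  have sq: "(\<sigma> *\<^sub>R z)\<^sup>2 = z\<^sup>2" for z :: complex using assms(2) by auto
  show ?thesis
    unfolding on_leaf_def hm_scaleR P sq h
    by (rule bexI[of _ "\<sigma>' * \<epsilon>"], rule exI[of _ t]) (use \<epsilon> assms(3) in auto)
qed

text \<open>Equality case of the triangle inequality: subtracting the real parts leaves the squares
  of the imaginary parts.\<close>

lemma real_if_squares:
  fixes a b :: complex
  assumes "a\<^sup>2 + b\<^sup>2 = 1" "a * cnj a + b * cnj b = 1"
  shows "Im a = 0"
proof -
  have "(Re a)\<^sup>2 - (Im a)\<^sup>2 + (Re b)\<^sup>2 - (Im b)\<^sup>2 = 1" "(Re a)\<^sup>2 + (Im a)\<^sup>2 + (Re b)\<^sup>2 + (Im b)\<^sup>2 = 1"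
    using assms by (simp_all add: complex_eq_iff power2_eq_square)
  then have "(Im a)\<^sup>2 + (Im b)\<^sup>2 = 0" by linarith
  then show ?thesis by (simp add: sum_power2_eq_zero_iff)
qed

text \<open>Once the phases \<open>cis (m1 * t)\<close> and \<open>cis (m2 * t)\<close> are divided
  out, the coordinates of \<open>p\<close> are real and form a point of the unit circle. Rescaling
  the time by \<open>m2\<close> matches the parametrization of \<open>Phi\<close>.\<close>

lemma on_leaf_imp_Phi:
  assumes leaf: "on_leaf u v m1 m2 p e s k d" and uv: "unitary u v" and pe: "unitary p e" and m2: "m2 \<noteq> 0"
  shows "(hm p u, hm p v) \<in> range (Phi (m1 / m2))"
proof -
  obtain t where t: "(hm p u)\<^sup>2 + (hm e u)\<^sup>2 = cis (2 * m1 * t)" "(hm p v)\<^sup>2 + (hm e v)\<^sup>2 = cis (2 * m2 * t)"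
    using leaf unfolding on_leaf_def by blast
  have re: "\<exists>r. hm p w = of_real r * cis a"
    if "(hm p w)\<^sup>2 + (hm e w)\<^sup>2 = cis (2 * a)" "hm w w = 1" for w a
  proof -
    let ?z = "hm p w * cis (- a)" and ?z' = "hm e w * cis (- a)"
    have "?z\<^sup>2 + ?z'\<^sup>2 = ((hm p w)\<^sup>2 + (hm e w)\<^sup>2) * (cis (- a))\<^sup>2" by (simp add: power_mult_distrib algebra_simps)
    also have "\<dots> = 1" unfolding that(1) by (simp add: power2_eq_square cis_mult)
    finally have 1: "?z\<^sup>2 + ?z'\<^sup>2 = 1" .
    have "hm w p * cnj (hm w p) + hm w e * cnj (hm w e) = 1" using hm_parseval[OF pe, of w w] that(2) by simp
    then have "hm p w * cnj (hm p w) + hm e w * cnj (hm e w) = 1" by (simp add: cnj_hm mult.commute)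
    moreover have "cis (- a) * cnj (cis (- a)) = 1" by (simp add: cis_mult cis_cnj)
    moreover have "?z * cnj ?z + ?z' * cnj ?z' =
        (hm p w * cnj (hm p w) + hm e w * cnj (hm e w)) * (cis (- a) * cnj (cis (- a)))"
      by (simp only: complex_cnj_mult algebra_simps)
    ultimately have "?z * cnj ?z + ?z' * cnj ?z' = 1" by simp
    from real_if_squares[OF 1 this] have z: "?z = of_real (Re ?z)" by (simp add: complex_eq_iff)
    have "hm p w = ?z * cis a" by (simp add: mult.assoc cis_mult)
    then have "hm p w = of_real (Re ?z) * cis a" by (subst (asm) z)
    then show ?thesis by blast
  qed
  obtain x where x: "hm p u = of_real x * cis (m1 * t)" using re[of u "m1 * t"] t hm_unitary[OF uv] by (auto simp: mult.assoc)
  obtain y where y: "hm p v = of_real y * cis (m2 * t)" using re[of v "m2 * t"] t hm_unitary[OF uv] by (auto simp: mult.assoc)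
  have "hm p u * cnj (hm p u) + hm p v * cnj (hm p v) = 1"
    using hm_parseval[OF uv, of p p] hm_unitary[OF pe] by simp
  then have "of_real (x\<^sup>2 + y\<^sup>2) = (1::complex)"
    by (simp add: x y cis_cnj power2_eq_square mult_ac) (simp add: cis_mult flip: mult.assoc)
  then have "x\<^sup>2 + y\<^sup>2 = 1" by (metis of_real_eq_1_iff)
  then obtain \<sigma> where "x = cos \<sigma>" "y = sin \<sigma>" using sincos_total_2pi by metis
  then have "Phi (m1 / m2) (\<sigma>, m2 * t) = (hm p u, hm p v)" using m2 x y by (simp add: Phi_def)
  then show ?thesis by (metis rangeI)
qed

text \<open>A rotation diagonalizes the real symmetric matrix. The eigenbasis is a real combination
  of \<open>p\<close> and \<open>e\<close>, so all coordinates are real and the time is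
  \<open>0\<close>.\<close>

lemma exists_on_leaf:
  assumes pe: "unitary p e" and ne: "k\<^sup>2 - d * s \<noteq> 0"
  shows "\<exists>u v m1 m2. unitary u v \<and> m2 \<noteq> 0 \<and> on_leaf u v m1 m2 p e s k d"
proof -
  have "\<exists>\<phi>. k * cos (2 * \<phi>) + (d - s) / 2 * sin (2 * \<phi>) = 0"
  proof (cases "k = 0 \<and> d = s")
    case False
    \<comment> \<open>With amplitude \<open>n\<close> and phase \<psi> the expression becomes
      \<open>n * sin (2 * \<phi> - \<psi>)\<close>, which vanishes at half of \<psi>.\<close>
    define n where "n = sqrt (k\<^sup>2 + ((d - s) / 2)\<^sup>2)"
    have n: "n > 0" "n\<^sup>2 = k\<^sup>2 + ((d - s) / 2)\<^sup>2" using False by (auto simp: n_def sum_power2_gt_zero_iff)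
    have "((d - s) / 2 / n)\<^sup>2 + (- k / n)\<^sup>2 = (k\<^sup>2 + ((d - s) / 2)\<^sup>2) / n\<^sup>2"
      by (simp add: power_divide add_divide_distrib)
    also have "\<dots> = 1" using n by (metis div_self less_irrefl zero_eq_power2)
    finally obtain \<psi> where "(d - s) / 2 / n = cos \<psi>" "- k / n = sin \<psi>" using sincos_total_2pi by metis
    then have "(d - s) / 2 = n * cos \<psi>" "k = - n * sin \<psi>" using n by (auto simp: field_simps)
    then show ?thesis by (intro exI[of _ "\<psi> / 2"]) simp
  qed (rule exI[of _ 0], simp)
  then obtain \<phi> where \<phi>: "k * cos (2 * \<phi>) + (d - s) / 2 * sin (2 * \<phi>) = 0" ..
  define c S where "c = cos \<phi>" and "S = sin \<phi>"
  have cS: "c\<^sup>2 + S\<^sup>2 = 1" by (simp add: c_def S_def)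
  have diag: "k * (c\<^sup>2 - S\<^sup>2) + (d - s) * (c * S) = 0"
    using \<phi> unfolding cos_double sin_double c_def S_def by (simp add: field_simps)
  define u v where "u = c *\<^sub>R p + S *\<^sub>R e" and "v = (- S) *\<^sub>R p + c *\<^sub>R e"
  note pe' = pe[unfolded unitary_def]
  have pJe: "p \<bullet> J e = 0" using pe' inner_J_left[of p e] by (simp add: inner_commute)
  have uv: "unitary u v"
    using pe' pJe cS unfolding unitary_def u_def v_def
    by (simp add: inner_add_left inner_add_right J_add J_scaleR inner_J_self inner_commute[of e p] power2_eq_square
        algebra_simps)
  note h = hm_unitary[OF pe]
  have hu: "hm p u = of_real c" "hm e u = of_real S" "hm p v = of_real (- S)" "hm e v = of_real c"
    unfolding u_def v_def hm_add_right hm_scaleR_right h by (simp_all add: scaleR_conv_of_real)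
  define r where "r = sqrt (1 + k\<^sup>2 + d\<^sup>2)"
  have r: "r > 0" by (simp add: r_def add_pos_nonneg)
  have Pr: "Pform s k d (of_real z) (of_real z') (of_real w) (of_real w') =
     of_real ((s * (z * w) + k * (z * w' + z' * w) + d * (z' * w')) / r)" for z z' w w'
    by (simp add: Pform_def r_def scaleR_conv_of_real)
  define m1 m2 where "m1 = (s * (c * c) + k * (c * S + S * c) + d * (S * S)) / r"
    and "m2 = (s * (S * S) - k * (S * c + c * S) + d * (c * c)) / r"
  \<comment> \<open>The determinant is invariant under the rotation, and the new off-diagonal entry
    is zero by \<open>diag\<close>; so neither eigenvalue vanishes.\<close>
  have "(m1 * r) * (m2 * r) = (d * s - k\<^sup>2) * (c\<^sup>2 + S\<^sup>2)\<^sup>2 + (k * (c\<^sup>2 - S\<^sup>2) + (d - s) * (c * S))\<^sup>2"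
    using r by (simp add: m1_def m2_def) algebra
  then have "(m1 * r) * (m2 * r) \<noteq> 0" using ne cS diag by simp
  then have "m2 \<noteq> 0" by auto
  moreover have "on_leaf u v m1 m2 p e s k d"
    unfolding on_leaf_def hu Pr
  proof (rule bexI[of _ 1], rule exI[of _ 0], intro conjI)
    have "s * (c * - S) + k * (c * c + S * - S) + d * (S * c) = 0" using diag by (simp add: power2_eq_square algebra_simps)
    then show "complex_of_real ((s * (c * - S) + k * (c * c + S * - S) + d * (S * c)) / r) = 0" by simp
    show "(complex_of_real c)\<^sup>2 + (complex_of_real S)\<^sup>2 = cis (2 * m1 * 0)"
      "(complex_of_real (- S))\<^sup>2 + (complex_of_real c)\<^sup>2 = cis (2 * m2 * 0)"
      using cS by (simp_all flip: of_real_power of_real_add add: add.commute)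
  qed (simp_all add: m1_def m2_def algebra_simps)
  ultimately show ?thesis using uv by blast
qed

text \<open>Multiplication by the integrating factor of phase \<open>- c * G t\<close> makes
  \<open>u\<close> constant.\<close>

lemma phase_ode:
  fixes u :: "real \<Rightarrow> complex"
  assumes "\<And>t. t \<in> {0..1} \<Longrightarrow> (u has_vector_derivative (\<i> * of_real (c * g t)) * u t) (at t within {0..1})"
    and "\<And>t. t \<in> {0..1} \<Longrightarrow> (G has_vector_derivative g t) (at t within {0..1})"
  shows "u 1 = cis (c * (G 1 - G 0)) * u 0"
proof -
  let ?V = "\<lambda>t. u t * exp (- (\<i> * of_real (c * G t)))"
  have "(?V has_derivative (\<lambda>h. 0)) (at t within {0..1})" if t: "t \<in> {0..1}" for t
  proof -
    have 1: "(u has_derivative (\<lambda>h. h *\<^sub>R ((\<i> * of_real (c * g t)) * u t))) (at t within {0..1})"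
      using assms(1)[OF t] by (simp add: has_vector_derivative_def)
    have 2: "(G has_derivative (\<lambda>h. h *\<^sub>R g t)) (at t within {0..1})"
      using assms(2)[OF t] by (simp add: has_vector_derivative_def)
    have "((\<lambda>t. - (\<i> * of_real (c * G t))) has_derivative (\<lambda>h. - (\<i> * of_real (c * (h *\<^sub>R g t))))) (at t within {0..1})"
      by (rule derivative_intros 2)+
    from has_derivative_mult[OF 1 has_derivative_compose[OF this DERIV_exp[unfolded has_field_derivative_def]]]
    show ?thesis by (rule has_derivative_eq_rhs) (simp add: fun_eq_iff scaleR_conv_of_real algebra_simps)
  qed
  then have "?V 1 = ?V 0" by (intro has_derivative_zero_unique[of "{0..1}"]) auto
  then have "u 1 * exp (- (\<i> * of_real (c * G 1))) * exp (\<i> * of_real (c * G 1)) =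
      u 0 * exp (- (\<i> * of_real (c * G 0))) * exp (\<i> * of_real (c * G 1))" by simp
  then have "u 1 = u 0 * exp (\<i> * of_real (c * (G 1 - G 0)))"
    by (simp add: mult.assoc algebra_simps flip: exp_add)
  then show ?thesis by (simp add: cis_conv_exp mult.commute)
qed

section \<open>Local constancy of the invariants\<close>

context adapted_frame
begin

lemma unitary_frame: "x \<in> M \<Longrightarrow> unitary (f x) (E x)"
  by (simp add: unitary_def inner_values)

lemma constant_if:
  fixes u :: "real^2 \<Rightarrow> 'b::real_normed_vector"
  assumes "connected M" and u: "smooth_on M u"
    and "\<And>x. x \<in> M \<Longrightarrow> lie X u x = 0" "\<And>x. x \<in> M \<Longrightarrow> lie Y u x = 0"
    and xy: "x \<in> M" "y \<in> M"
  shows "u x = u y"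
proof (rule has_derivative_zero_unique_connected[OF op assms(1) _ xy])
  fix z assume z: "z \<in> M"
  have "fderiv u z = (\<lambda>v. 0)"
    using frame_expand[OF z u] assms(3,4)[OF z] by (simp add: fun_eq_iff)
  then show "(u has_derivative (\<lambda>x. 0)) (at z)" using smooth_has_fderiv[OF op u z] by simp
qed

text \<open>By \<open>sk\<close> this is \<open>s\<^sup>2 + 2 * k\<^sup>2 + d\<^sup>2\<close>, the
  squared Frobenius norm of the matrix.\<close>

definition r :: "real^2 \<Rightarrow> real" where "r x = 1 + k x * k x + d x * d x"
definition \<rho> :: "real^2 \<Rightarrow> real" where "\<rho> x = 1 / sqrt (r x)"

lemma r_pos: "r x > 0"
  by (simp add: r_def add_pos_nonneg)

lemma \<rho>_r: "\<rho> x * \<rho> x * r x = 1"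
  using r_pos[of x] by (simp add: \<rho>_def field_simps)

lemma smr: "smooth_on M r"
  unfolding r_def by (intro smooth_intros sm)

lemma sm\<rho>: "smooth_on M \<rho>"
  unfolding \<rho>_def using r_pos by (intro smooth_on_divide smooth_on_sqrt smooth_intros sm smr) (auto simp: less_imp_neq[symmetric])

text \<open>Apart from a rotation, the entries scale along \<open>X\<close> at the rate
  \<open>- \<beta>\<close>, hence the reciprocal of the norm at the rate \<beta>. It is
  differentiated implicitly through \<open>\<rho>_r\<close>.\<close>

lemma \<rho>_lie:
  assumes x: "x \<in> M"
  shows "lie X \<rho> x = \<beta> x * \<rho> x" "lie Y \<rho> x = 0"
proof -
  have "lie Z (\<lambda>y. \<rho> y * \<rho> y * r y) x = 0" for Z
    by (rule lie_zero[OF x, of _ 1]) (intro smooth_intros sm sm\<rho> smr | simp add: \<rho>_r)+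
  then have 1: "\<rho> x * (2 * r x * lie Z \<rho> x + \<rho> x * lie Z r x) = 0" for Z
    using x by (simp add: lie_simps[OF op x] smooth_intros sm sm\<rho> smr algebra_simps)
  have "\<rho> x \<noteq> 0" using \<rho>_r[of x] by auto
  then have 2: "2 * r x * lie Z \<rho> x + \<rho> x * lie Z r x = 0" for Z using 1 by simp
  have "lie Z r x = 2 * k x * lie Z k x + 2 * d x * lie Z d x" for Z
    unfolding r_def by (simp add: lie_simps[OF op x] smooth_intros sm)
  then have rX: "lie X r x = - 2 * \<beta> x * r x" and rY: "lie Y r x = 0"
    using x by (simp_all add: structure_X d_X k_Y d_Y \<beta>_def r_def algebra_simps)
  have "2 * r x * (lie X \<rho> x - \<beta> x * \<rho> x) = 0" using 2[of X] unfolding rX by (simp add: algebra_simps)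
  then show "lie X \<rho> x = \<beta> x * \<rho> x" using r_pos[of x] by simp
  show "lie Y \<rho> x = 0" using 2[of Y] r_pos[of x] unfolding rY by simp
qed

text \<open>Minus the determinant does not see the rotation and is quadratic in the entries, so
  along \<open>X\<close> it scales at the rate \<open>- 2 * \<beta>\<close>, which
  \<open>\<rho> * \<rho>\<close> compensates.\<close>

lemma curvature_ratio_const:
  assumes "connected M" "x \<in> M" "y \<in> M"
  shows "(k x * k x - d x * s x) * (\<rho> x * \<rho> x) = (k y * k y - d y * s y) * (\<rho> y * \<rho> y)"
proof (rule constant_if[OF assms(1) _ _ _ assms(2,3)])
  show "smooth_on M (\<lambda>x. (k x * k x - d x * s x) * (\<rho> x * \<rho> x))" by (intro smooth_intros sm sm\<rho>)
  show "lie X (\<lambda>x. (k x * k x - d x * s x) * (\<rho> x * \<rho> x)) x = 0"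
    "lie Y (\<lambda>x. (k x * k x - d x * s x) * (\<rho> x * \<rho> x)) x = 0" if x: "x \<in> M" for x
    using x by (simp_all add: lie_simps[OF op x] smooth_intros sm sm\<rho> structure_X d_X k_Y d_Y s_Y \<rho>_lie algebra_simps)
qed

definition P :: "C2 \<Rightarrow> C2 \<Rightarrow> real^2 \<Rightarrow> complex" where
  "P u v x = Pform (s x) (k x) (d x) (hm (f x) u) (hm (E x) u) (hm (f x) v) (hm (E x) v)"

lemma P_eq: "P u v x = \<rho> x *\<^sub>R (s x *\<^sub>R (hm (f x) u * cnj (hm (f x) v)) + k x *\<^sub>R (hm (f x) u * cnj (hm (E x) v)
   + hm (E x) u * cnj (hm (f x) v)) + d x *\<^sub>R (hm (E x) u * cnj (hm (E x) v)))"
  by (simp add: P_def Pform_def \<rho>_def r_def power2_eq_square)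

lemma lie_hm_frame:
  assumes x: "x \<in> M"
  shows "lie X (\<lambda>y. hm (f y) u) x = hm (E x) u" "lie X (\<lambda>y. hm (E y) u) x = - hm (f x) u"
    "lie Y (\<lambda>y. hm (f y) u) x = \<i> * (s x *\<^sub>R hm (f x) u + k x *\<^sub>R hm (E x) u)"
    "lie Y (\<lambda>y. hm (E y) u) x = \<i> * (k x *\<^sub>R hm (f x) u + d x *\<^sub>R hm (E x) u)"
proof -
  show "lie X (\<lambda>y. hm (f y) u) x = hm (E x) u" "lie X (\<lambda>y. hm (E y) u) x = - hm (f x) u"
    "lie Y (\<lambda>y. hm (E y) u) x = \<i> * (k x *\<^sub>R hm (f x) u + d x *\<^sub>R hm (E x) u)"
    using x by (simp_all add: lie_hm[OF op x] sm E_X E_Y hm_minus hm_add hm_scaleR hm_J algebra_simps flip: E_def)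
  show "lie Y (\<lambda>y. hm (f y) u) x = \<i> * (s x *\<^sub>R hm (f x) u + k x *\<^sub>R hm (E x) u)"
    using x T_eq[OF x] by (simp add: lie_hm[OF op x] sm hm_add hm_scaleR hm_J algebra_simps flip: T_def)
qed

text \<open>Along \<open>X\<close>, the change of the entries undoes the rotation of
  \<open>(f, E)\<close>, and \<rho> cancels the common rate. Along \<open>Y\<close>, the entries are
  constant and the frame moves by the imaginary unit times the same matrix; its contributions to the
  two sides of the Hermitian form cancel.\<close>

lemma P_const:
  assumes "connected M" "x \<in> M" "y \<in> M"
  shows "P u v x = P u v y"
proof (rule constant_if[OF assms(1) _ _ _ assms(2,3)])
  note smP = smooth_intros sm sm\<rho>
  show "smooth_on M (P u v)" unfolding P_eq[abs_def] by (intro smP)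
  fix x assume x: "x \<in> M"
  note D = lie_add[OF op x] lie_mult[OF op x] lie_scaleR[OF op x] lie_cnj[OF op x]
    smP lie_hm_frame[OF x]
  show "lie X (P u v) x = 0"
    unfolding P_eq[abs_def]
    by (simp only: D structure_X[OF x] d_X[OF x] \<rho>_lie[OF x])
      (simp add: scaleR_conv_of_real algebra_simps)
  show "lie Y (P u v) x = 0"
    unfolding P_eq[abs_def]
    by (simp only: D k_Y[OF x] d_Y[OF x] s_Y[OF x] \<rho>_lie[OF x])
      (simp add: scaleR_conv_of_real algebra_simps)
qed

end

text \<open>The frame given by \<open>f\<close>, \<open>X\<close>, \<open>Y\<close> alone, with the
  derived quantities spelled out, so that frames in different charts can stand side by side.\<close>

locale lie_frame =
  fixes M :: "(real^2) set" and f :: "real^2 \<Rightarrow> C2" and X Y :: "real^2 \<Rightarrow> real^2"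
  assumes frame: "adapted_frame M f X Y"

sublocale lie_frame \<subseteq> adapted_frame M f X Y "lie X f" "lie Y f" "\<lambda>x. lie Y f x \<bullet> J (f x)"
  "\<lambda>x. lie Y f x \<bullet> J (lie X f x)" "\<lambda>x. lie Y (lie X f) x \<bullet> J (lie X f x)"
  using frame by simp_all

definition frame_on_leaf ::
  "C2 \<Rightarrow> C2 \<Rightarrow> real \<Rightarrow> real \<Rightarrow> (real^2 \<Rightarrow> C2) \<Rightarrow> (real^2 \<Rightarrow> real^2) \<Rightarrow> (real^2 \<Rightarrow> real^2) \<Rightarrow> real^2 \<Rightarrow> bool" where
  "frame_on_leaf u v m1 m2 f X Y x \<longleftrightarrow>
     on_leaf u v m1 m2 (f x) (lie X f x) (lie Y f x \<bullet> J (f x)) (lie Y f x \<bullet> J (lie X f x))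
       (lie Y (lie X f) x \<bullet> J (lie X f x))"

context adapted_frame
begin

lemma frame_on_leaf_eq: "frame_on_leaf u v m1 m2 f X Y x \<longleftrightarrow> on_leaf u v m1 m2 (f x) (E x) (s x) (k x) (d x)"
  by (simp add: frame_on_leaf_def E_def T_def s_def k_def d_def)

text \<open>Weighting the two equations for \<open>P\<close> by the coordinates along
  \<open>u\<close> and \<open>v\<close> and adding them, orthonormality turns the diagonal form into
  an eigenvector equation for the matrix of \<open>s\<close>, \<open>k\<close>,
  \<open>d\<close>.\<close>

lemma eigen_equations:
  assumes x: "x \<in> M" and uv: "unitary u v" and P: "P u u x = of_real m" "P u v x = 0"
  shows "s x *\<^sub>R hm (f x) u + k x *\<^sub>R hm (E x) u = of_real (m * sqrt (r x)) * hm (f x) u"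
    "k x *\<^sub>R hm (f x) u + d x *\<^sub>R hm (E x) u = of_real (m * sqrt (r x)) * hm (E x) u"
proof -
  define z z' w w' where "z = hm (f x) u" and "z' = hm (E x) u" and "w = hm (f x) v" and "w' = hm (E x) v"
  have h: "hm (f x) (f x) = 1" "hm (E x) (E x) = 1" "hm (f x) (E x) = 0" "hm (E x) (f x) = 0"
    using hm_unitary[OF unitary_frame[OF x]] .
  have ort: "z * cnj z + w * cnj w = 1" "z' * cnj z' + w' * cnj w' = 1" "z * cnj z' + w * cnj w' = 0" "z' * cnj z + w' * cnj w = 0"
    using hm_parseval[OF uv] h by (simp_all add: z_def z'_def w_def w'_def)
  have p: "\<rho> x * sqrt (r x) = 1" using r_pos[of x] by (simp add: \<rho>_def)
  then have p': "of_real (\<rho> x) * of_real (sqrt (r x)) = (1::complex)" by (metis of_real_1 of_real_mult)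
  let ?S = "of_real (s x) :: complex" and ?K = "of_real (k x) :: complex" and ?D = "of_real (d x) :: complex"
    and ?R = "of_real (\<rho> x) :: complex"
  have P1: "of_real m = ?R * (?S * (z * cnj z) + ?K * (z * cnj z' + z' * cnj z) + ?D * (z' * cnj z'))"
    and P2: "?R * (?S * (z * cnj w) + ?K * (z * cnj w' + z' * cnj w) + ?D * (z' * cnj w')) = 0" (is "?P2 = 0")
    using P by (simp_all add: P_eq scaleR_conv_of_real z_def z'_def w_def w'_def)
  have "of_real m * z + ?P2 * w = ?R * (?S * z * (z * cnj z + w * cnj w) + ?K * z * (z * cnj z' + w * cnj w')
      + ?K * z' * (z * cnj z + w * cnj w) + ?D * z' * (z * cnj z' + w * cnj w'))"
    unfolding P1 by (simp only: algebra_simps)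
  then have 1: "of_real m * z = ?R * (?S * z + ?K * z')" unfolding ort P2 by (simp add: algebra_simps)
  have "of_real m * z' + ?P2 * w' = ?R * (?S * z * (z' * cnj z + w' * cnj w) + ?K * z * (z' * cnj z' + w' * cnj w')
      + ?K * z' * (z' * cnj z + w' * cnj w) + ?D * z' * (z' * cnj z' + w' * cnj w'))"
    unfolding P1 by (simp only: algebra_simps)
  then have 2: "of_real m * z' = ?R * (?K * z + ?D * z')" unfolding ort P2 by (simp add: algebra_simps)
  have "of_real (sqrt (r x)) * (of_real m * z) = (of_real (\<rho> x) * of_real (sqrt (r x))) * (?S * z + ?K * z')"
    "of_real (sqrt (r x)) * (of_real m * z') = (of_real (\<rho> x) * of_real (sqrt (r x))) * (?K * z + ?D * z')"
    unfolding 1 2 by (simp_all only: mult_ac)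
  then show "s x *\<^sub>R hm (f x) u + k x *\<^sub>R hm (E x) u = of_real (m * sqrt (r x)) * hm (f x) u"
    "k x *\<^sub>R hm (f x) u + d x *\<^sub>R hm (E x) u = of_real (m * sqrt (r x)) * hm (E x) u"
    unfolding p' by (simp_all add: scaleR_conv_of_real z_def z'_def mult_ac)
qed

text \<open>The order of the quantifiers is the point: one time \<tau> serves every rate
  \<open>m\<close>, so the phases of both eigenvectors advance together. It is the integral of
  \<open>g\<close> along the segment from \<open>x\<close> to \<open>y\<close>.\<close>

lemma phase_transport:
  assumes "convex M" and xy: "x \<in> M" "y \<in> M"
  shows "\<exists>\<tau>. \<forall>m U. smooth_on M U \<and> (\<forall>z\<in>M. lie X U z = 0 \<and>
     lie Y U z = \<i> * of_real (m * sqrt (r z)) * U z) \<longrightarrow> U y = cis (m * \<tau>) * U x"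
proof -
  define \<gamma> where "\<gamma> = (\<lambda>t::real. x + t *\<^sub>R (y - x))"
  have \<gamma>: "\<gamma> t \<in> M" if "t \<in> {0..1}" for t
  proof -
    have "\<gamma> t = (1 - t) *\<^sub>R x + t *\<^sub>R y" by (simp add: \<gamma>_def algebra_simps)
    then show ?thesis using assms that by (auto simp: convex_alt)
  qed
  define g where "g = (\<lambda>t. (fderiv f (\<gamma> t) (y - x) \<bullet> T (\<gamma> t)) * sqrt (r (\<gamma> t)))"
  have "continuous_on M (\<lambda>z. (fderiv f z (y - x) \<bullet> T z) * sqrt (r z))"
    using smooth_continuous_on[OF smr]
    by (intro continuous_on_mult smooth_continuous_on[of M "\<lambda>z. fderiv f z (y - x) \<bullet> T z"]
      continuous_on_real_sqrt smooth_intros smooth_on_fderiv sm)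
  moreover have "continuous_on {0..1} \<gamma>" unfolding \<gamma>_def by (intro continuous_intros)
  ultimately have "continuous_on {0..1} g"
    unfolding g_def by (rule continuous_on_compose2) (use \<gamma> in auto)
  then obtain G where G: "\<And>t. t \<in> {0..1} \<Longrightarrow> (G has_vector_derivative g t) (at t within {0..1})"
    using antiderivative_continuous by blast
  show ?thesis
  proof (rule exI[of _ "G 1 - G 0"], intro allI impI)
    fix m U
    assume "smooth_on M U \<and> (\<forall>z\<in>M. lie X U z = 0 \<and>
      lie Y U z = \<i> * of_real (m * sqrt (r z)) * U z)"
    then have U: "smooth_on M U" "\<And>z. z \<in> M \<Longrightarrow> lie X U z = 0"
      "\<And>z. z \<in> M \<Longrightarrow> lie Y U z = \<i> * of_real (m * sqrt (r z)) * U z" by auto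
    have "(\<lambda>t. U (\<gamma> t)) 1 = cis (m * (G 1 - G 0)) * (\<lambda>t. U (\<gamma> t)) 0"
    proof (rule phase_ode[where g = g])
      fix t :: real assume t: "t \<in> {0..1}"
      have "(\<gamma> has_derivative (\<lambda>h. h *\<^sub>R (y - x))) (at t within {0..1})"
        unfolding \<gamma>_def by (auto intro!: derivative_eq_intros)
      from has_derivative_compose[OF this smooth_has_fderiv[OF op U(1) \<gamma>[OF t]]]
      have "((\<lambda>t. U (\<gamma> t)) has_derivative (\<lambda>h. fderiv U (\<gamma> t) (h *\<^sub>R (y - x)))) (at t within {0..1})" .
      then show "((\<lambda>t. U (\<gamma> t)) has_vector_derivative \<i> * of_real (m * g t) * U (\<gamma> t)) (at t within {0..1})"
        unfolding has_vector_derivative_def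
        by (rule has_derivative_eq_rhs)
          (simp add: fun_eq_iff frame_expand[OF \<gamma>[OF t] U(1)] U(2,3)[OF \<gamma>[OF t]] g_def
            linear_scale[OF lin[OF smf \<gamma>[OF t]]], simp add: scaleR_conv_of_real mult_ac)
    qed (rule G)
    then show "U y = cis (m * (G 1 - G 0)) * U x" by (simp add: \<gamma>_def)
  qed
qed

text \<open>The sums of squares in \<open>on_leaf\<close> are constant along \<open>X\<close>, where
  \<open>(f, E)\<close> rotates; along \<open>Y\<close> their phases turn at twice the eigenvalue by
  \<open>eigen_equations\<close>. The factor \<epsilon> in the new time accounts for the sign of the
  eigenvalues.\<close>

lemma leaf_transport:
  assumes "convex M" and xy: "x \<in> M" "y \<in> M" and uv: "unitary u v"
    and leaf: "frame_on_leaf u v m1 m2 f X Y x"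
  shows "frame_on_leaf u v m1 m2 f X Y y"
proof -
  have con: "connected M" using assms(1) by (rule convex_connected)
  obtain \<epsilon> t where \<epsilon>: "\<epsilon> \<in> {1, -1}" and h: "P u u x = of_real (\<epsilon> * m1)" "P u v x = 0" "P v v x = of_real (\<epsilon> * m2)"
     "(hm (f x) u)\<^sup>2 + (hm (E x) u)\<^sup>2 = cis (2 * m1 * t)" "(hm (f x) v)\<^sup>2 + (hm (E x) v)\<^sup>2 = cis (2 * m2 * t)"
    using leaf unfolding frame_on_leaf_eq on_leaf_def P_def by blast
  have Pz: "P u u z = of_real (\<epsilon> * m1)" "P u v z = 0" "P v v z = of_real (\<epsilon> * m2)" if "z \<in> M" for z
    using P_const[OF con that xy(1)] h by simp_all
  have "P v u z = cnj (P u v z)" for z by (simp add: P_eq algebra_simps)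
  then have Pvu: "P v u z = 0" if "z \<in> M" for z using Pz(2)[OF that] by simp
  have vu: "unitary v u"
    using uv inner_J_left[of u v] by (simp add: unitary_def inner_commute)
  obtain \<tau> where \<tau>: "\<And>m U. smooth_on M U \<Longrightarrow> (\<And>z. z \<in> M \<Longrightarrow> lie X U z = 0) \<Longrightarrow>
     (\<And>z. z \<in> M \<Longrightarrow> lie Y U z = \<i> * of_real (m * sqrt (r z)) * U z) \<Longrightarrow> U y = cis (m * \<tau>) * U x"
    using phase_transport[OF assms(1) xy] by blast
  have ph: "(hm (f y) a)\<^sup>2 + (hm (E y) a)\<^sup>2 = cis (2 * m * (t + \<epsilon> * \<tau>))"
    if "unitary a b" "\<And>z. z \<in> M \<Longrightarrow> P a a z = of_real (\<epsilon> * m)" "\<And>z. z \<in> M \<Longrightarrow> P a b z = 0"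
      "(hm (f x) a)\<^sup>2 + (hm (E x) a)\<^sup>2 = cis (2 * m * t)" for a b m
  proof -
    let ?U = "\<lambda>z. hm (f z) a * hm (f z) a + hm (E z) a * hm (E z) a"
    have "?U y = cis (2 * \<epsilon> * m * \<tau>) * ?U x"
    proof (rule \<tau>)
      show "smooth_on M ?U" by (intro smooth_intros sm)
      fix z assume z: "z \<in> M"
      note D = lie_add[OF op z] lie_mult[OF op z] smooth_intros sm lie_hm_frame[OF z]
      show "lie X ?U z = 0" by (simp only: D) simp
      have "lie Y ?U z = \<i> * (2 * hm (f z) a * (s z *\<^sub>R hm (f z) a + k z *\<^sub>R hm (E z) a)
         + 2 * hm (E z) a * (k z *\<^sub>R hm (f z) a + d z *\<^sub>R hm (E z) a))"
        by (simp only: D) (simp add: algebra_simps)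
      also have "\<dots> = \<i> * of_real (2 * \<epsilon> * m * sqrt (r z)) * ?U z"
        unfolding eigen_equations[OF z that(1) that(2)[OF z] that(3)[OF z]] by (simp add: algebra_simps)
      finally show "lie Y ?U z = \<i> * of_real (2 * \<epsilon> * m * sqrt (r z)) * ?U z" .
    qed
    also have "?U x = cis (2 * m * t)" using that(4) by (simp add: power2_eq_square)
    finally show ?thesis by (simp add: power2_eq_square cis_mult algebra_simps)
  qed
  show ?thesis
    unfolding frame_on_leaf_eq on_leaf_def
    using ph[OF uv Pz(1,2) h(4)] ph[OF vu Pz(3) Pvu h(5)] Pz[OF xy(2)] \<epsilon> unfolding P_def by blast
qed

definition N :: "real^2 \<Rightarrow> C2" where "N x = k x *\<^sub>R J (f x) - s x *\<^sub>R J (E x)"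

lemma N_inner:
  assumes x: "x \<in> M"
  shows "N x \<bullet> f x = 0" "N x \<bullet> E x = 0" "N x \<bullet> T x = 0" "N x \<bullet> N x = 1"
  using sk[OF x] T_eq[OF x] x
  by (simp_all add: N_def inner_values inner_diff_left inner_diff_right inner_add_right power2_eq_square algebra_simps)

text \<open>The bridge between the determinant of the matrix and umbilic points: the left side is
  the second fundamental form on \<open>E\<close> and \<open>T\<close>.\<close>

lemma E_Y_N: "x \<in> M \<Longrightarrow> lie Y E x \<bullet> N x = k x * k x - d x * s x"
  by (simp add: E_Y N_def inner_values inner_add_left inner_diff_right)

end

section \<open>Comparison of frames in two charts\<close>

lemma open_Collect_neq_on:
  fixes g :: "'a::topological_space \<Rightarrow> 'b::t1_space"
  assumes "open S" "continuous_on S g"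
  shows "open {y \<in> S. g y \<noteq> c}"
proof -
  have "{y \<in> S. g y \<noteq> c} = S \<inter> g -` (- {c})" by auto
  then show ?thesis using continuous_open_preimage[OF assms(2,1), of "- {c}"] by (simp add: open_Compl)
qed

lemma fderiv_compose:
  assumes "open W" "y \<in> W" "\<psi> differentiable (at y)" "(g has_derivative D) (at (\<psi> y))"
    and "\<And>z. z \<in> W \<Longrightarrow> f z = g (\<psi> z)"
  shows "fderiv f y w = D (fderiv \<psi> y w)"
proof -
  have "((\<lambda>z. g (\<psi> z)) has_derivative (\<lambda>w. D (fderiv \<psi> y w))) (at y)"
    by (rule has_derivative_compose[OF assms(3)[unfolded frechet_derivative_works] assms(4)])
  then have "(f has_derivative (\<lambda>w. D (fderiv \<psi> y w))) (at y)"
    by (rule has_derivative_transform_within_open[OF _ assms(1,2)]) (simp add: assms(5))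
  then show ?thesis by (rule fderiv_eqI)
qed

text \<open>Where the plane is not horizontal the two frames agree up to signs. As \<open>d\<close>
  contains a derivative of \<open>E\<close>, the sign \<sigma> has to be constant near the
  point.\<close>

lemma frame_on_leaf_change:
  assumes F: "adapted_frame M f X Y" and F': "adapted_frame M' f' X' Y'"
    and W: "open W" "x \<in> W" "W \<subseteq> M" and \<psi>: "\<And>y. y \<in> W \<Longrightarrow> \<psi> y \<in> M'" "\<And>y. y \<in> W \<Longrightarrow> \<psi> differentiable (at y)"
    and ff': "\<And>y. y \<in> W \<Longrightarrow> f y = f' (\<psi> y)"
    and ne: "lie Y f x \<bullet> J (f x) \<noteq> 0" "lie Y' f' (\<psi> x) \<bullet> J (f' (\<psi> x)) \<noteq> 0"
    and leaf: "frame_on_leaf u v m1 m2 f' X' Y' (\<psi> x)"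
  shows "frame_on_leaf u v m1 m2 f X Y x"
proof -
  interpret A: lie_frame M f X Y by (rule lie_frame.intro[OF F])
  interpret B: lie_frame M' f' X' Y' by (rule lie_frame.intro[OF F'])
  define E where "E = lie X f"
  define T where "T = lie Y f"
  define E' where "E' = lie X' f'"
  define T' where "T' = lie Y' f'"
  have Df: "fderiv f y w = fderiv f' (\<psi> y) (fderiv \<psi> y w)" if y: "y \<in> W" for y w
    by (rule fderiv_compose[OF W(1) y \<psi>(2)[OF y] smooth_has_fderiv[OF B.op B.smf \<psi>(1)[OF y]] ff'])
  have span: "fderiv f y w = (fderiv f y w \<bullet> E' (\<psi> y)) *\<^sub>R E' (\<psi> y)
      + (fderiv f y w \<bullet> T' (\<psi> y)) *\<^sub>R T' (\<psi> y)" if y: "y \<in> W" for y w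
    using B.frame_expand[OF \<psi>(1)[OF y] B.smf] unfolding Df[OF y] E'_def T'_def .
  have E'f: "E' (\<psi> y) \<bullet> J (f y) = 0" "E' (\<psi> y) \<bullet> E' (\<psi> y) = 1" "T' (\<psi> y) \<bullet> T' (\<psi> y) = 1" "E' (\<psi> y) \<bullet> T' (\<psi> y) = 0"
    if "y \<in> W" for y
    using B.EJf[OF \<psi>(1)[OF that]] B.EE[OF \<psi>(1)[OF that]] B.TT[OF \<psi>(1)[OF that]] B.ET[OF \<psi>(1)[OF that]] ff'[OF that]
    by (simp_all add: E'_def T'_def)
  have Ef: "E y \<bullet> J (f y) = 0" "E y \<bullet> E y = 1" "T y \<bullet> T y = 1" "E y \<bullet> T y = 0" if "y \<in> W" for y
    using that W(3) A.EJf A.EE A.TT A.ET unfolding E_def T_def by auto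
  have contW: "continuous_on W \<psi>"
    using \<psi>(2) W(1) by (meson continuous_at_imp_continuous_on differentiable_imp_continuous_within)
  have smE': "smooth_on M' E'" "smooth_on M' T'" using B.smE B.smT by (simp_all add: E'_def T'_def)
  have smE: "smooth_on W E" "smooth_on W T" "smooth_on W f"
    using A.smE A.smT A.smf W(3) smooth_on_subset by (auto simp: E_def T_def)
  have cE'\<psi>: "continuous_on W (\<lambda>y. E' (\<psi> y))"
    by (rule continuous_on_compose2[OF smooth_continuous_on[OF smE'(1)] contW]) (use \<psi>(1) in auto)
  have cT'\<psi>: "continuous_on W (\<lambda>y. T' (\<psi> y))"
    by (rule continuous_on_compose2[OF smooth_continuous_on[OF smE'(2)] contW]) (use \<psi>(1) in auto)
  \<comment> \<open>Here \<open>T'\<close> is not horizontal, so horizontality of \<open>E\<close>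
    and \<open>E'\<close> removes the \<open>T'\<close> component of \<open>E\<close>.\<close>
  define W1 where "W1 = {y \<in> W. T' (\<psi> y) \<bullet> J (f y) \<noteq> 0}"
  have openW1: "open W1"
    unfolding W1_def
    by (rule open_Collect_neq_on)
       (intro continuous_intros cT'\<psi> smooth_continuous_on[OF smooth_on_J] smE W(1))+
  have xW1: "x \<in> W1" using ne(2) W(2) ff'[OF W(2)] by (simp add: W1_def T'_def)
  have E_eq: "E y = (E y \<bullet> E' (\<psi> y)) *\<^sub>R E' (\<psi> y)" "(E y \<bullet> E' (\<psi> y))\<^sup>2 = 1" if y: "y \<in> W1" for y
  proof -
    have yW: "y \<in> W" using y by (simp add: W1_def)
    have sp: "E y = (E y \<bullet> E' (\<psi> y)) *\<^sub>R E' (\<psi> y) + (E y \<bullet> T' (\<psi> y)) *\<^sub>R T' (\<psi> y)"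
      using span[OF yW, of "X y"] unfolding E_def lie_def .
    have "E y \<bullet> J (f y) = (E y \<bullet> T' (\<psi> y)) * (T' (\<psi> y) \<bullet> J (f y))"
      by (subst sp) (simp add: inner_add_left E'f[OF yW])
    then have "E y \<bullet> T' (\<psi> y) = 0" using Ef[OF yW] y by (simp add: W1_def)
    then show e: "E y = (E y \<bullet> E' (\<psi> y)) *\<^sub>R E' (\<psi> y)" using sp by simp
    have "E y \<bullet> E y = (E y \<bullet> E' (\<psi> y))\<^sup>2"
      by (subst (1 2) e) (simp add: E'f[OF yW] power2_eq_square)
    then show "(E y \<bullet> E' (\<psi> y))\<^sup>2 = 1" using Ef[OF yW] by simp
  qed
  define \<sigma> where "\<sigma> = E x \<bullet> E' (\<psi> x)"
  have \<sigma>: "\<sigma> = 1 \<or> \<sigma> = -1" using E_eq(2)[OF xW1] by (simp add: \<sigma>_def power2_eq_1_iff)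
  \<comment> \<open>The product takes the values \<open>1\<close> and \<open>-1\<close>, so
    excluding \<open>-1\<close> is an open condition that fixes the sign.\<close>
  define W2 where "W2 = {y \<in> W1. \<sigma> * (E y \<bullet> E' (\<psi> y)) \<noteq> - 1}"
  have subs: "W1 \<subseteq> W" by (auto simp: W1_def)
  have openW2: "open W2"
    unfolding W2_def using subs
    by (intro open_Collect_neq_on openW1 continuous_intros continuous_on_subset[OF cE'\<psi>]
      continuous_on_subset[OF smooth_continuous_on[OF smE(1)]])
  have xW2: "x \<in> W2" using xW1 \<sigma> by (auto simp: W2_def \<sigma>_def)
  have Es: "E y = \<sigma> *\<^sub>R E' (\<psi> y)" if "y \<in> W2" for y
  proof -
    have y: "y \<in> W1" using that by (simp add: W2_def)
    have "E y \<bullet> E' (\<psi> y) = 1 \<or> E y \<bullet> E' (\<psi> y) = -1" using E_eq(2)[OF y] by (simp add: power2_eq_1_iff)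
    then have "E y \<bullet> E' (\<psi> y) = \<sigma>" using \<sigma> that by (auto simp: W2_def)
    then show ?thesis using E_eq(1)[OF y] by simp
  qed
  note xW = W(2)
  have Tx: "T x = (T x \<bullet> T' (\<psi> x)) *\<^sub>R T' (\<psi> x)"
  proof -
    have "T x = (T x \<bullet> E' (\<psi> x)) *\<^sub>R E' (\<psi> x) + (T x \<bullet> T' (\<psi> x)) *\<^sub>R T' (\<psi> x)"
      using span[OF xW, of "Y x"] unfolding T_def lie_def .
    moreover have "T x \<bullet> E' (\<psi> x) = 0" using Ef(4)[OF xW] Es[OF xW2] \<sigma> by (auto simp: inner_commute)
    ultimately show ?thesis by simp
  qed
  define \<sigma>' where "\<sigma>' = T x \<bullet> T' (\<psi> x)"
  have Tx': "T x = \<sigma>' *\<^sub>R T' (\<psi> x)" using Tx by (simp add: \<sigma>'_def)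
  have "T x \<bullet> T x = \<sigma>'\<^sup>2" unfolding Tx' by (simp add: E'f[OF xW] power2_eq_square)
  then have \<sigma>': "\<sigma>' = 1 \<or> \<sigma>' = -1" using Ef[OF xW] by (simp add: power2_eq_1_iff)
  have DE: "fderiv E x w = \<sigma> *\<^sub>R fderiv E' (\<psi> x) (fderiv \<psi> x w)" for w
    by (rule fderiv_compose[OF openW2 xW2 \<psi>(2)[OF xW] has_derivative_scaleR_right[OF
          smooth_has_fderiv[OF B.op smE'(1) \<psi>(1)[OF xW]]] Es])
  have xM: "x \<in> M" using W by auto
  have DY: "fderiv f' (\<psi> x) (fderiv \<psi> x (Y x)) = \<sigma>' *\<^sub>R T' (\<psi> x)"
    using Df[OF xW, of "Y x"] Tx' by (simp add: T_def lie_def)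
  have "lie Y E x = \<sigma> *\<^sub>R fderiv E' (\<psi> x) (fderiv \<psi> x (Y x))"
    unfolding lie_def by (rule DE)
  also have "\<dots> = (\<sigma> * \<sigma>') *\<^sub>R lie Y' E' (\<psi> x)"
    using B.frame_expand[OF \<psi>(1)[OF xW] smE'(1), of "fderiv \<psi> x (Y x)", unfolded DY] E'f[OF xW]
    by (simp add: E'_def T'_def inner_commute)
  finally have EY: "lie Y E x = (\<sigma> * \<sigma>') *\<^sub>R lie Y' E' (\<psi> x)" .
  have Ex: "E x = \<sigma> *\<^sub>R E' (\<psi> x)" using Es[OF xW2] .
  have fx: "f' (\<psi> x) = f x" using ff'[OF xW] by simp
  have leaf': "on_leaf u v m1 m2 (f x) (E' (\<psi> x)) (T' (\<psi> x) \<bullet> J (f x)) (T' (\<psi> x) \<bullet> J (E' (\<psi> x)))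
       (lie Y' E' (\<psi> x) \<bullet> J (E' (\<psi> x)))"
    using leaf unfolding frame_on_leaf_def fx E'_def T'_def .
  have s1: "\<sigma> \<in> {1, - 1}" "\<sigma>' \<in> {1, - 1}" using \<sigma> \<sigma>' by auto
  show ?thesis
    using on_leaf_flip[OF leaf' s1]
    unfolding frame_on_leaf_def E_def[symmetric] T_def[symmetric] EY Ex Tx'
    by - (rule disjE[OF \<sigma>], simp_all add: J_scaleR J_minus mult_ac)
qed

section \<open>The mean curvature in the Berger metrics\<close>

text \<open>The adjugate replaces the inverse, from which it differs by the factor
  \<open>det G\<close>; the equation becomes polynomial.\<close>

lemma trace_matrix_inv_mult_eq_0:
  fixes G H :: "real^2^2"
  assumes "det G \<noteq> 0" "trace (matrix_inv G ** H) = 0"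
  shows "G$2$2 * H$1$1 - G$1$2 * H$2$1 - G$2$1 * H$1$2 + G$1$1 * H$2$2 = 0"
proof -
  have "\<exists>M. G ** M = mat 1 \<and> M ** G = mat 1"
    using assms(1) unfolding invertible_det_nz[symmetric] invertible_def .
  then have "matrix_inv G ** G = mat 1" unfolding matrix_inv_def by (rule someI2_ex) simp
  then have M: "(matrix_inv G ** G) $ i $ j = (mat 1 :: real^2^2) $ i $ j" for i j by simp
  define m11 m12 m21 m22 where "m11 = matrix_inv G $ 1 $ 1" and "m12 = matrix_inv G $ 1 $ 2"
    and "m21 = matrix_inv G $ 2 $ 1" and "m22 = matrix_inv G $ 2 $ 2"
  note m = m11_def[symmetric] m12_def[symmetric] m21_def[symmetric] m22_def[symmetric]
  have e: "m11 * G$1$1 + m12 * G$2$1 = 1" "m11 * G$1$2 + m12 * G$2$2 = 0"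
    "m21 * G$1$1 + m22 * G$2$1 = 0" "m21 * G$1$2 + m22 * G$2$2 = 1"
    using M[of 1 1] M[of 1 2] M[of 2 1] M[of 2 2]
    by (simp_all add: matrix_matrix_mult_def sum_2 mat_def m)
  have t: "m11 * H$1$1 + m12 * H$2$1 + (m21 * H$1$2 + m22 * H$2$2) = 0"
    using assms(2) by (simp add: trace_def matrix_matrix_mult_def sum_2 m)
  define D where "D = G$1$1 * G$2$2 - G$1$2 * G$2$1"
  have "D * m11 = G$2$2" "D * m12 = - G$1$2" "D * m21 = - G$2$1" "D * m22 = G$1$1"
    using e unfolding D_def by algebra+
  moreover have "D * (m11 * H$1$1 + m12 * H$2$1 + (m21 * H$1$2 + m22 * H$2$2)) =
    (D * m11) * H$1$1 + (D * m12) * H$2$1 + ((D * m21) * H$1$2 + (D * m22) * H$2$2)"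
    by (simp only: algebra_simps)
  ultimately show ?thesis unfolding t by (simp add: algebra_simps)
qed

lemma berger_metric_4: "berger_metric 4 \<tau> p X Y = X \<bullet> Y + (\<tau>\<^sup>2 - 1) * (X \<bullet> J p) * (Y \<bullet> J p)"
  by (simp add: berger_metric_def)

text \<open>The value 4 makes the conformal factor equal to 1. As \<open>J\<close> is skew, the
  derivatives in the Koszul formula collapse to two terms.\<close>

lemma koszul_berger_4:
  "koszul (berger_metric 4 \<tau>) p u v w = (\<tau>\<^sup>2 - 1) * ((v \<bullet> J p) * (w \<bullet> J u) + (u \<bullet> J p) * (w \<bullet> J v))"
proof -
  have D: "fderiv (\<lambda>q. berger_metric 4 \<tau> q X Y) p h =
    (\<tau>\<^sup>2 - 1) * ((X \<bullet> J p) * (Y \<bullet> J h) + (X \<bullet> J h) * (Y \<bullet> J p))" for X Y h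
  proof (rule fderiv_eqI)
    have "(J has_derivative J) (at p)" by (rule bounded_linear_imp_has_derivative[OF bounded_linear_J])
    then show "((\<lambda>q. berger_metric 4 \<tau> q X Y) has_derivative
      (\<lambda>h. (\<tau>\<^sup>2 - 1) * ((X \<bullet> J p) * (Y \<bullet> J h) + (X \<bullet> J h) * (Y \<bullet> J p)))) (at p)"
      unfolding berger_metric_4 by (auto intro!: derivative_eq_intros simp: algebra_simps)
  qed
  have "u \<bullet> J v = - (v \<bullet> J u)" "v \<bullet> J w = - (w \<bullet> J v)" "u \<bullet> J w = - (w \<bullet> J u)"
    by (metis inner_J_left inner_commute)+
  then show ?thesis unfolding koszul_def D by (simp add: field_simps)
qed

text \<open>In the round orthonormal basis \<open>e1\<close>, \<open>e2\<close>, the Berger metric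
  is the identity plus \<open>\<tau>\<^sup>2 - 1\<close> times a rank one form, and the second form
  gains a mixed term in \<eta> and \<open>w\<close>. In \<open>key\<close> the terms quadratic in
  \<open>\<tau>\<^sup>2 - 1\<close> cancel, so two values of \<tau> separate the
  coefficients.\<close>

lemma berger_minimal_at_point:
  fixes f :: "real^2 \<Rightarrow> C2" and x :: "real^2" and n e1 e2 :: C2 and a1 a2 c2 :: real
  defines "f1 \<equiv> partial 1 f x" and "f2 \<equiv> partial 2 f x" and "p \<equiv> f x"
    and "b11 \<equiv> partial 1 (partial 1 f) x \<bullet> n" and "b12 \<equiv> partial 1 (partial 2 f) x \<bullet> n"
    and "b22 \<equiv> partial 2 (partial 2 f) x \<bullet> n"
  assumes e: "e1 = a1 *\<^sub>R f1" "e2 = a2 *\<^sub>R f1 + c2 *\<^sub>R f2" "a1 \<noteq> 0" "c2 \<noteq> 0"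
    and on: "p \<bullet> p = 1" "e1 \<bullet> e1 = 1" "e2 \<bullet> e2 = 1" "n \<bullet> n = 1" "p \<bullet> e1 = 0" "p \<bullet> e2 = 0" "p \<bullet> n = 0"
      "e1 \<bullet> e2 = 0" "e1 \<bullet> n = 0" "e2 \<bullet> n = 0"
    and sym: "partial 1 (partial 2 f) x = partial 2 (partial 1 f) x"
    and min: "\<And>\<tau> N. \<tau> \<noteq> 0 \<Longrightarrow> unit_normal (berger_metric 4 \<tau>) f x N \<Longrightarrow>
      mean_curvature (berger_metric 4 \<tau>) f x N = 0"
  defines "b11' \<equiv> a1 * a1 * b11" and "b12' \<equiv> a1 * (a2 * b11 + c2 * b12)"
    and "b22' \<equiv> a2 * a2 * b11 + 2 * a2 * c2 * b12 + c2 * c2 * b22"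
  shows "b11' + b22' = 0"
    and "(e2 \<bullet> J p)\<^sup>2 * b11' - 2 * (e1 \<bullet> J p) * (e2 \<bullet> J p) * b12' + (e1 \<bullet> J p)\<^sup>2 * b22' = 0"
proof -
  define \<eta>1 \<eta>2 \<nu> where "\<eta>1 = e1 \<bullet> J p" and "\<eta>2 = e2 \<bullet> J p" and "\<nu> = n \<bullet> J p"
  define w1 w2 where "w1 = n \<bullet> J e1" and "w2 = n \<bullet> J e2"
  have JpJp: "J p \<bullet> J p = 1" using on by (simp add: norm_J)
  have pS: "p \<in> S3" using on by (simp add: norm_eq_sqrt_inner)
  have on': "e1 \<bullet> p = 0" "e2 \<bullet> p = 0" "n \<bullet> p = 0" "e2 \<bullet> e1 = 0" "n \<bullet> e1 = 0" "n \<bullet> e2 = 0"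
    using on by (simp_all add: inner_commute)
  have Jp: "J p = \<eta>1 *\<^sub>R e1 + \<eta>2 *\<^sub>R e2 + \<nu> *\<^sub>R n"
    by (rule orthonormal_eqI[of p e1 e2 n])
      (use on on' in \<open>simp_all add: inner_add_left J_tangent \<eta>1_def \<eta>2_def \<nu>_def inner_commute[of "J p"]\<close>)
  have "J p \<bullet> J p = \<eta>1 * \<eta>1 + \<eta>2 * \<eta>2 + \<nu> * \<nu>"
    by (subst Jp) (simp add: inner_add_left \<eta>1_def \<eta>2_def \<nu>_def)
  then have sum1: "\<eta>1 * \<eta>1 + \<eta>2 * \<eta>2 + \<nu> * \<nu> = 1" using JpJp by simp
  text \<open>\<open>J\<close> maps the tangential part of the Hopf field into the span of \<open>p\<close> and \<open>J n\<close>.\<close>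
  have "n \<bullet> J (J p) = \<eta>1 * w1 + \<eta>2 * w2"
    by (subst Jp) (simp add: J_add J_scaleR inner_add_right inner_J_self w1_def w2_def)
  then have br: "\<eta>1 * w1 + \<eta>2 * w2 = 0" using on' by (simp add: J_J)
  have "n \<bullet> (c2 *\<^sub>R f2) = n \<bullet> e2 - a2 / a1 * (n \<bullet> e1)" "p \<bullet> (c2 *\<^sub>R f2) = p \<bullet> e2 - a2 / a1 * (p \<bullet> e1)"
    using e(3) unfolding e(1,2) by (simp_all add: inner_add_right)
  then have fn: "f1 \<bullet> n = 0" "f2 \<bullet> n = 0" "p \<bullet> f1 = 0" "p \<bullet> f2 = 0"
    using on on' e by (simp_all add: inner_commute)
  have key: "(1 + (\<tau>\<^sup>2 - 1) * (\<eta>2 * \<eta>2)) * (b11' + 2 * (\<tau>\<^sup>2 - 1) * (\<eta>1 * w1))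
      - 2 * ((\<tau>\<^sup>2 - 1) * (\<eta>1 * \<eta>2)) * (b12' + (\<tau>\<^sup>2 - 1) * (\<eta>1 * w2 + \<eta>2 * w1))
      + (1 + (\<tau>\<^sup>2 - 1) * (\<eta>1 * \<eta>1)) * (b22' + 2 * (\<tau>\<^sup>2 - 1) * (\<eta>2 * w2)) = 0" if \<tau>: "\<tau> \<noteq> 0" for \<tau> :: real
  proof -
    let ?g = "berger_metric 4 \<tau>" and ?m = "\<tau>\<^sup>2 - 1"
    \<comment> \<open>The vector that represents \<open>Z \<bullet> n\<close> in the Berger metric,
      as \<open>gN\<close> records up to the factor \<open>c\<close>; hence it is normal to the same
      tangent plane.\<close>
    define N0 where "N0 = n - ((1 - 1 / \<tau>\<^sup>2) * \<nu>) *\<^sub>R J p"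
    have "N0 \<noteq> 0"
    proof
      assume z: "N0 = 0"
      have "N0 \<bullet> J p = \<nu> / \<tau>\<^sup>2" by (simp add: N0_def inner_diff_left JpJp \<nu>_def algebra_simps)
      then have "\<nu> = 0" using z \<tau> by simp
      then show False using z on by (simp add: N0_def)
    qed
    then have pos: "?g p N0 N0 > 0" using berger_metric_pos[of 4 \<tau> p N0] \<tau> pS by simp
    define c where "c = 1 / sqrt (?g p N0 N0)"
    have c: "c > 0" "c * c * ?g p N0 N0 = 1" using pos by (auto simp: c_def)
    define N where "N = c *\<^sub>R N0"
    have gN: "?g p Z N = c * (Z \<bullet> n)" for Z
      unfolding berger_metric_4 N_def N0_def using \<tau>
      by (simp add: inner_diff_left inner_diff_right JpJp \<nu>_def field_simps)
    have NJ: "N \<bullet> J v = c * (n \<bullet> J v)" if "p \<bullet> v = 0" for v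
      using that by (simp add: N_def N0_def inner_diff_left inner_J_J)
    have UN: "unit_normal ?g f x N"
      unfolding unit_normal_def tangent_S3_def
    proof (intro conjI allI)
      show "N \<in> {v. v \<bullet> f x = 0}" using on' by (simp add: N_def N0_def inner_diff_left J_tangent flip: p_def)
      show "?g (f x) (partial i f x) N = 0" for i
        unfolding p_def[symmetric] gN using fn exhaust_2[of i] by (auto simp: f1_def f2_def)
      have "?g p N N = c * c * ?g p N0 N0" unfolding berger_metric_4 N_def by (simp add: algebra_simps)
      then show "?g (f x) N N = 1" using c(2) by (simp add: p_def)
    qed
    have Nt: "N \<in> tangent_S3 (f x)" using UN by (simp add: unit_normal_def)
    have fS: "f x \<in> S3" using pS by (simp add: p_def)
    define G H where "G = first_fundamental_form ?g f x" and "H = second_fundamental_form ?g f x N"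
    have H: "H $ i $ j = c * (partial i (partial j f) x \<bullet> n)
        + ?m * ((partial j f x \<bullet> J p) * (N \<bullet> J (partial i f x)) + (partial i f x \<bullet> J p) * (N \<bullet> J (partial j f x)))" for i j
      unfolding H_def second_fundamental_form_def
      using covariant_deriv_berger(2)[of 4 \<tau> f x N i "partial j f", OF _ \<tau> fS Nt]
      by (simp add: koszul_berger_4 gN flip: p_def)
    have G: "G $ i $ j = partial i f x \<bullet> partial j f x + ?m * (partial i f x \<bullet> J p) * (partial j f x \<bullet> J p)" for i j
      by (simp add: G_def first_fundamental_form_def berger_metric_4 flip: p_def)
    have sG: "G$2$1 = G$1$2" and sH: "H$2$1 = H$1$2"
      by (simp_all add: G H sym inner_commute algebra_simps)
    have G': "a1 * a1 * G$1$1 = 1 + ?m * (\<eta>1 * \<eta>1)" "a1 * (a2 * G$1$1 + c2 * G$1$2) = ?m * (\<eta>1 * \<eta>2)"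
      "a2 * a2 * G$1$1 + 2 * a2 * c2 * G$1$2 + c2 * c2 * G$2$2 = 1 + ?m * (\<eta>2 * \<eta>2)"
      using on(2,3,8) unfolding G f1_def[symmetric] f2_def[symmetric] \<eta>1_def \<eta>2_def e(1,2)
      by (simp_all add: inner_add_left inner_add_right inner_commute[of f2 f1] algebra_simps)
    have H': "a1 * a1 * H$1$1 = c * (b11' + 2 * ?m * (\<eta>1 * w1))"
      "a1 * (a2 * H$1$1 + c2 * H$1$2) = c * (b12' + ?m * (\<eta>1 * w2 + \<eta>2 * w1))"
      "a2 * a2 * H$1$1 + 2 * a2 * c2 * H$1$2 + c2 * c2 * H$2$2 = c * (b22' + 2 * ?m * (\<eta>2 * w2))"
      unfolding H f1_def[symmetric] f2_def[symmetric] NJ[OF fn(3)] NJ[OF fn(4)] \<eta>1_def \<eta>2_def w1_def w2_def e(1,2)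
        b11'_def b12'_def b22'_def b11_def b12_def b22_def
      by (simp_all add: inner_add_left inner_add_right J_add J_scaleR algebra_simps)
    \<comment> \<open>The Gram determinant is computed in the basis \<open>e1\<close>,
      \<open>e2\<close>; the change of basis has determinant \<open>a1 * c2\<close>.\<close>
    have "(a1 * c2)\<^sup>2 * (G$1$1 * G$2$2 - G$1$2 * G$1$2) = (a1 * a1 * G$1$1) *
        (a2 * a2 * G$1$1 + 2 * a2 * c2 * G$1$2 + c2 * c2 * G$2$2) - (a1 * (a2 * G$1$1 + c2 * G$1$2))\<^sup>2" by algebra
    also have "\<dots> = \<nu> * \<nu> + \<tau>\<^sup>2 * (\<eta>1 * \<eta>1 + \<eta>2 * \<eta>2)" unfolding G' using sum1 by algebra
    also have "\<dots> \<noteq> 0"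
    proof
      assume "\<nu> * \<nu> + \<tau>\<^sup>2 * (\<eta>1 * \<eta>1 + \<eta>2 * \<eta>2) = 0"
      then have "\<nu> * \<nu> = 0" "\<tau>\<^sup>2 * (\<eta>1 * \<eta>1 + \<eta>2 * \<eta>2) = 0"
        using add_nonneg_eq_0_iff[of "\<nu> * \<nu>" "\<tau>\<^sup>2 * (\<eta>1 * \<eta>1 + \<eta>2 * \<eta>2)"] by auto
      then show False using sum1 \<tau> by simp
    qed
    finally have "det G \<noteq> 0" unfolding det_2 sG by auto
    moreover have "trace (matrix_inv G ** H) = 0"
      using min[OF \<tau> UN] by (simp add: mean_curvature_def G_def H_def)
    ultimately have "G$2$2 * H$1$1 - G$1$2 * H$1$2 - G$1$2 * H$1$2 + G$1$1 * H$2$2 = 0"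
      using trace_matrix_inv_mult_eq_0[of G H] unfolding sG sH by blast
    then have "(a2 * a2 * G$1$1 + 2 * a2 * c2 * G$1$2 + c2 * c2 * G$2$2) * (a1 * a1 * H$1$1)
      - 2 * (a1 * (a2 * G$1$1 + c2 * G$1$2)) * (a1 * (a2 * H$1$1 + c2 * H$1$2))
      + (a1 * a1 * G$1$1) * (a2 * a2 * H$1$1 + 2 * a2 * c2 * H$1$2 + c2 * c2 * H$2$2) = 0"
      by algebra
    then have "c * ((1 + ?m * (\<eta>2 * \<eta>2)) * (b11' + 2 * ?m * (\<eta>1 * w1))
      - 2 * (?m * (\<eta>1 * \<eta>2)) * (b12' + ?m * (\<eta>1 * w2 + \<eta>2 * w1))
      + (1 + ?m * (\<eta>1 * \<eta>1)) * (b22' + 2 * ?m * (\<eta>2 * w2))) = 0"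
      unfolding G' H' by algebra
    then show ?thesis using c(1) by simp
  qed
  \<comment> \<open>At \<open>\<tau> = 1\<close> the metric is round. At \<open>\<tau> = 2\<close>
    the factor \<open>\<tau>\<^sup>2 - 1\<close> is \<open>3\<close>, and \<open>br\<close> removes
    the terms in \<open>w1\<close> and \<open>w2\<close>.\<close>
  have A0: "b11' + b22' = 0" using key[of 1] by simp
  have "(b11' + b22') + 3 * (\<eta>2\<^sup>2 * b11' - 2 * \<eta>1 * \<eta>2 * b12' + \<eta>1\<^sup>2 * b22') + 6 * (\<eta>1 * w1 + \<eta>2 * w2) = 0"
    using key[of 2] by (simp add: power2_eq_square algebra_simps)
  then have "\<eta>2\<^sup>2 * b11' - 2 * \<eta>1 * \<eta>2 * b12' + \<eta>1\<^sup>2 * b22' = 0" unfolding A0 br by simp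
  then show "b11' + b22' = 0" "(e2 \<bullet> J p)\<^sup>2 * b11' - 2 * (e1 \<bullet> J p) * (e2 \<bullet> J p) * b12' + (e1 \<bullet> J p)\<^sup>2 * b22' = 0"
    using A0 by (simp_all add: \<eta>1_def \<eta>2_def)
qed

section \<open>Frames on minimal surfaces\<close>

text \<open>For an adapted frame this is \<open>k * k - d * s\<close>, the second fundamental form
  on \<open>E\<close> and \<open>T\<close> by \<open>E_Y_N\<close>, written in terms of
  \<open>f\<close>, \<open>X\<close>, \<open>Y\<close> for use outside the locale.\<close>

definition curvature ::
  "(real^2 \<Rightarrow> C2) \<Rightarrow> (real^2 \<Rightarrow> real^2) \<Rightarrow> (real^2 \<Rightarrow> real^2) \<Rightarrow> real^2 \<Rightarrow> real" where
  "curvature f X Y x =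
     (lie Y f x \<bullet> J (lie X f x)) * (lie Y f x \<bullet> J (lie X f x))
     - (lie Y (lie X f) x \<bullet> J (lie X f x)) * (lie Y f x \<bullet> J (f x))"

text \<open>The condition \<open>hopf0\<close> says that the horizontal tangent vector
  \<open>\<eta>2 *\<^sub>R e1 - \<eta>1 *\<^sub>R e2\<close> is asymptotic. It is void where the
  tangent plane is horizontal, and frames there need a separate construction.\<close>

locale minimal_patch =
  fixes M :: "(real^2) set" and f :: "real^2 \<Rightarrow> C2" and X1 X2 :: "real^2 \<Rightarrow> real^2" and n :: "real^2 \<Rightarrow> C2"
    and e1 e2 :: "real^2 \<Rightarrow> C2" and b11 b12 b22 \<eta>1 \<eta>2 :: "real^2 \<Rightarrow> real"
  defines "e1 \<equiv> lie X1 f" and "e2 \<equiv> lie X2 f"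
    and "b11 \<equiv> \<lambda>x. lie X1 e1 x \<bullet> n x" and "b12 \<equiv> \<lambda>x. lie X1 e2 x \<bullet> n x"
    and "b22 \<equiv> \<lambda>x. lie X2 e2 x \<bullet> n x"
    and "\<eta>1 \<equiv> \<lambda>x. e1 x \<bullet> J (f x)" and "\<eta>2 \<equiv> \<lambda>x. e2 x \<bullet> J (f x)"
  assumes op: "open M" and smf: "smooth_on M f" and smX1: "smooth_on M X1" and smX2: "smooth_on M X2"
    and smn: "smooth_on M n"
    and ff: "x \<in> M \<Longrightarrow> f x \<bullet> f x = 1"
    and e11: "x \<in> M \<Longrightarrow> e1 x \<bullet> e1 x = 1" and e22: "x \<in> M \<Longrightarrow> e2 x \<bullet> e2 x = 1"
    and e12: "x \<in> M \<Longrightarrow> e1 x \<bullet> e2 x = 0"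
    and nn: "x \<in> M \<Longrightarrow> n x \<bullet> n x = 1" and nf: "x \<in> M \<Longrightarrow> f x \<bullet> n x = 0"
    and ne1: "x \<in> M \<Longrightarrow> e1 x \<bullet> n x = 0" and ne2: "x \<in> M \<Longrightarrow> e2 x \<bullet> n x = 0"
    and mean0: "x \<in> M \<Longrightarrow> b11 x + b22 x = 0"
    and hopf0: "x \<in> M \<Longrightarrow> (\<eta>2 x)\<^sup>2 * b11 x - 2 * \<eta>1 x * \<eta>2 x * b12 x + (\<eta>1 x)\<^sup>2 * b22 x = 0"
begin

lemma sme1: "smooth_on M e1" and sme2: "smooth_on M e2"
  unfolding e1_def e2_def by (intro smooth_on_lie op smf smX1 smX2)+

lemma smb11: "smooth_on M b11" and smb12: "smooth_on M b12" and sm\<eta>1: "smooth_on M \<eta>1" and sm\<eta>2: "smooth_on M \<eta>2"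
  unfolding b11_def b12_def \<eta>1_def \<eta>2_def by (intro smooth_intros op smf sme1 sme2 smX1 smX2 smn)+

lemmas sm = op smf smX1 smX2 smn sme1 sme2 smb11 smb12 sm\<eta>1 sm\<eta>2

lemma lin: "smooth_on M u \<Longrightarrow> x \<in> M \<Longrightarrow> linear (fderiv u x)"
  using smooth_has_fderiv[OF op] has_derivative_linear by blast

lemma zero_deriv:
  assumes "x \<in> M" "smooth_on M u" "\<And>y. y \<in> M \<Longrightarrow> u y = c"
  shows "fderiv u x v = 0"
  using fderiv_cong[OF op assms(2,1), of "\<lambda>_. c"] assms(3) by simp

lemma expand_deriv:
  assumes x: "x \<in> M" and u: "smooth_on M u"
  shows "fderiv u x v = (fderiv f x v \<bullet> e1 x) *\<^sub>R lie X1 u x + (fderiv f x v \<bullet> e2 x) *\<^sub>R lie X2 u x"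
  using fderiv_span_pair[OF lin[OF smf x] lin[OF u x]] e11[OF x] e22[OF x] e12[OF x] unfolding e1_def e2_def by blast

lemma fe: assumes x: "x \<in> M" shows "f x \<bullet> fderiv f x v = 0"
proof -
  have "fderiv (\<lambda>y. f y \<bullet> f y) x v = 2 * (f x \<bullet> fderiv f x v)"
    using lie_inner[OF op x smf smf, of "\<lambda>_. v"] by (simp add: inner_commute lie_def)
  moreover have "fderiv (\<lambda>y. f y \<bullet> f y) x v = 0"
    by (rule zero_deriv[OF x, of _ 1]) (intro smooth_intros sm | simp add: ff)+
  ultimately show ?thesis by simp
qed

lemma inner_values:
  assumes x: "x \<in> M"
  shows "f x \<bullet> f x = 1" "e1 x \<bullet> e1 x = 1" "e2 x \<bullet> e2 x = 1" "n x \<bullet> n x = 1"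
    "f x \<bullet> e1 x = 0" "f x \<bullet> e2 x = 0" "f x \<bullet> n x = 0" "e1 x \<bullet> e2 x = 0" "e1 x \<bullet> n x = 0" "e2 x \<bullet> n x = 0"
    "e1 x \<bullet> f x = 0" "e2 x \<bullet> f x = 0" "n x \<bullet> f x = 0" "e2 x \<bullet> e1 x = 0" "n x \<bullet> e1 x = 0" "n x \<bullet> e2 x = 0"
  using ff[OF x] e11[OF x] e22[OF x] e12[OF x] nn[OF x] nf[OF x] ne1[OF x] ne2[OF x] fe[OF x, of "X1 x"] fe[OF x, of "X2 x"]
  by (simp_all add: e1_def e2_def lie_def inner_commute)

lemma vec_eqI:
  assumes x: "x \<in> M" and "u \<bullet> f x = w \<bullet> f x" "u \<bullet> e1 x = w \<bullet> e1 x" "u \<bullet> e2 x = w \<bullet> e2 x" "u \<bullet> n x = w \<bullet> n x"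
  shows "u = w"
  by (rule orthonormal_eqI[of "f x" "e1 x" "e2 x" "n x"]) (use assms in \<open>simp_all add: inner_values\<close>)

lemma deriv_n: assumes x: "x \<in> M" shows "fderiv f x v \<bullet> n x = 0"
  using arg_cong[OF expand_deriv[OF x smf, of v], of "\<lambda>u. u \<bullet> n x"] x
  by (simp add: inner_add_left inner_values flip: e1_def e2_def)

text \<open>Symmetry of the second fundamental form: the bracket contributes a tangent
  vector.\<close>

lemma b21: assumes x: "x \<in> M" shows "lie X2 e1 x \<bullet> n x = b12 x"
proof -
  have "(lie X2 e1 x - lie X1 e2 x) \<bullet> n x = 0"
    unfolding e1_def e2_def lie_commutator[OF op smf smX1 smX2 x] by (rule deriv_n[OF x])
  then show ?thesis by (simp add: b12_def inner_diff_left)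
qed

lemma b22: "x \<in> M \<Longrightarrow> lie X2 e2 x \<bullet> n x = - b11 x"
  using mean0[of x] by (simp add: b22_def)

lemma frame_deriv_n:
  assumes x: "x \<in> M"
  shows "fderiv e1 x v \<bullet> n x = (fderiv f x v \<bullet> e1 x) * b11 x + (fderiv f x v \<bullet> e2 x) * b12 x"
    "fderiv e2 x v \<bullet> n x = (fderiv f x v \<bullet> e1 x) * b12 x - (fderiv f x v \<bullet> e2 x) * b11 x"
  unfolding expand_deriv[OF x sme1, of v] expand_deriv[OF x sme2, of v]
  using b21[OF x] b22[OF x] by (simp_all add: inner_add_left) (simp_all add: b11_def b12_def)

lemma hopf_normal:
  assumes x: "x \<in> M" and "\<eta>1 x = 0" "\<eta>2 x = 0"
  shows "J (f x) = (J (f x) \<bullet> n x) *\<^sub>R n x"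
proof (rule vec_eqI[OF x])
  show "J (f x) \<bullet> e1 x = ((J (f x) \<bullet> n x) *\<^sub>R n x) \<bullet> e1 x" "J (f x) \<bullet> e2 x = ((J (f x) \<bullet> n x) *\<^sub>R n x) \<bullet> e2 x"
    using assms by (simp_all add: inner_values \<eta>1_def \<eta>2_def inner_commute[of "J (f x)"])
qed (use x in \<open>simp_all add: inner_values J_tangent\<close>)

text \<open>The normal is constant where the second fundamental form vanishes.\<close>

lemma umbilic_ball_geodesic:
  assumes sub: "ball q r \<subseteq> M" and umb: "\<And>x. x \<in> ball q r \<Longrightarrow> b11 x = 0 \<and> b12 x = 0" and x: "x \<in> ball q r"
  shows "f x \<bullet> n q = 0"
proof -
  have "n x = n q"
  proof (rule has_derivative_zero_unique_connected[of "ball q r" n])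
    fix y assume y: "y \<in> ball q r"
    then have yM: "y \<in> M" using sub by auto
    have "fderiv n y v = 0" for v
    proof (rule vec_eqI[OF yM])
      have D: "u y \<bullet> fderiv n y v + fderiv u y v \<bullet> n y = 0"
        if "smooth_on M u" "\<And>z. z \<in> M \<Longrightarrow> u z \<bullet> n z = c" for u c
        using lie_inner[OF op yM that(1) smn, of "\<lambda>_. v"]
          zero_deriv[OF yM smooth_on_inner[OF op that(1) smn] that(2), of v]
        by (simp add: lie_def)
      show "fderiv n y v \<bullet> n y = 0 \<bullet> n y"
        using D[OF smn, of 1] by (simp add: inner_values inner_commute)
      show "fderiv n y v \<bullet> f y = 0 \<bullet> f y"
        using D[OF smf, of 0] deriv_n[OF yM] by (simp add: inner_values inner_commute)
      show "fderiv n y v \<bullet> e1 y = 0 \<bullet> e1 y" "fderiv n y v \<bullet> e2 y = 0 \<bullet> e2 y"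
        using D[OF sme1, of 0] D[OF sme2, of 0] frame_deriv_n[OF yM, of v] umb[OF y]
        by (simp_all add: inner_values inner_commute)
    qed
    then have "fderiv n y = (\<lambda>v. 0)" by auto
    then show "(n has_derivative (\<lambda>v. 0)) (at y)" using smooth_has_fderiv[OF op smn yM] by simp
  qed (use x in \<open>auto intro: le_less_trans[OF zero_le_dist]\<close>)
  then show ?thesis using inner_values(7)[of x] x sub by auto
qed

text \<open>One derivative of \<open>f x \<bullet> N0 = 0\<close> shows that \<open>N0\<close> is
  orthogonal to the tangent plane, hence a multiple of \<open>n\<close>; a second one makes the
  second form vanish.\<close>

lemma normal_vector:
  assumes r: "r > 0" "ball q r \<subseteq> M" and N0: "\<And>x. x \<in> ball q r \<Longrightarrow> f x \<bullet> N0 = 0"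
  shows "N0 = (N0 \<bullet> n q) *\<^sub>R n q" "N0 \<noteq> 0 \<Longrightarrow> b11 q = 0 \<and> b12 q = 0"
proof -
  have D: "fderiv u y v \<bullet> N0 = 0"
    if "smooth_on M u" "\<And>z. z \<in> ball q r \<Longrightarrow> u z \<bullet> N0 = 0" "y \<in> ball q r" for u :: "real^2 \<Rightarrow> C2" and y v
  proof -
    have u: "smooth_on (ball q r) u" using smooth_on_subset[OF that(1) r(2)] .
    have c: "smooth_on (ball q r) (\<lambda>_. N0)" by (rule smooth_on_const) simp
    have "lie (\<lambda>_. v) (\<lambda>y. u y \<bullet> N0) y = lie (\<lambda>_. v) (\<lambda>y. 0) y"
      by (rule lie_cong[of "ball q r"]) (use that u c in \<open>auto intro: smooth_on_inner\<close>)
    then show ?thesis using lie_inner[OF _ that(3) u c, of "\<lambda>_. v"] by (simp add: lie_def)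
  qed
  have q: "q \<in> ball q r" "q \<in> M" using r by auto
  have e: "e1 y \<bullet> N0 = 0" "e2 y \<bullet> N0 = 0" if "y \<in> ball q r" for y
    using D[OF smf N0 that] by (simp_all add: e1_def e2_def lie_def)
  show eq: "N0 = (N0 \<bullet> n q) *\<^sub>R n q"
    by (rule vec_eqI[OF q(2)]) (use N0[OF q(1)] e[OF q(1)] q in \<open>simp_all add: inner_values inner_commute[of N0]\<close>)
  assume "N0 \<noteq> 0"
  then have nz: "N0 \<bullet> n q \<noteq> 0" using eq by auto
  have w: "w \<bullet> N0 = (N0 \<bullet> n q) * (w \<bullet> n q)" for w by (subst eq) simp
  have "fderiv e1 q (X1 q) \<bullet> N0 = 0" "fderiv e2 q (X1 q) \<bullet> N0 = 0"
    by (rule D[OF sme1 e(1) q(1)], assumption) (rule D[OF sme2 e(2) q(1)], assumption)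
  then have "(N0 \<bullet> n q) * b11 q = 0" "(N0 \<bullet> n q) * b12 q = 0"
    unfolding w by (simp_all add: b11_def b12_def lie_def)
  then show "b11 q = 0 \<and> b12 q = 0" using nz by simp
qed

end

section \<open>Rotated frames\<close>

locale rotated_frame = minimal_patch +
  fixes M' :: "(real^2) set" and c S :: "real^2 \<Rightarrow> real" and X Y :: "real^2 \<Rightarrow> real^2"
  defines "X \<equiv> \<lambda>y. c y *\<^sub>R X1 y - S y *\<^sub>R X2 y" and "Y \<equiv> \<lambda>y. S y *\<^sub>R X1 y + c y *\<^sub>R X2 y"
  assumes op': "open M'" and sub: "M' \<subseteq> M" and smc: "smooth_on M' c" and smS: "smooth_on M' S"
    and cS: "x \<in> M' \<Longrightarrow> (c x)\<^sup>2 + (S x)\<^sup>2 = 1"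
begin

lemma sm': "smooth_on M' f" "smooth_on M' X1" "smooth_on M' X2" "smooth_on M' n" "smooth_on M' e1" "smooth_on M' e2"
  using sm sub smooth_on_subset by blast+

lemma smXY: "smooth_on M' X" "smooth_on M' Y"
  unfolding X_def Y_def by (intro smooth_intros op' smc smS sm')+

lemma lie_XY:
  assumes x: "x \<in> M'" and u: "smooth_on M u \<or> smooth_on M' u"
  shows "lie X u x = c x *\<^sub>R lie X1 u x - S x *\<^sub>R lie X2 u x"
    "lie Y u x = S x *\<^sub>R lie X1 u x + c x *\<^sub>R lie X2 u x"
proof -
  have u': "smooth_on M' u" using u sub smooth_on_subset by blast
  have l: "linear (fderiv u x)"
    using smooth_has_fderiv[OF op' u' x] has_derivative_linear by blast
  show "lie X u x = c x *\<^sub>R lie X1 u x - S x *\<^sub>R lie X2 u x"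
    "lie Y u x = S x *\<^sub>R lie X1 u x + c x *\<^sub>R lie X2 u x"
    by (simp_all only: lie_def X_def Y_def linear_add[OF l] linear_diff[OF l] linear_scale[OF l])
qed

lemma E_T:
  assumes x: "x \<in> M'"
  shows "lie X f x = c x *\<^sub>R e1 x - S x *\<^sub>R e2 x" "lie Y f x = S x *\<^sub>R e1 x + c x *\<^sub>R e2 x"
  using lie_XY[OF x, of f] smf by (simp_all add: e1_def e2_def)

text \<open>Derivatives of the coefficients multiply tangent vectors and do not reach the normal
  component.\<close>

lemma comb_deriv_n:
  assumes x: "x \<in> M'" and ab: "smooth_on M' a" "smooth_on M' b"
  shows "lie Z (\<lambda>y. a y *\<^sub>R e1 y + b y *\<^sub>R e2 y) x \<bullet> n x = a x * (lie Z e1 x \<bullet> n x) + b x * (lie Z e2 x \<bullet> n x)"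
  using x sub ab
  by (auto simp: lie_simps[OF op' x] smooth_intros sm' op' inner_add_left inner_values)

text \<open>Together with \<open>xy\<close> these are the entries of the second form in the rotated
  frame; being traceless, it turns by the double angle.\<close>

definition xx where "xx x = ((c x)\<^sup>2 - (S x)\<^sup>2) * b11 x - 2 * c x * S x * b12 x"
definition xy where "xy x = 2 * c x * S x * b11 x + ((c x)\<^sup>2 - (S x)\<^sup>2) * b12 x"

lemma xx_xy: "x \<in> M' \<Longrightarrow> (xx x)\<^sup>2 + (xy x)\<^sup>2 = (b11 x)\<^sup>2 + (b12 x)\<^sup>2"
proof -
  assume x: "x \<in> M'"
  have "(xx x)\<^sup>2 + (xy x)\<^sup>2 = ((c x)\<^sup>2 + (S x)\<^sup>2)\<^sup>2 * ((b11 x)\<^sup>2 + (b12 x)\<^sup>2)"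
    unfolding xx_def xy_def by algebra
  then show ?thesis using cS[OF x] by simp
qed

lemma second_form:
  assumes x: "x \<in> M'"
  shows "lie X (lie X f) x \<bullet> n x = xx x" "lie Y (lie X f) x \<bullet> n x = xy x"
    "lie Y (lie Y f) x \<bullet> n x = - xx x"
proof -
  have xM: "x \<in> M" using x sub by auto
  have E: "lie Z (lie X f) x = lie Z (\<lambda>y. c y *\<^sub>R e1 y + (- S y) *\<^sub>R e2 y) x" for Z
    by (rule lie_cong[OF op' x]) (intro smooth_on_lie op' sm' smXY | simp add: E_T)+
  have T: "lie Z (lie Y f) x = lie Z (\<lambda>y. S y *\<^sub>R e1 y + c y *\<^sub>R e2 y) x" for Z
    by (rule lie_cong[OF op' x]) (intro smooth_on_lie op' sm' smXY | simp add: E_T)+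
  have b: "lie X1 e1 x \<bullet> n x = b11 x" "lie X1 e2 x \<bullet> n x = b12 x" by (simp_all add: b11_def b12_def)
  note D = lie_XY[OF x disjI1[OF sme1]] lie_XY[OF x disjI1[OF sme2]]
  show "lie X (lie X f) x \<bullet> n x = xx x" "lie Y (lie X f) x \<bullet> n x = xy x"
    "lie Y (lie Y f) x \<bullet> n x = - xx x"
    unfolding E T comb_deriv_n[OF x smc smooth_on_minus[OF op' smS]] comb_deriv_n[OF x smS smc] D
    by (simp_all add: inner_add_left inner_diff_left b b21[OF xM] b22[OF xM] xx_def xy_def power2_eq_square algebra_simps)
qed

lemma E_T_inner:
  assumes x: "x \<in> M'"
  shows "lie X f x \<bullet> lie X f x = 1" "lie Y f x \<bullet> lie Y f x = 1" "lie X f x \<bullet> lie Y f x = 0"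
    "lie X f x \<bullet> f x = 0" "lie Y f x \<bullet> f x = 0" "lie X f x \<bullet> n x = 0" "lie Y f x \<bullet> n x = 0"
  using x sub cS[OF x] unfolding E_T[OF x]
  by (auto simp: inner_add_left inner_diff_left inner_add_right inner_diff_right inner_values power2_eq_square algebra_simps)

text \<open>The vector \<open>N\<close> is orthogonal to \<open>f\<close>, \<open>E\<close> and
  \<open>T\<close>, hence a multiple of \<open>n\<close>, so the asymptotic conditions carry over.
  Both are unit vectors; the sign between them disappears in the square of the curvature.\<close>

lemma adapted:
  assumes hor: "\<And>x. x \<in> M' \<Longrightarrow> lie X f x \<bullet> J (f x) = 0" and asy: "\<And>x. x \<in> M' \<Longrightarrow> xx x = 0"
    and dense: "\<And>x e. x \<in> M' \<Longrightarrow> e > 0 \<Longrightarrow> \<exists>z\<in>M' \<inter> ball x e. lie Y f z \<bullet> J (f z) \<noteq> 0"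
  shows "adapted_frame M' f X Y"
    and "x \<in> M' \<Longrightarrow> (curvature f X Y x)\<^sup>2 = (b11 x)\<^sup>2 + (b12 x)\<^sup>2"
proof -
  define s k where "s = (\<lambda>x. lie Y f x \<bullet> J (f x))" and "k = (\<lambda>x. lie Y f x \<bullet> J (lie X f x))"
  define N where "N = (\<lambda>x. k x *\<^sub>R J (f x) - s x *\<^sub>R J (lie X f x))"
  have N: "N x = (N x \<bullet> n x) *\<^sub>R n x" if x: "x \<in> M'" for x
  proof -
    let ?E = "lie X f x" and ?T = "lie Y f x"
    note h = E_T_inner[OF x] hor[OF x]
    have xM: "x \<in> M" using x sub by auto
    have fJE: "f x \<bullet> J ?E = 0" using hor[OF x] inner_J_left[of "f x" ?E] by (simp add: inner_commute)
    have c: "f x \<bullet> ?E = 0" "f x \<bullet> ?T = 0" "?T \<bullet> ?E = 0" using h by (simp_all add: inner_commute)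
    have T: "?T \<bullet> J (f x) = s x" "?T \<bullet> J ?E = k x" by (simp_all add: s_def k_def)
    have NfET: "N x \<bullet> f x = 0" "N x \<bullet> ?E = 0" "N x \<bullet> ?T = 0"
      using h fJE T by (simp_all add: N_def inner_diff_left J_tangent inner_commute[of "J _"] inner_J_self)
    show ?thesis
      by (rule orthonormal_eqI[of "f x" ?E ?T "n x"])
        (use h c NfET in \<open>simp_all add: inner_values[OF xM] inner_commute[of "n x" ?E] inner_commute[of "n x" ?T]\<close>)
  qed
  have Nu: "u \<bullet> N x = (N x \<bullet> n x) * (u \<bullet> n x)" if "x \<in> M'" for u x
    by (subst N[OF that]) simp
  show F: "adapted_frame M' f X Y"
  proof
    show "lie X (lie X f) x \<bullet> ((lie Y f x \<bullet> J (lie X f x)) *\<^sub>R J (f x) - (lie Y f x \<bullet> J (f x)) *\<^sub>R J (lie X f x)) = 0"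
      "lie Y (lie Y f) x \<bullet> ((lie Y f x \<bullet> J (lie X f x)) *\<^sub>R J (f x) - (lie Y f x \<bullet> J (f x)) *\<^sub>R J (lie X f x)) = 0"
      if x: "x \<in> M'" for x
      using Nu[OF x, unfolded N_def s_def k_def] second_form[OF x] asy[OF x] by simp_all
    show "f x \<bullet> f x = 1" if "x \<in> M'" for x using that sub ff by auto
  qed (use op' sm' smXY E_T_inner hor dense in auto)
  interpret A: lie_frame M' f X Y by (rule lie_frame.intro[OF F])
  assume x: "x \<in> M'"
  have AN: "A.N x = N x" by (simp add: A.N_def N_def s_def k_def)
  have "N x \<bullet> N x = (N x \<bullet> n x)\<^sup>2" using Nu[OF x, of "N x"] by (simp add: power2_eq_square)
  then have 1: "(N x \<bullet> n x)\<^sup>2 = 1" using A.N_inner(4)[OF x] unfolding AN by simp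
  have "(lie Y (lie X f) x \<bullet> N x)\<^sup>2 = (b11 x)\<^sup>2 + (b12 x)\<^sup>2"
    using 1 xx_xy[OF x] asy[OF x] second_form(2)[OF x] unfolding Nu[OF x] by (simp add: power_mult_distrib)
  then show "(curvature f X Y x)\<^sup>2 = (b11 x)\<^sup>2 + (b12 x)\<^sup>2"
    using A.E_Y_N[OF x] unfolding AN by (simp add: curvature_def)
qed

end

lemma ball_where_nonzero:
  fixes g :: "'a::metric_space \<Rightarrow> real"
  assumes "open S" "continuous_on S g" "q \<in> S" "g q \<noteq> 0"
  shows "\<exists>r>0. ball q r \<subseteq> S \<and> (\<forall>x\<in>ball q r. g x \<noteq> 0)"
proof -
  have "open {y \<in> S. g y \<noteq> 0}" by (rule open_Collect_neq_on[OF assms(1,2)])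
  then obtain r where "r > 0" "ball q r \<subseteq> {y \<in> S. g y \<noteq> 0}"
    using assms(3,4) by (metis (mono_tags, lifting) mem_Collect_eq open_contains_ball)
  then show ?thesis by blast
qed

text \<open>An injective linear map is bounded below by some \<open>B * norm v\<close>, while the
  error of the linear approximation stays below half of that.\<close>

lemma nonzero_near_if_injective_derivative:
  fixes h :: "'a::euclidean_space \<Rightarrow> 'b::euclidean_space"
  assumes "(h has_derivative L) (at q)" "h q = 0" "\<And>v. L v = 0 \<Longrightarrow> v = 0"
  shows "\<exists>r>0. \<forall>x\<in>ball q r - {q}. h x \<noteq> 0"
proof -
  have L: "linear L" using assms(1) has_derivative_linear by blast
  have "inj L" using assms(3) by (simp add: linear_injective_0[OF L])
  then obtain B where B: "B > 0" "\<And>v. B * norm v \<le> norm (L v)"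
    using linear_inj_bounded_below_pos[OF L] by blast
  obtain d where d: "d > 0" "\<And>y. norm (y - q) < d \<Longrightarrow> norm (h y - h q - L (y - q)) \<le> B / 2 * norm (y - q)"
    using assms(1) B(1) unfolding has_derivative_at_alt by (metis half_gt_zero)
  have "h x \<noteq> 0" if "x \<in> ball q d - {q}" for x
  proof
    assume "h x = 0"
    then have "norm (L (x - q)) \<le> B / 2 * norm (x - q)"
      using d(2)[of x] that assms(2) by (auto simp: dist_norm norm_minus_commute)
    then have "B * norm (x - q) \<le> B / 2 * norm (x - q)" using B(2)[of "x - q"] by linarith
    then show False using B(1) that by auto
  qed
  then show ?thesis using d(1) by blast
qed

lemma normalized_asymptotic:
  fixes a b :: real
  assumes "(a\<^sup>2 - b\<^sup>2) * b1 - 2 * a * b * b2 = 0" "m \<noteq> 0"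
  shows "((a / m)\<^sup>2 - (b / m)\<^sup>2) * b1 - 2 * (a / m) * (b / m) * b2 = 0"
proof -
  have "((a / m)\<^sup>2 - (b / m)\<^sup>2) * b1 - 2 * (a / m) * (b / m) * b2 = ((a\<^sup>2 - b\<^sup>2) * b1 - 2 * a * b * b2) / m\<^sup>2"
    using assms(2) by (simp add: field_simps power2_eq_square)
  then show ?thesis using assms(1) by simp
qed

section \<open>Frames away from horizontal planes, and umbilic points\<close>

context minimal_patch
begin

lemma rotated_frameI:
  assumes "open M'" "M' \<subseteq> M" "smooth_on M' c" "smooth_on M' S" "\<And>x. x \<in> M' \<Longrightarrow> (c x)\<^sup>2 + (S x)\<^sup>2 = 1"
  shows "rotated_frame M f X1 X2 n M' c S"
  by (rule rotated_frame.intro[OF minimal_patch_axioms]) (use assms in \<open>auto simp: rotated_frame_axioms_def\<close>)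

lemma normalized_rotated_frame:
  assumes "open M'" "M' \<subseteq> M" and A: "smooth_on M' A" and B: "smooth_on M' B"
    and ne: "\<And>x. x \<in> M' \<Longrightarrow> A x \<noteq> 0 \<or> B x \<noteq> 0"
  shows "rotated_frame M f X1 X2 n M' (\<lambda>x. A x / sqrt ((A x)\<^sup>2 + (B x)\<^sup>2)) (\<lambda>x. B x / sqrt ((A x)\<^sup>2 + (B x)\<^sup>2))"
proof (rule rotated_frameI[OF assms(1,2)])
  have pos: "(A x)\<^sup>2 + (B x)\<^sup>2 > 0" if "x \<in> M'" for x using ne[OF that] by (simp add: sum_power2_gt_zero_iff)
  then have "smooth_on M' (\<lambda>x. sqrt ((A x)\<^sup>2 + (B x)\<^sup>2))"
    by (intro smooth_on_sqrt smooth_intros A B assms(1))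
  moreover have "sqrt ((A x)\<^sup>2 + (B x)\<^sup>2) \<noteq> 0" if "x \<in> M'" for x
    using real_sqrt_gt_zero[OF pos[OF that]] by (metis less_irrefl)
  ultimately show "smooth_on M' (\<lambda>x. A x / sqrt ((A x)\<^sup>2 + (B x)\<^sup>2))" "smooth_on M' (\<lambda>x. B x / sqrt ((A x)\<^sup>2 + (B x)\<^sup>2))"
    using smooth_on_divide[OF assms(1) A] smooth_on_divide[OF assms(1) B] by blast+
  show "(A x / sqrt ((A x)\<^sup>2 + (B x)\<^sup>2))\<^sup>2 + (B x / sqrt ((A x)\<^sup>2 + (B x)\<^sup>2))\<^sup>2 = 1" if "x \<in> M'" for x
    using pos[OF that] ne[OF that] by (auto simp: power_divide simp flip: add_divide_distrib)
qed

text \<open>Rotating by the normalized pair \<open>(\<eta>2, \<eta>1)\<close> makes \<open>X\<close>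
  horizontal, and \<open>hopf0\<close> makes it asymptotic. The Hopf component of \<open>Y\<close>
  is then the positive length \<open>m\<close>, which settles density.\<close>

lemma hopf_frame:
  assumes "open M'" "M' \<subseteq> M" and ne: "\<And>x. x \<in> M' \<Longrightarrow> \<eta>1 x \<noteq> 0 \<or> \<eta>2 x \<noteq> 0"
  shows "\<exists>X Y. adapted_frame M' f X Y \<and>
    (\<forall>x\<in>M'. (curvature f X Y x)\<^sup>2 = (b11 x)\<^sup>2 + (b12 x)\<^sup>2)"
proof -
  have \<eta>: "smooth_on M' \<eta>1" "smooth_on M' \<eta>2" using sm assms(2) smooth_on_subset by blast+
  define m where "m = (\<lambda>x. sqrt ((\<eta>2 x)\<^sup>2 + (\<eta>1 x)\<^sup>2))"
  have m: "m x > 0" "m x * m x = (\<eta>2 x)\<^sup>2 + (\<eta>1 x)\<^sup>2" if "x \<in> M'" for x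
    using ne[OF that] by (auto simp: m_def sum_power2_gt_zero_iff)
  define c where "c = (\<lambda>x. \<eta>2 x / m x)"
  define S where "S = (\<lambda>x. \<eta>1 x / m x)"
  have RF: "rotated_frame M f X1 X2 n M' c S"
    unfolding c_def S_def m_def by (rule normalized_rotated_frame[OF assms(1,2) \<eta>(2,1)]) (use ne in auto)
  let ?X = "\<lambda>y. c y *\<^sub>R X1 y - S y *\<^sub>R X2 y" and ?Y = "\<lambda>y. S y *\<^sub>R X1 y + c y *\<^sub>R X2 y"
  interpret R: rotated_frame M f X1 X2 n e1 e2 b11 b12 b22 \<eta>1 \<eta>2 M' c S
    ?X ?Y
    by (rule RF) (simp_all add: e1_def e2_def b11_def b12_def b22_def \<eta>1_def \<eta>2_def)
  have hor: "lie ?X f x \<bullet> J (f x) = 0" if x: "x \<in> M'" for x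
  proof -
    have "lie ?X f x \<bullet> J (f x) = c x * \<eta>1 x - S x * \<eta>2 x"
      unfolding R.E_T[OF x] by (simp add: inner_diff_left \<eta>1_def \<eta>2_def)
    then show ?thesis by (simp add: c_def S_def)
  qed
  have ver: "lie ?Y f x \<bullet> J (f x) \<noteq> 0" if x: "x \<in> M'" for x
  proof -
    have "lie ?Y f x \<bullet> J (f x) = S x * \<eta>1 x + c x * \<eta>2 x"
      unfolding R.E_T[OF x] by (simp add: inner_add_left \<eta>1_def \<eta>2_def)
    also have "\<dots> = (m x * m x) / m x" unfolding m(2)[OF x] by (simp add: c_def S_def power2_eq_square add_divide_distrib)
    finally show ?thesis using m(1)[OF x] by simp
  qed
  have asy: "R.xx x = 0" if x: "x \<in> M'" for x
    unfolding R.xx_def unfolding c_def S_def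
  proof (rule normalized_asymptotic)
    show "((\<eta>2 x)\<^sup>2 - (\<eta>1 x)\<^sup>2) * b11 x - 2 * \<eta>2 x * \<eta>1 x * b12 x = 0"
      using hopf0[of x] mean0[of x] x assms(2) by (simp add: subset_iff algebra_simps eq_neg_iff_add_eq_0[symmetric])
  qed (use m(1)[OF x] in simp)
  show ?thesis
    by (intro exI[of _ ?X] exI[of _ ?Y] conjI ballI) (rule R.adapted[OF hor asy]; use ver in \<open>auto\<close>)+
qed

text \<open>Where \<open>\<eta>1 = \<eta>2 = 0\<close>, the tangent plane is horizontal and hence a complex line.\<close>

lemma horizontal_plane:
  assumes x: "x \<in> M" and z: "\<eta>1 x = 0" "\<eta>2 x = 0"
  shows "(e1 x \<bullet> J (e2 x))\<^sup>2 = 1"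
proof -
  let ?\<mu> = "J (f x) \<bullet> n x"
  have Jf: "J (f x) = ?\<mu> *\<^sub>R n x" by (rule hopf_normal[OF assms])
  have "J (f x) \<bullet> J (f x) = ?\<mu> * ?\<mu>" by (subst (1 2) Jf) (simp add: inner_values[OF x])
  then have \<mu>: "?\<mu> * ?\<mu> = 1" by (simp add: inner_J_J inner_values[OF x])
  have "?\<mu> * (J (e2 x) \<bullet> n x) = J (e2 x) \<bullet> J (f x)" by (subst (2) Jf) simp
  then have Jn: "J (e2 x) \<bullet> n x = 0" using \<mu> by (auto simp: inner_J_J inner_values[OF x])
  have "J (e2 x) = (e1 x \<bullet> J (e2 x)) *\<^sub>R e1 x"
  proof (rule vec_eqI[OF x])
    show "J (e2 x) \<bullet> f x = ((e1 x \<bullet> J (e2 x)) *\<^sub>R e1 x) \<bullet> f x"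
      using z by (simp add: inner_values[OF x] inner_J_left \<eta>2_def)
  qed (use Jn in \<open>simp_all add: inner_values[OF x] J_tangent inner_commute[of "J (e2 x)" "e1 x"]\<close>)
  then have "J (e2 x) \<bullet> J (e2 x) = ((e1 x \<bullet> J (e2 x)) *\<^sub>R e1 x) \<bullet> ((e1 x \<bullet> J (e2 x)) *\<^sub>R e1 x)" by simp
  then show ?thesis by (simp add: inner_J_J inner_values[OF x] power2_eq_square)
qed

text \<open>As the second form vanishes at \<open>q\<close>, the derivative of
  \<open>(\<eta>1, \<eta>2)\<close> consists of the components of \<open>J (fderiv f q v)\<close>.
  The tangent plane is a complex line, on which \<open>J\<close> is a rotation, so this derivative
  is injective.\<close>

lemma isolated_horizontal:
  assumes q: "q \<in> M" and umb: "b11 q = 0" "b12 q = 0" and z: "\<eta>1 q = 0" "\<eta>2 q = 0"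
  shows "\<exists>r>0. \<forall>x\<in>ball q r - {q}. (\<eta>1 x, \<eta>2 x) \<noteq> 0"
proof (rule nonzero_near_if_injective_derivative)
  show "((\<lambda>x. (\<eta>1 x, \<eta>2 x)) has_derivative (\<lambda>v. (fderiv \<eta>1 q v, fderiv \<eta>2 q v))) (at q)"
    by (intro has_derivative_Pair smooth_has_fderiv[OF op _ q] sm)
  show "(\<eta>1 q, \<eta>2 q) = 0" using z by (simp add: zero_prod_def)
  fix v assume 0: "(fderiv \<eta>1 q v, fderiv \<eta>2 q v) = 0"
  let ?D = "fderiv f q v"
  have Jf: "w \<bullet> J (f q) = (J (f q) \<bullet> n q) * (w \<bullet> n q)" for w
    by (subst hopf_normal[OF q z]) simp
  have "fderiv \<eta>1 q v = e1 q \<bullet> J ?D + fderiv e1 q v \<bullet> J (f q)"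
    "fderiv \<eta>2 q v = e2 q \<bullet> J ?D + fderiv e2 q v \<bullet> J (f q)"
    using lie_inner[OF op q sme1 smooth_on_J[OF op smf], of "\<lambda>_. v"]
      lie_inner[OF op q sme2 smooth_on_J[OF op smf], of "\<lambda>_. v"] lie_J[OF op q smf, of "\<lambda>_. v"]
    by (simp_all add: \<eta>1_def[abs_def] \<eta>2_def[abs_def] lie_def)
  then have 1: "e1 q \<bullet> J ?D = 0" "e2 q \<bullet> J ?D = 0"
    using 0 umb unfolding Jf frame_deriv_n[OF q] by (simp_all add: zero_prod_def)
  have D: "?D = (?D \<bullet> e1 q) *\<^sub>R e1 q + (?D \<bullet> e2 q) *\<^sub>R e2 q"
    using expand_deriv[OF q smf, of v] by (simp flip: e1_def e2_def)
  have w: "e1 q \<bullet> J (e2 q) \<noteq> 0" using horizontal_plane[OF q z] by auto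
  have "e2 q \<bullet> J (e1 q) = - (e1 q \<bullet> J (e2 q))" by (metis inner_J_left inner_commute)
  moreover have "e1 q \<bullet> J ?D = (?D \<bullet> e2 q) * (e1 q \<bullet> J (e2 q))" "e2 q \<bullet> J ?D = (?D \<bullet> e1 q) * (e2 q \<bullet> J (e1 q))"
    by (subst D, simp add: J_add J_scaleR inner_add_right inner_J_self)+
  ultimately have "?D \<bullet> e1 q = 0" "?D \<bullet> e2 q = 0" using 1 w by auto
  then show "v = 0" using span_pair[OF lin[OF smf q], of "X1 q" "X2 q" v] e11[OF q] e22[OF q] e12[OF q]
    by (simp add: e1_def e2_def lie_def)
qed

text \<open>On a punctured ball the curvature times \<open>\<rho> * \<rho>\<close> is constant. As
  \<open>\<rho> * \<rho> \<le> 1\<close>, a nonzero constant would bound the second form away from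
  zero near \<open>q\<close>. The puncture removes the one possible horizontal point and, in
  dimension two, leaves the ball connected.\<close>

lemma umbilic_open:
  assumes q: "q \<in> M" and umb: "b11 q = 0" "b12 q = 0"
  shows "\<exists>r>0. ball q r \<subseteq> M \<and> (\<forall>x\<in>ball q r. b11 x = 0 \<and> b12 x = 0)"
proof -
  obtain r0 where r0: "r0 > 0" "ball q r0 \<subseteq> M" using op q open_contains_ball by blast
  have "\<exists>r>0. \<forall>x\<in>ball q r \<inter> M - {q}. \<eta>1 x \<noteq> 0 \<or> \<eta>2 x \<noteq> 0"
  proof (cases "\<eta>1 q = 0 \<and> \<eta>2 q = 0")
    case True
    then show ?thesis using isolated_horizontal[OF q umb] by (auto simp: zero_prod_def)
  next
    case False
    then have "\<exists>r>0. ball q r \<subseteq> M \<and> (\<forall>x\<in>ball q r. (\<eta>1 x)\<^sup>2 + (\<eta>2 x)\<^sup>2 \<noteq> 0)"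
      using q by (intro ball_where_nonzero op smooth_continuous_on smooth_intros sm) (auto simp: sum_power2_eq_zero_iff)
    then show ?thesis by (auto simp: sum_power2_eq_zero_iff)
  qed
  then obtain r1 where r1: "r1 > 0" "\<And>x. x \<in> ball q r1 \<inter> M - {q} \<Longrightarrow> \<eta>1 x \<noteq> 0 \<or> \<eta>2 x \<noteq> 0" by blast
  define r where "r = min r0 r1"
  have r: "r > 0" "ball q r \<subseteq> M" using r0 r1 by (auto simp: r_def)
  define O' where "O' = ball q r - {q}"
  have O': "open O'" "O' \<subseteq> M" "connected O'"
    using r by (auto simp: O'_def open_delete intro!: connected_punctured_ball)
  have hne: "\<eta>1 x \<noteq> 0 \<or> \<eta>2 x \<noteq> 0" if "x \<in> O'" for x
    using that O'(2) by (intro r1(2)) (auto simp: O'_def r_def)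
  obtain X Y where F: "adapted_frame O' f X Y"
    and cu: "\<And>x. x \<in> O' \<Longrightarrow> (curvature f X Y x)\<^sup>2 = (b11 x)\<^sup>2 + (b12 x)\<^sup>2"
    using hopf_frame[OF O'(1,2) hne] by blast
  interpret A: lie_frame O' f X Y by (rule lie_frame.intro[OF F])
  define a where "a = curvature f X Y"
  have ratio: "a x * (A.\<rho> x * A.\<rho> x) = a y * (A.\<rho> y * A.\<rho> y)" if "x \<in> O'" "y \<in> O'" for x y
    using A.curvature_ratio_const[OF O'(3) that] unfolding a_def curvature_def .
  have a2: "(a x)\<^sup>2 = (b11 x)\<^sup>2 + (b12 x)\<^sup>2" if "x \<in> O'" for x using cu[OF that] unfolding a_def .
  have \<rho>: "0 < A.\<rho> x * A.\<rho> x" "A.\<rho> x * A.\<rho> x \<le> 1" for x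
  proof -
    have "A.r x \<ge> 1" by (simp add: A.r_def)
    moreover have "A.\<rho> x * A.\<rho> x = 1 / A.r x" using A.\<rho>_r[of x] \<open>A.r x \<ge> 1\<close> by (simp add: field_simps)
    ultimately show "0 < A.\<rho> x * A.\<rho> x" "A.\<rho> x * A.\<rho> x \<le> 1" by simp_all
  qed
  have "a x = 0" if x: "x \<in> O'" for x
  proof (rule ccontr)
    assume ax: "a x \<noteq> 0"
    define K where "K = a x * (A.\<rho> x * A.\<rho> x)"
    have K: "K\<^sup>2 > 0" using ax \<rho>(1)[of x] by (auto simp: K_def)
    have le: "K\<^sup>2 \<le> (b11 y)\<^sup>2 + (b12 y)\<^sup>2" if "y \<in> O'" for y
    proof -
      have "K\<^sup>2 = (a y)\<^sup>2 * (A.\<rho> y * A.\<rho> y)\<^sup>2" unfolding K_def ratio[OF x that] by (rule power_mult_distrib)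
      also have "\<dots> \<le> (a y)\<^sup>2 * 1" using \<rho>[of y] by (intro mult_left_mono power_le_one) auto
      finally show ?thesis using a2[OF that] by simp
    qed
    have "continuous_on M (\<lambda>y. (b11 y)\<^sup>2 + (b12 y)\<^sup>2)" by (intro smooth_continuous_on smooth_intros sm)
    from continuous_on_iff[THEN iffD1, OF this, rule_format, OF q K]
    obtain e where e: "e > 0" "\<And>y. y \<in> M \<Longrightarrow> dist y q < e \<Longrightarrow> (b11 y)\<^sup>2 + (b12 y)\<^sup>2 < K\<^sup>2"
      using umb by (auto simp: dist_real_def)
    define y where "y = q + (min e r / 2) *\<^sub>R axis 1 1"
    have d: "dist y q = min e r / 2" using e(1) r(1) by (simp add: y_def dist_norm)
    have "y \<in> O'" using d e(1) r(1) by (auto simp: O'_def dist_commute y_def axis_eq_0_iff)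
    moreover have "dist y q < e" using d e(1) r(1) by auto
    ultimately show False using le[of y] e(2)[of y] O'(2) by auto
  qed
  then have "b11 x = 0 \<and> b12 x = 0" if "x \<in> ball q r" for x
    using a2[of x] umb that by (cases "x = q") (auto simp: O'_def sum_power2_eq_zero_iff)
  then show ?thesis using r by blast
qed

end

section \<open>Frames across horizontal planes\<close>

context rotated_frame
begin

text \<open>For asymptotic \<open>X\<close> and \<open>Y\<close>, the condition \<open>hopf0\<close>
  says that the product of the Hopf components of \<open>E\<close> and \<open>T\<close> vanishes.
  The assumption \<open>tr\<close> keeps the one of \<open>T\<close> from vanishing on open sets
  near \<open>q\<close>, so the one of \<open>E\<close> vanishes there throughout.\<close>

lemma transversal_frame:
  assumes q: "q \<in> M'" and asy: "\<And>x. x \<in> M' \<Longrightarrow> xx x = 0" "\<And>x. x \<in> M' \<Longrightarrow> xy x \<noteq> 0"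
    and tr: "lie X (\<lambda>x. lie Y f x \<bullet> J (f x)) q \<noteq> 0"
  shows "\<exists>r>0. ball q r \<subseteq> M' \<and> adapted_frame (ball q r) f X Y \<and> (curvature f X Y q)\<^sup>2 = (b11 q)\<^sup>2 + (b12 q)\<^sup>2"
proof -
  let ?g1 = "\<lambda>x. lie X f x \<bullet> J (f x)" and ?g2 = "\<lambda>x. lie Y f x \<bullet> J (f x)"
  have smg: "smooth_on M' ?g1" "smooth_on M' ?g2" by (intro smooth_intros op' sm' smXY)+
  have "continuous_on M' (lie X ?g2)" by (intro smooth_continuous_on smooth_on_lie op' smg smXY)
  from ball_where_nonzero[OF op' this q tr] obtain r where r: "r > 0" "ball q r \<subseteq> M'"
    and nz: "\<And>x. x \<in> ball q r \<Longrightarrow> lie X ?g2 x \<noteq> 0" by blast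
  have RF: "rotated_frame M f X1 X2 n (ball q r) c S"
    by (rule rotated_frameI) (use r(2) sub cS smc smS smooth_on_subset in auto)
  interpret B: rotated_frame M f X1 X2 n e1 e2 b11 b12 b22 \<eta>1 \<eta>2 "ball q r" c S X Y
    by (rule RF) (simp_all add: e1_def e2_def b11_def b12_def b22_def \<eta>1_def \<eta>2_def X_def Y_def)
  have dense: "\<exists>z\<in>ball q r \<inter> ball x e. ?g2 z \<noteq> 0" if x: "x \<in> ball q r" and e: "e > 0" for x e
  proof (rule ccontr)
    assume "\<not> ?thesis"
    then have z: "?g2 y = 0" if "y \<in> ball q r \<inter> ball x e" for y using that by blast
    have "smooth_on (ball q r \<inter> ball x e) ?g2" by (rule smooth_on_subset[OF smg(2)]) (use r(2) in auto)
    then have "lie X ?g2 x = lie X (\<lambda>_. 0) x"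
      by (intro lie_cong[of "ball q r \<inter> ball x e"]) (use x e z in auto)
    then show False using nz[OF x] by simp
  qed
  have prod: "?g2 x * ?g1 x = 0" if x: "x \<in> ball q r" for x
  proof -
    have x': "x \<in> M'" "x \<in> M" using x r(2) sub by auto
    define g1 g2 where "g1 = ?g1 x" and "g2 = ?g2 x"
    have g: "g1 = c x * \<eta>1 x - S x * \<eta>2 x" "g2 = S x * \<eta>1 x + c x * \<eta>2 x"
      unfolding g1_def g2_def E_T[OF x'(1)] by (simp_all add: inner_add_left inner_diff_left \<eta>1_def \<eta>2_def)
    have "(g2\<^sup>2 - g1\<^sup>2) * xx x - 2 * g1 * g2 * xy x = ((c x)\<^sup>2 + (S x)\<^sup>2)\<^sup>2 *
       ((\<eta>2 x)\<^sup>2 * b11 x - 2 * \<eta>1 x * \<eta>2 x * b12 x + (\<eta>1 x)\<^sup>2 * (- b11 x))"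
      unfolding g xx_def xy_def by algebra
    moreover have "- b11 x = b22 x" using mean0[OF x'(2)] by simp
    ultimately have "g1 * g2 * xy x = 0" using hopf0[OF x'(2)] asy(1)[OF x'(1)] by simp
    then show ?thesis using asy(2)[OF x'(1)] by (auto simp: g1_def g2_def)
  qed
  have "B.xx x = 0" if "x \<in> ball q r" for x using asy(1)[of x] that r(2) by (auto simp: B.xx_def xx_def)
  moreover have "?g1 x = 0" if "x \<in> ball q r" for x
    by (rule zero_if_mult_zero_dense[OF _ prod dense that])
      (use continuous_on_subset[OF smooth_continuous_on[OF smg(1)] r(2)] in auto)
  ultimately show ?thesis using B.adapted[OF _ _ dense] r by (intro exI[of _ r]) auto
qed

text \<open>In the difference of the two derivatives the second-order terms cancel, as the bracket
  is tangent and \<open>J (f q)\<close> is normal. What remains is twice the inner product of one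
  frame vector with \<open>J\<close> of the other, which is \<open>2\<close> or \<open>-2\<close> on
  a complex line.\<close>

lemma transversality:
  assumes q: "q \<in> M'" and z: "\<eta>1 q = 0" "\<eta>2 q = 0"
  shows "lie Y (\<lambda>x. lie X f x \<bullet> J (f x)) q \<noteq> 0 \<or> lie X (\<lambda>x. lie Y f x \<bullet> J (f x)) q \<noteq> 0"
proof -
  have qM: "q \<in> M" using q sub by auto
  let ?E = "lie X f q" and ?T = "lie Y f q"
  have smET: "smooth_on M' (lie X f)" "smooth_on M' (lie Y f)" by (intro smooth_intros op' sm' smXY)+
  have 1: "lie Y (\<lambda>x. lie X f x \<bullet> J (f x)) q = ?E \<bullet> J ?T + lie Y (lie X f) q \<bullet> J (f q)"
    "lie X (\<lambda>x. lie Y f x \<bullet> J (f x)) q = ?T \<bullet> J ?E + lie X (lie Y f) q \<bullet> J (f q)"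
    using lie_inner[OF op' q smET(1) smooth_on_J[OF op' sm'(1)], of Y] lie_inner[OF op' q smET(2) smooth_on_J[OF op' sm'(1)], of X]
      lie_J[OF op' q sm'(1)] by simp_all
  have Jf: "w \<bullet> J (f q) = (J (f q) \<bullet> n q) * (w \<bullet> n q)" for w
    by (subst hopf_normal[OF qM z]) simp
  have "(lie Y (lie X f) q - lie X (lie Y f) q) \<bullet> J (f q) = 0"
    unfolding Jf lie_commutator[OF op' sm'(1) smXY q] deriv_n[OF qM] by simp
  then have "lie Y (\<lambda>x. lie X f x \<bullet> J (f x)) q - lie X (\<lambda>x. lie Y f x \<bullet> J (f x)) q = ?E \<bullet> J ?T - ?T \<bullet> J ?E"
    unfolding 1 by (simp add: inner_diff_left)
  also have "\<dots> = 2 * (?E \<bullet> J ?T)" using inner_J_left[of ?E ?T] by (simp add: inner_commute)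
  also have "?E \<bullet> J ?T = ((c q)\<^sup>2 + (S q)\<^sup>2) * (e1 q \<bullet> J (e2 q))"
  proof -
    have "e2 q \<bullet> J (e1 q) = - (e1 q \<bullet> J (e2 q))" by (metis inner_J_left inner_commute)
    then show ?thesis unfolding E_T[OF q]
      by (simp add: J_add J_scaleR inner_add_right inner_diff_left inner_J_self power2_eq_square algebra_simps)
  qed
  finally show ?thesis using cS[OF q] horizontal_plane[OF qM z] by auto
qed

end

context minimal_patch
begin

text \<open>At a horizontal point either asymptotic direction may continue the horizontal ones;
  \<open>transversality\<close> shows that at least one of them does.\<close>

lemma nonumbilic_frame:
  assumes q: "q \<in> M" and nu: "b11 q \<noteq> 0 \<or> b12 q \<noteq> 0"
  shows "\<exists>r>0. \<exists>X Y. ball q r \<subseteq> M \<and> adapted_frame (ball q r) f X Y \<and> curvature f X Y q \<noteq> 0"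
proof (cases "\<eta>1 q = 0 \<and> \<eta>2 q = 0")
  case False
  then have "\<exists>r>0. ball q r \<subseteq> M \<and> (\<forall>x\<in>ball q r. (\<eta>1 x)\<^sup>2 + (\<eta>2 x)\<^sup>2 \<noteq> 0)"
    using q by (intro ball_where_nonzero op smooth_continuous_on smooth_intros sm) (auto simp: sum_power2_eq_zero_iff)
  then obtain r where r: "r > 0" "ball q r \<subseteq> M" "\<And>x. x \<in> ball q r \<Longrightarrow> \<eta>1 x \<noteq> 0 \<or> \<eta>2 x \<noteq> 0" by fastforce
  obtain X Y where F: "adapted_frame (ball q r) f X Y"
    and cu: "\<And>x. x \<in> ball q r \<Longrightarrow> (curvature f X Y x)\<^sup>2 = (b11 x)\<^sup>2 + (b12 x)\<^sup>2"
    using hopf_frame[OF open_ball r(2,3)] by blast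
  have "curvature f X Y q \<noteq> 0" using cu[of q] r(1) nu by (auto simp: sum_power2_eq_zero_iff)
  then show ?thesis using F r by blast
next
  case True
  have "\<exists>r>0. ball q r \<subseteq> M \<and> (\<forall>x\<in>ball q r. (b11 x)\<^sup>2 + (b12 x)\<^sup>2 \<noteq> 0)"
    using q nu by (intro ball_where_nonzero op smooth_continuous_on smooth_intros sm) (auto simp: sum_power2_eq_zero_iff)
  then obtain r0 where r0: "r0 > 0" "ball q r0 \<subseteq> M" "\<And>x. x \<in> ball q r0 \<Longrightarrow> (b11 x)\<^sup>2 + (b12 x)\<^sup>2 \<noteq> 0" by blast
  define R where "R = (\<lambda>x. sqrt ((b11 x)\<^sup>2 + (b12 x)\<^sup>2))"
  have smb: "smooth_on (ball q r0) b11" "smooth_on (ball q r0) b12" using sm r0(2) smooth_on_subset by blast+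
  have pos: "(b11 x)\<^sup>2 + (b12 x)\<^sup>2 > 0" if "x \<in> ball q r0" for x
    using r0(3)[OF that] by (simp add: less_le)
  have smR: "smooth_on (ball q r0) R" unfolding R_def by (intro smooth_on_sqrt smooth_intros smb pos open_ball)
  have R2: "R x * R x = b11 x * b11 x + b12 x * b12 x" "R x > 0" if "x \<in> ball q r0" for x
    using pos[OF that] by (auto simp: R_def power2_eq_square)
  text \<open>Both choices below are asymptotic directions; at least one of them does not vanish at \<open>q\<close>.\<close>
  obtain A B where AB: "smooth_on (ball q r0) A" "smooth_on (ball q r0) B"
    "\<And>x. x \<in> ball q r0 \<Longrightarrow> ((A x)\<^sup>2 - (B x)\<^sup>2) * b11 x - 2 * A x * B x * b12 x = 0" "(A q)\<^sup>2 + (B q)\<^sup>2 \<noteq> 0"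
  proof (cases "b12 q + R q = 0")
    case False
    show ?thesis
    proof (rule that[of "\<lambda>x. b12 x + R x" b11])
      show "((b12 x + R x)\<^sup>2 - (b11 x)\<^sup>2) * b11 x - 2 * (b12 x + R x) * b11 x * b12 x = 0" if "x \<in> ball q r0" for x
        using R2(1)[OF that] by (simp add: power2_eq_square) algebra
    qed (use False in \<open>auto intro!: smooth_intros smb smR simp: sum_power2_eq_zero_iff\<close>)
  next
    case True
    show ?thesis
    proof (rule that[of b11 "\<lambda>x. R x - b12 x"])
      show "((b11 x)\<^sup>2 - (R x - b12 x)\<^sup>2) * b11 x - 2 * b11 x * (R x - b12 x) * b12 x = 0" if "x \<in> ball q r0" for x
        using R2(1)[OF that] by (simp add: power2_eq_square) algebra
      have "R q - b12 q > 0" using True R2(2)[of q] r0(1) by simp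
      then show "(b11 q)\<^sup>2 + (R q - b12 q)\<^sup>2 \<noteq> 0" by (auto simp: sum_power2_eq_zero_iff)
    qed (auto intro!: smooth_intros smb smR)
  qed
  have "\<exists>r>0. ball q r \<subseteq> ball q r0 \<and> (\<forall>x\<in>ball q r. (A x)\<^sup>2 + (B x)\<^sup>2 \<noteq> 0)"
    using r0(1) AB by (intro ball_where_nonzero smooth_continuous_on smooth_intros) auto
  then obtain r where r: "r > 0" "ball q r \<subseteq> ball q r0" "\<And>x. x \<in> ball q r \<Longrightarrow> (A x)\<^sup>2 + (B x)\<^sup>2 \<noteq> 0" by blast
  define m where "m = (\<lambda>x. sqrt ((A x)\<^sup>2 + (B x)\<^sup>2))"
  define c where "c = (\<lambda>x. A x / m x)"
  define S where "S = (\<lambda>x. B x / m x)"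
  have sub: "ball q r \<subseteq> M" using r(2) r0(2) by blast
  have RF: "rotated_frame M f X1 X2 n (ball q r) c S"
    unfolding c_def S_def m_def
    by (rule normalized_rotated_frame[OF open_ball sub])
      (use r smooth_on_subset[OF AB(1)] smooth_on_subset[OF AB(2)] in \<open>fastforce+\<close>)
  let ?X = "\<lambda>y. c y *\<^sub>R X1 y - S y *\<^sub>R X2 y" and ?Y = "\<lambda>y. S y *\<^sub>R X1 y + c y *\<^sub>R X2 y"
  interpret R: rotated_frame M f X1 X2 n e1 e2 b11 b12 b22 \<eta>1 \<eta>2 "ball q r" c S
    ?X ?Y
    by (rule RF) (simp_all add: e1_def e2_def b11_def b12_def b22_def \<eta>1_def \<eta>2_def)
  \<comment> \<open>A quarter turn: the new \<open>X\<close> is the old \<open>Y\<close>, and the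
    new \<open>Y\<close> is minus the old \<open>X\<close>.\<close>
  have RF': "rotated_frame M f X1 X2 n (ball q r) S (\<lambda>x. - c x)"
    by (rule rotated_frameI[OF open_ball sub]) (use R.smc R.smS R.cS in \<open>auto intro: smooth_on_minus simp: add.commute\<close>)
  interpret R': rotated_frame M f X1 X2 n e1 e2 b11 b12 b22 \<eta>1 \<eta>2 "ball q r" S "\<lambda>x. - c x"
    "\<lambda>y. S y *\<^sub>R X1 y - (- c y) *\<^sub>R X2 y" "\<lambda>y. (- c y) *\<^sub>R X1 y + S y *\<^sub>R X2 y"
    by (rule RF') (simp_all add: e1_def e2_def b11_def b12_def b22_def \<eta>1_def \<eta>2_def)
  have asy: "R.xx x = 0" "R.xy x \<noteq> 0" if x: "x \<in> ball q r" for x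
  proof -
    show "R.xx x = 0"
      unfolding R.xx_def unfolding c_def S_def
      by (rule normalized_asymptotic) (use AB(3)[of x] r(2,3) x in \<open>auto simp: m_def\<close>)
    then show "R.xy x \<noteq> 0" using R.xx_xy[OF x] r0(3)[of x] r(2) x by auto
  qed
  have xx': "R'.xx x = - R.xx x" "R'.xy x = - R.xy x" for x
    by (simp_all add: R.xx_def R.xy_def R'.xx_def R'.xy_def algebra_simps)
  have qr: "q \<in> ball q r" using r(1) by simp
  have XY': "(\<lambda>y. S y *\<^sub>R X1 y - (- c y) *\<^sub>R X2 y) = ?Y" by simp
  have nz: "k \<noteq> 0" if "k\<^sup>2 = (b11 q)\<^sup>2 + (b12 q)\<^sup>2" for k using that nu by (auto simp: sum_power2_eq_zero_iff)
  from True have "\<eta>1 q = 0" "\<eta>2 q = 0" by auto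
  from R.transversality[OF qr this] show ?thesis
  proof
    assume "lie ?X (\<lambda>x. lie ?Y f x \<bullet> J (f x)) q \<noteq> 0"
    from R.transversal_frame[OF qr asy this] show ?thesis using sub nz by blast
  next
    assume a: "lie ?Y (\<lambda>x. lie ?X f x \<bullet> J (f x)) q \<noteq> 0"
    let ?g = "\<lambda>x. lie (\<lambda>y. (- c y) *\<^sub>R X1 y + S y *\<^sub>R X2 y) f x \<bullet> J (f x)"
    have sg: "smooth_on (ball q r) ?g" by (intro smooth_intros R'.sm' R'.smXY open_ball)
    have "?g y = - (lie ?X f y \<bullet> J (f y))" if "y \<in> ball q r" for y
      unfolding R'.E_T[OF that] R.E_T[OF that] by (simp add: inner_add_left inner_diff_left)
    then have "lie (\<lambda>y. S y *\<^sub>R X1 y - (- c y) *\<^sub>R X2 y) ?g q =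
       lie ?Y (\<lambda>y. - (lie ?X f y \<bullet> J (f y))) q"
      unfolding XY' by (intro lie_cong[OF open_ball qr sg])
    also have "\<dots> = - lie ?Y (\<lambda>y. lie ?X f y \<bullet> J (f y)) q"
      by (rule lie_minus[OF open_ball qr]) (intro smooth_intros R.sm' R.smXY open_ball)
    finally have "lie (\<lambda>y. S y *\<^sub>R X1 y - (- c y) *\<^sub>R X2 y) ?g q \<noteq> 0" using a by simp
    have "R'.xx x = 0" "R'.xy x \<noteq> 0" if "x \<in> ball q r" for x using asy[OF that] unfolding xx' by simp_all
    from R'.transversal_frame[OF qr this \<open>lie _ ?g q \<noteq> 0\<close>] show ?thesis using sub nz by blast
  qed
qed

end

section \<open>Orthonormal frame and normal field in a chart\<close>

definition quatj :: "C2 \<Rightarrow> C2" where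
  "quatj p = (- cnj (snd p), cnj (fst p))"

lemma linear_quatj: "linear quatj"
  by (rule linearI) (auto simp: quatj_def)

lemma smooth_on_quatj: "open S \<Longrightarrow> smooth_on S u \<Longrightarrow> smooth_on S (\<lambda>x. quatj (u x))"
  using smooth_on_bounded_linear[of S quatj u] linear_quatj by (simp add: linear_conv_bounded_linear)

lemma quatj_inner:
  "quatj p \<bullet> quatj p = p \<bullet> p" "quatj p \<bullet> p = 0" "quatj p \<bullet> J p = 0" "J (quatj p) \<bullet> p = 0" "J (quatj p) \<bullet> J p = 0"
  "J (quatj p) \<bullet> quatj p = 0" "J (quatj p) \<bullet> J (quatj p) = p \<bullet> p"
  by (simp_all add: quatj_def J_def inner_prod_def inner_complex_def)

text \<open>The cross product in the basis \<open>J p\<close>, \<open>quatj p\<close>,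
  \<open>J (quatj p)\<close> of the tangent space, where \<open>quatj\<close> is multiplication by
  the quaternion j. Being polynomial in its arguments, it gives a smooth normal on the whole
  chart.\<close>

definition normal3 :: "C2 \<Rightarrow> C2 \<Rightarrow> C2 \<Rightarrow> C2" where
  "normal3 p u v =
    ((u \<bullet> quatj p) * (v \<bullet> J (quatj p)) - (u \<bullet> J (quatj p)) * (v \<bullet> quatj p)) *\<^sub>R J p
    + ((u \<bullet> J (quatj p)) * (v \<bullet> J p) - (u \<bullet> J p) * (v \<bullet> J (quatj p))) *\<^sub>R quatj p
    + ((u \<bullet> J p) * (v \<bullet> quatj p) - (u \<bullet> quatj p) * (v \<bullet> J p)) *\<^sub>R J (quatj p)"

lemma normal3:
  assumes p: "p \<bullet> p = 1" "u \<bullet> p = 0" "v \<bullet> p = 0" and "u \<bullet> u = 1" "v \<bullet> v = 1" "u \<bullet> v = 0"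
  shows "p \<bullet> normal3 p u v = 0" "u \<bullet> normal3 p u v = 0" "v \<bullet> normal3 p u v = 0" "normal3 p u v \<bullet> normal3 p u v = 1"
proof -
  note q = quatj_inner[of p] p(1) norm_J[of p] J_tangent[of p]
  have q': "p \<bullet> J p = 0" "p \<bullet> quatj p = 0" "p \<bullet> J (quatj p) = 0" "J p \<bullet> quatj p = 0" "J p \<bullet> J (quatj p) = 0" "quatj p \<bullet> J (quatj p) = 0"
    using q by (simp_all add: inner_commute)
  have expand: "w = (w \<bullet> J p) *\<^sub>R J p + (w \<bullet> quatj p) *\<^sub>R quatj p + (w \<bullet> J (quatj p)) *\<^sub>R J (quatj p)"
    if "w \<bullet> p = 0" for w
    by (rule orthonormal_eqI[of p "J p" "quatj p" "J (quatj p)"])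
      (use that q q' in \<open>simp_all add: inner_add_left\<close>)
  define a b c where "a = u \<bullet> J p" and "b = u \<bullet> quatj p" and "c = u \<bullet> J (quatj p)"
  define a' b' c' where "a' = v \<bullet> J p" and "b' = v \<bullet> quatj p" and "c' = v \<bullet> J (quatj p)"
  have ip: "(r *\<^sub>R J p + s *\<^sub>R quatj p + t *\<^sub>R J (quatj p)) \<bullet> (r' *\<^sub>R J p + s' *\<^sub>R quatj p + t' *\<^sub>R J (quatj p))
     = r * r' + s * s' + t * t'" for r s t r' s' t'
    using q q' by (simp add: inner_add_left inner_add_right)
  have u: "u = a *\<^sub>R J p + b *\<^sub>R quatj p + c *\<^sub>R J (quatj p)" using expand[OF p(2)] by (simp add: a_def b_def c_def)
  have v: "v = a' *\<^sub>R J p + b' *\<^sub>R quatj p + c' *\<^sub>R J (quatj p)" using expand[OF p(3)] by (simp add: a'_def b'_def c'_def)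
  have n: "normal3 p u v = (b * c' - c * b') *\<^sub>R J p + (c * a' - a * c') *\<^sub>R quatj p + (a * b' - b * a') *\<^sub>R J (quatj p)"
    by (simp add: normal3_def a_def b_def c_def a'_def b'_def c'_def)
  have uv: "a * a + b * b + c * c = 1" "a' * a' + b' * b' + c' * c' = 1" "a * a' + b * b' + c * c' = 0"
    using assms(4-6) ip[of a b c a b c] ip[of a' b' c' a' b' c'] ip[of a b c a' b' c'] by (simp_all flip: u v)
  show "p \<bullet> normal3 p u v = 0" unfolding n using q' by (simp add: inner_add_right)
  have "u \<bullet> normal3 p u v = a * (b * c' - c * b') + b * (c * a' - a * c') + c * (a * b' - b * a')"
    unfolding n by (subst u) (rule ip)
  also have "\<dots> = 0" by algebra
  finally show "u \<bullet> normal3 p u v = 0" .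
  have "v \<bullet> normal3 p u v = a' * (b * c' - c * b') + b' * (c * a' - a * c') + c' * (a * b' - b * a')"
    unfolding n by (subst v) (rule ip)
  also have "\<dots> = 0" by algebra
  finally show "v \<bullet> normal3 p u v = 0" .
  have "normal3 p u v \<bullet> normal3 p u v = (b * c' - c * b') * (b * c' - c * b') + (c * a' - a * c') * (c * a' - a * c')
     + (a * b' - b * a') * (a * b' - b * a')"
    unfolding n by (rule ip)
  \<comment> \<open>The Lagrange identity for the cross product.\<close>
  also have "\<dots> = (a * a + b * b + c * c) * (a' * a' + b' * b' + c' * c') - (a * a' + b * b' + c * c')\<^sup>2" by algebra
  finally show "normal3 p u v \<bullet> normal3 p u v = 1" unfolding uv by simp
qed

lemma second_derivative_bilinear:
  assumes S: "open S" "smooth_on S f" "x \<in> S"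
  shows "fderiv (\<lambda>z. fderiv f z (a *\<^sub>R axis 1 1 + b *\<^sub>R axis 2 1)) x (c *\<^sub>R axis 1 1 + d *\<^sub>R axis 2 1)
    = (a * c) *\<^sub>R partial 1 (partial 1 f) x + (a * d) *\<^sub>R partial 2 (partial 1 f) x
      + (b * c) *\<^sub>R partial 1 (partial 2 f) x + (b * d) *\<^sub>R partial 2 (partial 2 f) x"
proof -
  let ?v = "a *\<^sub>R axis 1 1 + b *\<^sub>R axis 2 1 :: real^2"
  have D: "(partial i f has_derivative fderiv (partial i f) x) (at x)" for i
    unfolding partial_def[abs_def] by (rule smooth_has_fderiv[OF S(1) smooth_on_fderiv[OF S(2)] S(3)])
  have 1: "fderiv (\<lambda>z. fderiv f z ?v) x = fderiv (\<lambda>z. a *\<^sub>R partial 1 f z + b *\<^sub>R partial 2 f z) x"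
  proof (rule fderiv_cong[OF S(1) smooth_on_fderiv[OF S(2)] S(3)])
    fix z assume "z \<in> S"
    then have l: "linear (fderiv f z)"
      using smooth_has_fderiv[OF S(1,2)] has_derivative_linear by blast
    show "fderiv f z ?v = a *\<^sub>R partial 1 f z + b *\<^sub>R partial 2 f z"
      by (simp only: linear_add[OF l] linear_scale[OF l] partial_def)
  qed
  have 2: "fderiv (\<lambda>z. a *\<^sub>R partial 1 f z + b *\<^sub>R partial 2 f z) x w
     = a *\<^sub>R fderiv (partial 1 f) x w + b *\<^sub>R fderiv (partial 2 f) x w" for w
    by (rule fderiv_eqI) (intro has_derivative_add has_derivative_scaleR_right D)
  show ?thesis
    using linear_add[OF has_derivative_linear[OF D]] linear_scale[OF has_derivative_linear[OF D]]
    unfolding 1 2 by (simp add: partial_def[of _ "partial _ f"] algebra_simps)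
qed

text \<open>Gram-Schmidt for the partial derivatives: \<open>D\<close> is their Gram determinant,
  and \<open>m\<close> is the length of
  \<open>g11 x *\<^sub>R f2 x - g12 x *\<^sub>R f1 x\<close>.\<close>

lemma chart_minimal_patch:
  assumes op: "open M" and sm: "smooth_on M f" and ff: "\<And>x. x \<in> M \<Longrightarrow> f x \<bullet> f x = 1"
    and inj: "\<And>x. x \<in> M \<Longrightarrow> inj (fderiv f x)"
    and min: "\<And>x \<tau> N. x \<in> M \<Longrightarrow> \<tau> \<noteq> 0 \<Longrightarrow> unit_normal (berger_metric 4 \<tau>) f x N \<Longrightarrow>
      mean_curvature (berger_metric 4 \<tau>) f x N = 0"
  shows "\<exists>X1 X2 n. minimal_patch M f X1 X2 n"
proof -
  define f1 f2 where "f1 = partial 1 f" and "f2 = partial 2 f"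
  have smp: "smooth_on M f1" "smooth_on M f2"
    unfolding f1_def f2_def partial_def[abs_def] by (intro smooth_on_fderiv sm)+
  have l: "linear (fderiv f x)" if "x \<in> M" for x
    using smooth_has_fderiv[OF op sm that] has_derivative_linear by blast
  have ind: "a = 0 \<and> b = 0" if x: "x \<in> M" and 0: "a *\<^sub>R f1 x + b *\<^sub>R f2 x = 0" for x a b
  proof -
    have "fderiv f x (a *\<^sub>R axis 1 1 + b *\<^sub>R axis 2 1) = 0"
      using 0 by (simp only: linear_add[OF l[OF x]] linear_scale[OF l[OF x]] f1_def f2_def partial_def)
    then have "a *\<^sub>R axis 1 1 + b *\<^sub>R axis 2 1 = (0 :: real^2)"
      using inj[OF x] by (simp add: linear_injective_0[OF l[OF x]])
    from arg_cong[OF this, of "\<lambda>v. v $ 1"] arg_cong[OF this, of "\<lambda>v. v $ 2"] show ?thesis by (simp add: axis_def)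
  qed
  define g11 g12 g22 where "g11 = (\<lambda>x. f1 x \<bullet> f1 x)" and "g12 = (\<lambda>x. f1 x \<bullet> f2 x)" and "g22 = (\<lambda>x. f2 x \<bullet> f2 x)"
  define D where "D = (\<lambda>x. g11 x * g22 x - g12 x * g12 x)"
  have g11: "g11 x > 0" if "x \<in> M" for x using ind[OF that, of 1 0] by (auto simp: g11_def)
  have hh: "(g11 x *\<^sub>R f2 x - g12 x *\<^sub>R f1 x) \<bullet> (g11 x *\<^sub>R f2 x - g12 x *\<^sub>R f1 x) = g11 x * D x" for x
    by (simp add: inner_diff_left inner_diff_right inner_commute[of "f2 x" "f1 x"] D_def g11_def g12_def g22_def algebra_simps)
  have D: "D x > 0" if x: "x \<in> M" for x
  proof -
    have "g11 x *\<^sub>R f2 x - g12 x *\<^sub>R f1 x \<noteq> 0" using ind[OF x, of "- g12 x" "g11 x"] g11[OF x] by auto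
    then have "0 < (g11 x *\<^sub>R f2 x - g12 x *\<^sub>R f1 x) \<bullet> (g11 x *\<^sub>R f2 x - g12 x *\<^sub>R f1 x)" by simp
    then show ?thesis unfolding hh using g11[OF x] by (simp add: zero_less_mult_iff)
  qed
  define a1 where "a1 = (\<lambda>x. 1 / sqrt (g11 x))"
  define m where "m = (\<lambda>x. sqrt (g11 x * D x))"
  define a2 where "a2 = (\<lambda>x. - g12 x / m x)"
  define c2 where "c2 = (\<lambda>x. g11 x / m x)"
  have m: "m x > 0" "m x * m x = g11 x * D x" if "x \<in> M" for x
    using g11[OF that] D[OF that] by (simp_all add: m_def)
  have a1: "a1 x * a1 x * g11 x = 1" if "x \<in> M" for x using g11[OF that] by (simp add: a1_def)
  have smg: "smooth_on M g11" "smooth_on M g12" "smooth_on M D"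
    unfolding D_def g11_def g12_def g22_def by (intro smooth_intros op smp)+
  have smm: "smooth_on M m"
    unfolding m_def by (intro smooth_on_sqrt smooth_intros op smg) (use g11 D in simp)
  have sma: "smooth_on M a1" "smooth_on M a2" "smooth_on M c2"
  proof -
    show "smooth_on M a1" unfolding a1_def
    proof (rule smooth_on_divide[OF op smooth_on_const[OF op]])
      show "smooth_on M (\<lambda>x. sqrt (g11 x))" by (rule smooth_on_sqrt[OF op smg(1) g11])
      show "sqrt (g11 x) \<noteq> 0" if "x \<in> M" for x using g11[OF that] by simp
    qed
    show "smooth_on M a2" "smooth_on M c2" unfolding a2_def c2_def
      using smooth_on_divide[OF op smooth_on_minus[OF op smg(2)] smm] smooth_on_divide[OF op smg(1) smm] m(1) by (metis less_irrefl)+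
  qed
  \<comment> \<open>The zero summand gives \<open>X1\<close> the shape expected by
    \<open>second_derivative_bilinear\<close>.\<close>
  define X1 :: "real^2 \<Rightarrow> real^2" where "X1 = (\<lambda>x. a1 x *\<^sub>R axis 1 1 + 0 *\<^sub>R axis 2 1)"
  define X2 :: "real^2 \<Rightarrow> real^2" where "X2 = (\<lambda>x. a2 x *\<^sub>R axis 1 1 + c2 x *\<^sub>R axis 2 1)"
  have smX: "smooth_on M X1" "smooth_on M X2"
    unfolding X1_def X2_def by (intro smooth_intros op sma)+
  define e1 e2 where "e1 = lie X1 f" and "e2 = lie X2 f"
  have e: "e1 x = a1 x *\<^sub>R f1 x" "e2 x = a2 x *\<^sub>R f1 x + c2 x *\<^sub>R f2 x" if x: "x \<in> M" for x
    unfolding e1_def e2_def lie_def X1_def X2_def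
    by (simp_all only: linear_add[OF l[OF x]] linear_scale[OF l[OF x]] f1_def f2_def partial_def) simp_all
  have ee: "e1 x \<bullet> e1 x = 1" "e2 x \<bullet> e2 x = 1" "e1 x \<bullet> e2 x = 0" if x: "x \<in> M" for x
  proof -
    have e2': "e2 x = (1 / m x) *\<^sub>R (g11 x *\<^sub>R f2 x - g12 x *\<^sub>R f1 x)"
      unfolding e[OF x] a2_def c2_def by (simp add: algebra_simps divide_inverse)
    show "e1 x \<bullet> e1 x = 1" unfolding e[OF x] using a1[OF x] by (simp add: g11_def mult_ac)
    show "e2 x \<bullet> e2 x = 1" unfolding e2' inner_scaleR_left inner_scaleR_right hh using m[OF x] g11[OF x] D[OF x] by (simp add: field_simps)
    show "e1 x \<bullet> e2 x = 0" unfolding e2' e[OF x] by (simp add: inner_diff_right g11_def g12_def)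
  qed
  have tang: "fderiv f x v \<bullet> f x = 0" if x: "x \<in> M" for x v
  proof -
    have "lie (\<lambda>_. v) (\<lambda>y. f y \<bullet> f y) x = lie (\<lambda>_. v) (\<lambda>_. 1) x"
      by (rule lie_cong[OF op x]) (intro smooth_intros op sm | simp add: ff)+
    then show ?thesis using lie_inner[OF op x sm sm, of "\<lambda>_. v"] by (simp add: lie_def inner_commute)
  qed
  then have ef: "e1 x \<bullet> f x = 0" "e2 x \<bullet> f x = 0" if "x \<in> M" for x using that by (simp_all add: e1_def e2_def lie_def)
  define n where "n = (\<lambda>x. normal3 (f x) (e1 x) (e2 x))"
  have sme: "smooth_on M e1" "smooth_on M e2" unfolding e1_def e2_def by (intro smooth_intros op sm smX)+
  have smn: "smooth_on M n"
    unfolding n_def normal3_def by (intro smooth_intros smooth_on_quatj op sm sme)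
  have n: "f x \<bullet> n x = 0" "e1 x \<bullet> n x = 0" "e2 x \<bullet> n x = 0" "n x \<bullet> n x = 1" if x: "x \<in> M" for x
    unfolding n_def by (rule normal3; rule ff[OF x] ef[OF x] ee[OF x])+
  have key: "lie X1 e1 x \<bullet> n x + lie X2 e2 x \<bullet> n x = 0"
    "(e2 x \<bullet> J (f x))\<^sup>2 * (lie X1 e1 x \<bullet> n x) - 2 * (e1 x \<bullet> J (f x)) * (e2 x \<bullet> J (f x)) * (lie X1 e2 x \<bullet> n x)
      + (e1 x \<bullet> J (f x))\<^sup>2 * (lie X2 e2 x \<bullet> n x) = 0" if x: "x \<in> M" for x
  proof -
    define B11 B12 B22 where "B11 = partial 1 (partial 1 f) x \<bullet> n x" and "B12 = partial 1 (partial 2 f) x \<bullet> n x"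
      and "B22 = partial 2 (partial 2 f) x \<bullet> n x"
    have sym: "partial 1 (partial 2 f) x = partial 2 (partial 1 f) x"
      unfolding partial_def[of _ "partial _ f"] unfolding partial_def[abs_def]
      by (rule fderiv_symmetric[OF op sm x])
    have nz: "a1 x \<noteq> 0" "c2 x \<noteq> 0" using g11[OF x] m(1)[OF x] by (simp_all add: a1_def c2_def)
    have Dn: "fderiv f x v \<bullet> n x = 0" for v
    proof -
      have "v = (v $ 1) *\<^sub>R axis 1 1 + (v $ 2) *\<^sub>R axis 2 1" by (simp add: vec_eq_iff forall_2 axis_def)
      then have "fderiv f x v = (v $ 1) *\<^sub>R f1 x + (v $ 2) *\<^sub>R f2 x"
        unfolding f1_def f2_def partial_def by (metis linear_add[OF l[OF x]] linear_scale[OF l[OF x]])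
      moreover have "f1 x \<bullet> n x = 0" "f2 x \<bullet> n x = 0" using n(2,3)[OF x] nz unfolding e[OF x] by (auto simp: inner_add_left)
      ultimately show ?thesis by (simp add: inner_add_left)
    qed
    \<comment> \<open>The first-order part is tangent and drops out against \<open>n\<close>, so the
      variation of the coefficients of the fields does not enter.\<close>
    have II: "lie Z (lie W f) x \<bullet> n x = a * c * B11 + (a * d + b * c) * B12 + b * d * B22"
      if "smooth_on M W" "W x = a *\<^sub>R axis 1 1 + b *\<^sub>R axis 2 1" "Z x = c *\<^sub>R axis 1 1 + d *\<^sub>R axis 2 1" for W Z a b c d
      unfolding lie_lie[OF op sm that(1) x] that(2,3) second_derivative_bilinear[OF op sm x] inner_add_left Dn
      by (simp add: B11_def B12_def B22_def sym algebra_simps)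
    have X: "X1 x = a1 x *\<^sub>R axis 1 1 + 0 *\<^sub>R axis 2 1" "X2 x = a2 x *\<^sub>R axis 1 1 + c2 x *\<^sub>R axis 2 1"
      by (simp_all add: X1_def X2_def)
    have b: "lie X1 e1 x \<bullet> n x = a1 x * a1 x * B11" "lie X1 e2 x \<bullet> n x = a1 x * (a2 x * B11 + c2 x * B12)"
      "lie X2 e2 x \<bullet> n x = a2 x * a2 x * B11 + 2 * a2 x * c2 x * B12 + c2 x * c2 x * B22"
      unfolding e1_def e2_def
      by (simp_all add: II[where W = X1 and Z = X1, OF smX(1) X(1) X(1)] II[where W = X2 and Z = X1, OF smX(2) X(2) X(1)]
        II[where W = X2 and Z = X2, OF smX(2) X(2) X(2)] algebra_simps)
    have fe: "f x \<bullet> e1 x = 0" "f x \<bullet> e2 x = 0" using ef[OF x] by (simp_all add: inner_commute)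
    note pt = berger_minimal_at_point[OF e[OF x, unfolded f1_def f2_def] nz ff[OF x] ee(1,2)[OF x] n(4)[OF x] fe n(1)[OF x]
      ee(3)[OF x] n(2,3)[OF x] sym min[OF x]]
    show "lie X1 e1 x \<bullet> n x + lie X2 e2 x \<bullet> n x = 0"
      "(e2 x \<bullet> J (f x))\<^sup>2 * (lie X1 e1 x \<bullet> n x) - 2 * (e1 x \<bullet> J (f x)) * (e2 x \<bullet> J (f x)) * (lie X1 e2 x \<bullet> n x)
        + (e1 x \<bullet> J (f x))\<^sup>2 * (lie X2 e2 x \<bullet> n x) = 0"
      unfolding b B11_def B12_def B22_def using pt by simp_all
  qed
  have "minimal_patch M f X1 X2 n"
    by (rule minimal_patch.intro)
      (use op sm smX smn ff ee n key in \<open>simp_all flip: e1_def e2_def\<close>)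
  then show ?thesis by blast
qed

section \<open>Congruences\<close>

lemma unitary_map_berger_isometry:
  assumes "unitary u v"
  shows "(\<lambda>p. (hm p u, hm p v)) \<in> berger_isometries"
proof -
  have "linear (\<lambda>p. (hm p u, hm p v))" by (rule linearI) (simp_all add: hm_add hm_scaleR)
  moreover have "(hm p u, hm p v) \<bullet> (hm q u, hm q v) = p \<bullet> q" for p q
  proof -
    have "(hm p u, hm p v) \<bullet> (hm q u, hm q v) = Re (hm p u * cnj (hm q u) + hm p v * cnj (hm q v))"
      by (simp add: inner_complex_def)
    also have "\<dots> = Re (hm p q)" by (simp only: hm_parseval[OF assms])
    also have "\<dots> = p \<bullet> q" by (simp add: hm_eq)
    finally show ?thesis .
  qed
  ultimately have "orthogonal_transformation (\<lambda>p. (hm p u, hm p v))" by (simp add: orthogonal_transformation_def)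
  moreover have "(hm (J p) u, hm (J p) v) = J (hm p u, hm p v)" for p
    by (simp add: hm_J J_def[of "(_, _)"])
  ultimately show ?thesis by (simp add: berger_isometries_def)
qed

text \<open>The first basis vector \<open>- J n\<close> is chosen because \<open>J\<close> maps it
  to \<open>n\<close>: the imaginary part of the first coordinate is \<open>p \<bullet> n\<close>,
  which vanishes, so that coordinate is real as in \<open>Phi 0\<close>.\<close>

lemma equator_congruent:
  assumes "N \<noteq> 0" "\<And>p. p \<in> M \<Longrightarrow> p \<bullet> p = 1 \<and> p \<bullet> N = 0"
  shows "congruent_to_piece M (range (Phi 0))"
proof -
  define n where "n = (1 / norm N) *\<^sub>R N"
  have n: "n \<bullet> n = 1" using assms(1) by (simp add: n_def dot_square_norm power2_eq_square)
  let ?u = "- J n" and ?v = "quatj n"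
  have uv: "unitary ?u ?v"
    using n quatj_inner[of n] by (simp add: unitary_def inner_J_J J_minus J_J inner_commute[of "J n"])
  have "(hm p ?u, hm p ?v) \<in> range (Phi 0)" if p: "p \<in> M" for p
  proof -
    have pn: "p \<bullet> n = 0" "p \<bullet> p = 1" using assms(2)[OF p] by (simp_all add: n_def)
    have z: "hm p ?u = of_real (- (p \<bullet> J n))" by (simp add: hm_eq J_minus J_J pn complex_eq_iff)
    have "hm p ?u * cnj (hm p ?u) + hm p ?v * cnj (hm p ?v) = 1"
      using hm_parseval[OF uv, of p p] pn by (simp add: hm_eq inner_J_self complex_eq_iff)
    then have "of_real ((p \<bullet> J n)\<^sup>2 + (cmod (hm p ?v))\<^sup>2) = (1 :: complex)"
      unfolding z complex_norm_square[symmetric] by simp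
    then have "(- (p \<bullet> J n))\<^sup>2 + (cmod (hm p ?v))\<^sup>2 = 1" by (metis of_real_eq_1_iff power2_minus)
    then obtain \<sigma> where "- (p \<bullet> J n) = cos \<sigma>" "cmod (hm p ?v) = sin \<sigma>" using sincos_total_2pi by metis
    moreover have "hm p ?v = of_real (cmod (hm p ?v)) * cis (Arg (hm p ?v))"
      using rcis_cmod_Arg[of "hm p ?v"] by (simp add: rcis_def)
    ultimately have "Phi 0 (\<sigma>, Arg (hm p ?v)) = (hm p ?u, hm p ?v)" by (simp add: Phi_def z)
    then show ?thesis by (metis rangeI)
  qed
  then show ?thesis
    unfolding congruent_to_piece_def using unitary_map_berger_isometry[OF uv] by (intro bexI) auto
qed

lemma (in adapted_frame) vertical_if_hopf:
  assumes x: "x \<in> M" and "fderiv f x v \<bullet> J (f x) \<noteq> 0"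
  shows "s x \<noteq> 0"
proof
  assume "s x = 0"
  then have "fderiv f x v \<bullet> J (f x) = 0"
    by (subst frame_expand[OF x smf]) (simp add: inner_add_left s_def EJf[OF x] flip: E_def T_def)
  then show False using assms(2) by simp
qed

section \<open>From local to global\<close>

locale minimal_surface =
  fixes S :: "'a::{t2_space,second_countable_topology} set" and \<A> :: "'a chart set" and \<Phi> :: "'a \<Rightarrow> C2"
  assumes surf: "smooth_surface S \<A>" and con: "connected S" and imm: "immersion_S3 S \<A> \<Phi>"
    and min: "\<And>\<kappa> \<tau>. \<kappa> > 0 \<Longrightarrow> \<tau> \<noteq> 0 \<Longrightarrow> minimal_immersion (berger_metric \<kappa> \<tau>) S \<A> \<Phi>"
begin

abbreviation rep :: "'a set \<Rightarrow> ('a \<Rightarrow> real^2) \<Rightarrow> real^2 \<Rightarrow> C2" where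
  "rep U \<phi> \<equiv> \<Phi> \<circ> inv_into U \<phi>"

text \<open>A chart-free form of being umbilic near \<open>x\<close>: a neighbourhood lies in a
  great sphere. Openness is immediate; closedness is left to the charts.\<close>

definition geodesic_at :: "'a \<Rightarrow> bool" where
  "geodesic_at x \<longleftrightarrow> (\<exists>T N. openin (top_of_set S) T \<and> x \<in> T \<and> N \<noteq> 0 \<and> (\<forall>y\<in>T. \<Phi> y \<bullet> N = 0))"

lemma chart_at: assumes "a \<in> S" obtains U \<phi> where "(U, \<phi>) \<in> \<A>" "a \<in> U"
  using surf assms unfolding smooth_surface_def by blast

section \<open>Properties of a single chart\<close>

context
  fixes U \<phi> assumes ch: "(U, \<phi>) \<in> \<A>"
begin

lemma chart: "openin (top_of_set S) U" "open (\<phi> ` U)" "homeomorphism U (\<phi> ` U) \<phi> (inv_into U \<phi>)" "U \<subseteq> S"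
proof -
  show "openin (top_of_set S) U" "open (\<phi> ` U)" "homeomorphism U (\<phi> ` U) \<phi> (inv_into U \<phi>)"
    using surf ch unfolding smooth_surface_def by blast+
  then show "U \<subseteq> S" using openin_imp_subset by blast
qed

lemma par_chart: "x \<in> U \<Longrightarrow> inv_into U \<phi> (\<phi> x) = x" "y \<in> \<phi> ` U \<Longrightarrow> \<phi> (inv_into U \<phi> y) = y"
  "y \<in> \<phi> ` U \<Longrightarrow> inv_into U \<phi> y \<in> U"
  using chart(3) by (auto simp: homeomorphism_def)

lemma openin_chart_preimage: "open V \<Longrightarrow> openin (top_of_set S) (U \<inter> \<phi> -` V)"
proof -
  assume "open V"
  have "continuous_on U \<phi>" using chart(3) by (simp add: homeomorphism_def)
  then have "openin (top_of_set U) (U \<inter> \<phi> -` V)" using \<open>open V\<close> continuous_openin_preimage_gen by blast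
  then show ?thesis using chart(1) openin_trans by blast
qed

lemma open_par_preimage: "openin (top_of_set S) T \<Longrightarrow> open (\<phi> ` U \<inter> inv_into U \<phi> -` T)"
proof -
  assume T: "openin (top_of_set S) T"
  have c: "continuous_on (\<phi> ` U) (inv_into U \<phi>)" using chart(3) by (simp add: homeomorphism_def)
  obtain G where G: "open G" "T = S \<inter> G" using T by (auto simp: openin_open)
  have "\<phi> ` U \<inter> inv_into U \<phi> -` T = \<phi> ` U \<inter> inv_into U \<phi> -` G"
    using par_chart(3) chart(4) G(2) by blast
  then show ?thesis using continuous_open_preimage[OF c chart(2) G(1)] by simp
qed

lemma ball_in_chart:
  assumes "openin (top_of_set S) T" "x \<in> U" "x \<in> T"
  obtains r where "r > 0" "ball (\<phi> x) r \<subseteq> \<phi> ` U" "\<And>y. y \<in> ball (\<phi> x) r \<Longrightarrow> inv_into U \<phi> y \<in> T"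
proof -
  have "\<phi> x \<in> \<phi> ` U \<inter> inv_into U \<phi> -` T" using assms par_chart(1) by auto
  then obtain r where "r > 0" "ball (\<phi> x) r \<subseteq> \<phi> ` U \<inter> inv_into U \<phi> -` T"
    using open_par_preimage[OF assms(1)] open_contains_ball by blast
  then show ?thesis using that by blast
qed

lemma chart_map:
  "smooth_on (\<phi> ` U) (rep U \<phi>)" "y \<in> \<phi> ` U \<Longrightarrow> (rep U \<phi>) y \<bullet> (rep U \<phi>) y = 1"
proof -
  show "smooth_on (\<phi> ` U) (rep U \<phi>)" using imm ch unfolding immersion_S3_def by blast
  assume "y \<in> \<phi> ` U"
  then have "inv_into U \<phi> y \<in> S" using par_chart(3) chart(4) by blast
  then have "\<Phi> (inv_into U \<phi> y) \<in> S3" using imm unfolding immersion_S3_def by blast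
  then show "(rep U \<phi>) y \<bullet> (rep U \<phi>) y = 1" by (simp add: dot_square_norm)
qed

lemma chart_patch: "\<exists>X1 X2 n. minimal_patch (\<phi> ` U) (rep U \<phi>) X1 X2 n"
proof (rule chart_minimal_patch[OF chart(2) chart_map])
  show "inj (fderiv (rep U \<phi>) x)" if "x \<in> \<phi> ` U" for x
    using imm ch that unfolding immersion_S3_def by blast
  show "mean_curvature (berger_metric 4 \<tau>) (rep U \<phi>) x N = 0"
    if "x \<in> \<phi> ` U" "\<tau> \<noteq> 0" "unit_normal (berger_metric 4 \<tau>) (rep U \<phi>) x N" for x \<tau> N
    using min[of 4 \<tau>] ch that unfolding minimal_immersion_def by fastforce
qed

text \<open>\<open>K\<close> measures the size of the second form. Since umbilic points are
  interior, its zeros are the geodesic points. The normal \<open>n\<close> is kept in order to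
  compare hyperplanes; the other data of the patch stay hidden.\<close>

lemma chart_curvature:
  obtains n :: "real^2 \<Rightarrow> C2" and K :: "real^2 \<Rightarrow> real" where "continuous_on (\<phi> ` U) K" "\<And>x. x \<in> U \<Longrightarrow> geodesic_at x \<longleftrightarrow> K (\<phi> x) = 0"
    "\<And>q r N. r > 0 \<Longrightarrow> ball q r \<subseteq> \<phi> ` U \<Longrightarrow> (\<forall>x\<in>ball q r. \<Phi> (inv_into U \<phi> x) \<bullet> N = 0) \<Longrightarrow>
      N = (N \<bullet> n q) *\<^sub>R n q"
    "\<And>q. q \<in> \<phi> ` U \<Longrightarrow> K q \<noteq> 0 \<Longrightarrow> \<exists>r>0. \<exists>X Y. ball q r \<subseteq> \<phi> ` U \<and> adapted_frame (ball q r) (rep U \<phi>) X Y \<and>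
      curvature (rep U \<phi>) X Y q \<noteq> 0"
proof -
  let ?f = "rep U \<phi>"
  obtain X1 X2 n where "minimal_patch (\<phi> ` U) ?f X1 X2 n" using chart_patch by blast
  then interpret P: minimal_patch "\<phi> ` U" ?f X1 X2 n "lie X1 ?f" "lie X2 ?f"
    "\<lambda>x. lie X1 (lie X1 ?f) x \<bullet> n x" "\<lambda>x. lie X1 (lie X2 ?f) x \<bullet> n x" "\<lambda>x. lie X2 (lie X2 ?f) x \<bullet> n x"
    "\<lambda>x. lie X1 ?f x \<bullet> J (?f x)" "\<lambda>x. lie X2 ?f x \<bullet> J (?f x)"
    by simp_all
  define K where "K = (\<lambda>x. (lie X1 (lie X1 ?f) x \<bullet> n x)\<^sup>2 + (lie X1 (lie X2 ?f) x \<bullet> n x)\<^sup>2)"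
  have K0: "K x = 0 \<longleftrightarrow> lie X1 (lie X1 ?f) x \<bullet> n x = 0 \<and> lie X1 (lie X2 ?f) x \<bullet> n x = 0" for x
    by (simp add: K_def sum_power2_eq_zero_iff)
  show ?thesis
  proof (rule that[of K n])
    show "continuous_on (\<phi> ` U) K" unfolding K_def by (intro smooth_continuous_on smooth_intros P.sm)
    show "N = (N \<bullet> n q) *\<^sub>R n q" if "r > 0" "ball q r \<subseteq> \<phi> ` U" "\<forall>x\<in>ball q r. \<Phi> (inv_into U \<phi> x) \<bullet> N = 0" for q r N
      by (rule P.normal_vector(1)[OF that(1,2)]) (use that(3) in simp)
    show "\<exists>r>0. \<exists>X Y. ball q r \<subseteq> \<phi> ` U \<and> adapted_frame (ball q r) ?f X Y \<and> curvature ?f X Y q \<noteq> 0"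
      if "q \<in> \<phi> ` U" "K q \<noteq> 0" for q
      using P.nonumbilic_frame[OF that(1)] that(2) K0 by blast
    fix x assume x: "x \<in> U"
    then have q: "\<phi> x \<in> \<phi> ` U" by simp
    show "geodesic_at x \<longleftrightarrow> K (\<phi> x) = 0"
    proof
      assume "geodesic_at x"
      then obtain T N where TN: "openin (top_of_set S) T" "x \<in> T" "N \<noteq> 0" "\<And>y. y \<in> T \<Longrightarrow> \<Phi> y \<bullet> N = 0"
        unfolding geodesic_at_def by blast
      obtain e where e: "e > 0" "ball (\<phi> x) e \<subseteq> \<phi> ` U" "\<And>y. y \<in> ball (\<phi> x) e \<Longrightarrow> inv_into U \<phi> y \<in> T"
        by (rule ball_in_chart[OF TN(1) x TN(2)]) (rule that; assumption)
      show "K (\<phi> x) = 0"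
        unfolding K0 by (rule P.normal_vector(2)[OF e(1,2) _ TN(3)]) (use e(3) TN(4) in auto)
    next
      assume "K (\<phi> x) = 0"
      then obtain r where r: "r > 0" "ball (\<phi> x) r \<subseteq> \<phi> ` U" "\<And>y. y \<in> ball (\<phi> x) r \<Longrightarrow> K y = 0"
        using P.umbilic_open[OF q] unfolding K0 by blast
      let ?T = "U \<inter> \<phi> -` ball (\<phi> x) r"
      have T: "openin (top_of_set S) ?T" by (rule openin_chart_preimage) simp
      have "\<Phi> y \<bullet> n (\<phi> x) = 0" if "y \<in> ?T" for y
        using P.umbilic_ball_geodesic[OF r(2) r(3)[unfolded K0], of "\<phi> y"] that par_chart(1)[of y] by auto
      moreover have "n (\<phi> x) \<noteq> 0" using P.nn[OF q] by auto
      moreover have "x \<in> ?T" using x r(1) by simp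
      ultimately show "geodesic_at x" using T unfolding geodesic_at_def by blast
    qed
  qed
qed

end

text \<open>The geodesic points form an open set by definition and a closed one because, in each
  chart, they are the zeros of a continuous \<open>K\<close>.\<close>

lemma geodesic_at_dichotomy:
  assumes a: "a \<in> S" "geodesic_at a" and b: "b \<in> S"
  shows "geodesic_at b"
proof (rule connected_induction_simple[where P = geodesic_at, OF con a(1) b a(2)])
  fix a assume aS: "a \<in> S"
  show "\<exists>T. openin (top_of_set S) T \<and> a \<in> T \<and> (\<forall>x\<in>T. \<forall>y\<in>T. geodesic_at x \<longrightarrow> geodesic_at y)"
  proof (cases "geodesic_at a")
    case True
    then show ?thesis unfolding geodesic_at_def by blast
  next
    case False
    obtain U \<phi> where ch: "(U, \<phi>) \<in> \<A>" "a \<in> U" using chart_at[OF aS] .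
    obtain K :: "real^2 \<Rightarrow> real" where K: "continuous_on (\<phi> ` U) K" "\<And>x. x \<in> U \<Longrightarrow> geodesic_at x \<longleftrightarrow> K (\<phi> x) = 0"
      by (rule chart_curvature[OF ch(1)]) (rule that; assumption)
    have "K (\<phi> a) \<noteq> 0" using K(2)[OF ch(2)] False by simp
    from ball_where_nonzero[OF chart(2)[OF ch(1)] K(1) imageI[OF ch(2)] this]
    obtain r where r: "r > 0" "\<And>y. y \<in> ball (\<phi> a) r \<Longrightarrow> K y \<noteq> 0" by blast
    let ?T = "U \<inter> \<phi> -` ball (\<phi> a) r"
    have "openin (top_of_set S) ?T" by (rule openin_chart_preimage[OF ch(1)]) simp
    moreover have "\<not> geodesic_at x" if "x \<in> ?T" for x using that K(2) r(2) by auto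
    ultimately show ?thesis using ch(2) r(1) by (intro exI[of _ ?T]) auto
  qed
qed

text \<open>Two hyperplanes containing the image of a common open set have proportional normals,
  both being multiples of \<open>n\<close>. So the hyperplane at \<open>a\<close> propagates over
  the connected surface.\<close>

lemma geodesic_congruent:
  assumes a: "a \<in> S" "geodesic_at a"
  shows "congruent_to_piece (\<Phi> ` S) (range (Phi 0))"
proof -
  obtain T0 N0 where N0: "openin (top_of_set S) T0" "a \<in> T0" "N0 \<noteq> 0" "\<And>y. y \<in> T0 \<Longrightarrow> \<Phi> y \<bullet> N0 = 0"
    using a(2) unfolding geodesic_at_def by blast
  let ?P = "\<lambda>x. \<exists>T. openin (top_of_set S) T \<and> x \<in> T \<and> (\<forall>y\<in>T. \<Phi> y \<bullet> N0 = 0)"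
  have "?P b" if "b \<in> S" for b
  proof (rule connected_induction_simple[where P = ?P, OF con a(1) that])
    show "?P a" using N0 by blast
    fix x assume xS: "x \<in> S"
    obtain T N1 where TN: "openin (top_of_set S) T" "x \<in> T" "N1 \<noteq> 0" "\<And>y. y \<in> T \<Longrightarrow> \<Phi> y \<bullet> N1 = 0"
      using geodesic_at_dichotomy[OF a xS] unfolding geodesic_at_def by blast
    have "?P y" if y: "y \<in> T" "z \<in> T" "?P z" for y z
    proof -
      obtain T' where T': "openin (top_of_set S) T'" "z \<in> T'" "\<And>y. y \<in> T' \<Longrightarrow> \<Phi> y \<bullet> N0 = 0" using y(3) by blast
      have "z \<in> S" using y(2) TN(1) openin_imp_subset by blast
      then obtain U \<phi> where ch: "(U, \<phi>) \<in> \<A>" "z \<in> U" using chart_at by blast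
      obtain n where n: "\<And>q r N. r > 0 \<Longrightarrow> ball q r \<subseteq> \<phi> ` U \<Longrightarrow>
          (\<forall>x\<in>ball q r. \<Phi> (inv_into U \<phi> x) \<bullet> N = 0) \<Longrightarrow> N = (N \<bullet> n q) *\<^sub>R n q"
        by (rule chart_curvature[OF ch(1)]) (rule that; assumption)
      have TT': "openin (top_of_set S) (T \<inter> T')" using TN(1) T'(1) by (rule openin_Int)
      obtain e where e: "e > 0" "ball (\<phi> z) e \<subseteq> \<phi> ` U" "\<And>y. y \<in> ball (\<phi> z) e \<Longrightarrow> inv_into U \<phi> y \<in> T \<inter> T'"
        by (rule ball_in_chart[OF ch(1) TT' ch(2) IntI[OF y(2) T'(2)]]) (rule that; assumption)
      have 0: "N0 = (N0 \<bullet> n (\<phi> z)) *\<^sub>R n (\<phi> z)"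
        by (rule n[OF e(1,2)]) (use e(3) T'(3) in auto)
      have 1: "N1 = (N1 \<bullet> n (\<phi> z)) *\<^sub>R n (\<phi> z)"
        by (rule n[OF e(1,2)]) (use e(3) TN(4) in auto)
      have nz: "N1 \<bullet> n (\<phi> z) \<noteq> 0" using 1 TN(3) by auto
      have "\<Phi> w \<bullet> N0 = 0" if "w \<in> T" for w
      proof -
        have "(N1 \<bullet> n (\<phi> z)) * (\<Phi> w \<bullet> n (\<phi> z)) = \<Phi> w \<bullet> N1" by (subst (2) 1) simp
        then have "\<Phi> w \<bullet> n (\<phi> z) = 0" using TN(4)[OF that] nz by simp
        then show ?thesis by (subst 0) simp
      qed
      then show ?thesis using TN(1) y(1) by blast
    qed
    then show "\<exists>T. openin (top_of_set S) T \<and> x \<in> T \<and> (\<forall>x\<in>T. \<forall>y\<in>T. ?P x \<longrightarrow> ?P y)"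
      using TN(1,2) by (intro exI[of _ T]) blast
  qed
  then have "\<Phi> b \<bullet> N0 = 0" if "b \<in> S" for b using that by blast
  moreover have "\<Phi> b \<bullet> \<Phi> b = 1" if "b \<in> S" for b
    using imm that unfolding immersion_S3_def by (auto simp: dot_square_norm)
  ultimately show ?thesis using N0(3) by (intro equator_congruent[of N0]) auto
qed

section \<open>Independence of the chart\<close>

lemma transition:
  assumes ch: "(U, \<phi>) \<in> \<A>" and ch': "(U', \<phi>') \<in> \<A>"
  defines "W \<equiv> \<phi> ` U \<inter> inv_into U \<phi> -` U'" and "\<psi> \<equiv> \<phi>' \<circ> inv_into U \<phi>"
  shows "open W" "y \<in> W \<Longrightarrow> \<psi> differentiable (at y)" "y \<in> W \<Longrightarrow> \<psi> y \<in> \<phi>' ` U'"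
    "y \<in> W \<Longrightarrow> (rep U \<phi>) y = (rep U' \<phi>') (\<psi> y)"
proof -
  have W: "W = \<phi> ` (U \<inter> U')"
    unfolding W_def using par_chart[OF ch] by (auto simp: image_iff)
  show o: "open W" unfolding W_def by (rule open_par_preimage[OF ch chart(1)[OF ch']])
  have "smooth_on W \<psi>" using surf ch ch' unfolding smooth_surface_def W \<psi>_def by blast
  then show "y \<in> W \<Longrightarrow> \<psi> differentiable (at y)" using smooth_has_fderiv[OF o] differentiable_def by blast
  show "y \<in> W \<Longrightarrow> \<psi> y \<in> \<phi>' ` U'" by (auto simp: W_def \<psi>_def)
  show "y \<in> W \<Longrightarrow> (rep U \<phi>) y = (rep U' \<phi>') (\<psi> y)"
    using par_chart(1)[OF ch'] by (simp add: W_def \<psi>_def)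
qed

text \<open>Expresses that the tangent plane is not horizontal. Quantification over all charts makes
  it easy to use; by \<open>transversalI\<close> one chart suffices to prove it.\<close>

definition transversal :: "'a \<Rightarrow> bool" where
  "transversal x \<longleftrightarrow> (\<forall>(U, \<phi>)\<in>\<A>. x \<in> U \<longrightarrow>
     (\<exists>v. fderiv (rep U \<phi>) (\<phi> x) v \<bullet> J (\<Phi> x) \<noteq> 0))"

lemma transversalI:
  assumes ch: "(U, \<phi>) \<in> \<A>" and x: "x \<in> U" and v: "fderiv (rep U \<phi>) (\<phi> x) v \<bullet> J (\<Phi> x) \<noteq> 0"
  shows "transversal x"
  unfolding transversal_def
proof (clarify)
  fix U' \<phi>' assume ch': "(U', \<phi>') \<in> \<A>" and x': "x \<in> U'"
  let ?W = "\<phi> ` U \<inter> inv_into U \<phi> -` U'" and ?\<psi> = "\<phi>' \<circ> inv_into U \<phi>"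
  note tr = transition[OF ch ch']
  have xW: "\<phi> x \<in> ?W" using x x' par_chart(1)[OF ch x] by auto
  have \<psi>x: "?\<psi> (\<phi> x) = \<phi>' x" using par_chart(1)[OF ch x] by simp
  have "fderiv (rep U \<phi>) (\<phi> x) v = fderiv (rep U' \<phi>') (\<phi>' x) (fderiv ?\<psi> (\<phi> x) v)"
    using fderiv_compose[OF tr(1) xW tr(2)[OF xW] smooth_has_fderiv[OF chart(2)[OF ch'] chart_map(1)[OF ch'] tr(3)[OF xW]] tr(4)]
    unfolding \<psi>x .
  then show "\<exists>v. fderiv (rep U' \<phi>') (\<phi>' x) v \<bullet> J (\<Phi> x) \<noteq> 0" using v by metis
qed

definition leaf_at :: "C2 \<Rightarrow> C2 \<Rightarrow> real \<Rightarrow> real \<Rightarrow> 'a \<Rightarrow> bool" where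
  "leaf_at u v m1 m2 x \<longleftrightarrow> (\<exists>(U, \<phi>)\<in>\<A>. x \<in> U \<and> (\<exists>M X Y. \<phi> x \<in> M \<and> M \<subseteq> \<phi> ` U \<and>
     adapted_frame M (rep U \<phi>) X Y \<and> frame_on_leaf u v m1 m2 (rep U \<phi>) X Y (\<phi> x)))"

text \<open>The frame on \<open>M\<close> is entered at a transversal point, where any two frames
  agree up to sign; the leaf data then reach every point of \<open>M\<close>, transversal or
  not.\<close>

lemma leaf_at_transfer:
  assumes ch: "(U, \<phi>) \<in> \<A>" and F: "adapted_frame M (rep U \<phi>) X Y" and M: "M \<subseteq> \<phi> ` U" "convex M"
    and x: "x \<in> U" "\<phi> x \<in> M" "transversal x" "leaf_at u v m1 m2 x" and uv: "unitary u v" and y: "y \<in> M"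
  shows "frame_on_leaf u v m1 m2 (rep U \<phi>) X Y y"
proof -
  let ?f = "rep U \<phi>"
  obtain U' \<phi>' M' X' Y' where ch': "(U', \<phi>') \<in> \<A>" "x \<in> U'" and x': "\<phi>' x \<in> M'" "M' \<subseteq> \<phi>' ` U'"
    and F': "adapted_frame M' (rep U' \<phi>') X' Y'"
    and leaf: "frame_on_leaf u v m1 m2 (rep U' \<phi>') X' Y' (\<phi>' x)"
    using x(4) unfolding leaf_at_def by blast
  let ?f' = "rep U' \<phi>'"
  interpret A: lie_frame M ?f X Y by (rule lie_frame.intro[OF F])
  interpret B: lie_frame M' ?f' X' Y' by (rule lie_frame.intro[OF F'])
  let ?W0 = "\<phi> ` U \<inter> inv_into U \<phi> -` U'" and ?\<psi> = "\<phi>' \<circ> inv_into U \<phi>"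
  note tr = transition[OF ch ch'(1)]
  have xW0: "\<phi> x \<in> ?W0" using x ch'(2) par_chart(1)[OF ch x(1)] by auto
  have \<psi>x: "?\<psi> (\<phi> x) = \<phi>' x" using par_chart(1)[OF ch x(1)] by simp
  have fx: "?f (\<phi> x) = \<Phi> x" "?f' (\<phi>' x) = \<Phi> x" using par_chart(1)[OF ch x(1)] par_chart(1)[OF ch'] by simp_all
  have cont: "continuous_on ?W0 ?\<psi>"
    using tr(1,2) by (meson continuous_at_imp_continuous_on differentiable_imp_continuous_within)
  define W where "W = M \<inter> (?W0 \<inter> ?\<psi> -` M')"
  have oW: "open W" unfolding W_def by (intro open_Int A.op continuous_open_preimage cont tr(1) B.op)
  have xW: "\<phi> x \<in> W" using x(2) xW0 \<psi>x x'(1) by (simp add: W_def)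
  have "frame_on_leaf u v m1 m2 ?f X Y (\<phi> x)"
  proof (rule frame_on_leaf_change[OF F F' oW xW, where \<psi> = ?\<psi>])
    show "W \<subseteq> M" "\<And>y. y \<in> W \<Longrightarrow> ?\<psi> y \<in> M'" by (auto simp: W_def)
    show "\<And>y. y \<in> W \<Longrightarrow> ?\<psi> differentiable (at y)" using tr(2) by (simp add: W_def)
    show "\<And>y. y \<in> W \<Longrightarrow> ?f y = ?f' (?\<psi> y)" using tr(4) by (simp add: W_def)
    obtain w where w: "fderiv ?f (\<phi> x) w \<bullet> J (\<Phi> x) \<noteq> 0"
      using x(1,3) ch unfolding transversal_def by blast
    show "lie Y ?f (\<phi> x) \<bullet> J (?f (\<phi> x)) \<noteq> 0"
      by (rule A.vertical_if_hopf[OF x(2)]) (use w fx in simp)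
    obtain w' where w': "fderiv ?f' (\<phi>' x) w' \<bullet> J (\<Phi> x) \<noteq> 0"
      using x(3) ch' unfolding transversal_def by blast
    show "lie Y' ?f' (?\<psi> (\<phi> x)) \<bullet> J (?f' (?\<psi> (\<phi> x))) \<noteq> 0"
      unfolding \<psi>x by (rule B.vertical_if_hopf[OF x'(1)]) (use w' fx in simp)
    show "frame_on_leaf u v m1 m2 ?f' X' Y' (?\<psi> (\<phi> x))" unfolding \<psi>x by (rule leaf)
  qed
  from A.leaf_transport[OF M(2) x(2) y uv this] show ?thesis .
qed

lemma framed_chart:
  assumes ng: "\<not> geodesic_at a" and a: "a \<in> S"
  obtains U \<phi> r X Y where "(U, \<phi>) \<in> \<A>" "a \<in> U" "r > 0" "ball (\<phi> a) r \<subseteq> \<phi> ` U"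
    "adapted_frame (ball (\<phi> a) r) (rep U \<phi>) X Y" "curvature (rep U \<phi>) X Y (\<phi> a) \<noteq> 0"
proof -
  obtain U \<phi> where ch: "(U, \<phi>) \<in> \<A>" "a \<in> U" using chart_at[OF a] .
  obtain K :: "real^2 \<Rightarrow> real" where K0: "\<And>x. x \<in> U \<Longrightarrow> geodesic_at x \<longleftrightarrow> K (\<phi> x) = 0"
    and K: "\<And>q. q \<in> \<phi> ` U \<Longrightarrow> K q \<noteq> 0 \<Longrightarrow> \<exists>r>0. \<exists>X Y. ball q r \<subseteq> \<phi> ` U \<and>
      adapted_frame (ball q r) (rep U \<phi>) X Y \<and> curvature (rep U \<phi>) X Y q \<noteq> 0"
    by (rule chart_curvature[OF ch(1)]) (rule that; assumption)
  have "K (\<phi> a) \<noteq> 0" using ng K0[OF ch(2)] by simp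
  from K[OF imageI[OF ch(2)] this] show ?thesis using that[OF ch] by blast
qed

lemma transversal_dense:
  assumes ng: "\<And>x. x \<in> S \<Longrightarrow> \<not> geodesic_at x" and T: "openin (top_of_set S) T" "a \<in> T"
  shows "\<exists>z. z \<in> T \<and> transversal z"
proof -
  have a: "a \<in> S" using T openin_imp_subset by blast
  obtain U \<phi> r X Y where ch: "(U, \<phi>) \<in> \<A>" "a \<in> U" and r: "r > 0" "ball (\<phi> a) r \<subseteq> \<phi> ` U"
    and F: "adapted_frame (ball (\<phi> a) r) (rep U \<phi>) X Y"
    by (rule framed_chart[OF ng[OF a] a]) (rule that; assumption)
  let ?f = "rep U \<phi>"
  interpret A: lie_frame "ball (\<phi> a) r" ?f X Y by (rule lie_frame.intro[OF F])
  obtain e where e: "e > 0" "\<And>y. y \<in> ball (\<phi> a) e \<Longrightarrow> inv_into U \<phi> y \<in> T"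
    by (rule ball_in_chart[OF ch(1) T(1) ch(2) T(2)]) (rule that; assumption)
  obtain y where y: "y \<in> ball (\<phi> a) r" "y \<in> ball (\<phi> a) e" "lie Y ?f y \<bullet> J (?f y) \<noteq> 0"
    using A.dense[of "\<phi> a" e] r(1) e(1) by auto
  have yU: "y \<in> \<phi> ` U" using y(1) r(2) by blast
  let ?z = "inv_into U \<phi> y"
  have "transversal ?z"
    by (rule transversalI[OF ch(1) par_chart(3)[OF ch(1) yU], where v = "Y y"])
      (use y(3) par_chart(2)[OF ch(1) yU] in \<open>simp add: lie_def\<close>)
  then show ?thesis using e(2)[OF y(2)] by blast
qed

text \<open>The eigenbasis and the eigenvalues are fixed once, at a transversal point
  \<open>a\<close>, where the nonzero curvature yields \<open>m2 \<noteq> 0\<close>.\<close>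

lemma ruled_congruent:
  assumes ng: "\<And>x. x \<in> S \<Longrightarrow> \<not> geodesic_at x" and ne: "S \<noteq> {}"
  shows "\<exists>c. congruent_to_piece (\<Phi> ` S) (range (Phi c))"
proof -
  obtain a where a: "a \<in> S" "transversal a" using transversal_dense[OF ng, of S] ne by fastforce
  obtain U \<phi> r X Y where ch: "(U, \<phi>) \<in> \<A>" "a \<in> U" and r: "r > 0" "ball (\<phi> a) r \<subseteq> \<phi> ` U"
    and F: "adapted_frame (ball (\<phi> a) r) (rep U \<phi>) X Y" and cu: "curvature (rep U \<phi>) X Y (\<phi> a) \<noteq> 0"
    by (rule framed_chart[OF ng[OF a(1)] a(1)]) (rule that; assumption)
  let ?f = "rep U \<phi>"
  interpret A: lie_frame "ball (\<phi> a) r" ?f X Y by (rule lie_frame.intro[OF F])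
  have a': "\<phi> a \<in> ball (\<phi> a) r" using r(1) by simp
  obtain u v m1 m2 where uv: "unitary u v" and m2: "m2 \<noteq> 0" and leaf: "frame_on_leaf u v m1 m2 ?f X Y (\<phi> a)"
    using exists_on_leaf[OF A.unitary_frame[OF a'], of "lie Y ?f (\<phi> a) \<bullet> J (lie X ?f (\<phi> a))"
      "lie Y (lie X ?f) (\<phi> a) \<bullet> J (lie X ?f (\<phi> a))" "lie Y ?f (\<phi> a) \<bullet> J (?f (\<phi> a))"] cu
    unfolding frame_on_leaf_def curvature_def by (auto simp: power2_eq_square)
  have La: "leaf_at u v m1 m2 a" unfolding leaf_at_def using ch a' r(2) F leaf by blast
  \<comment> \<open>The induction over the connected surface is restricted to the dense set of
    transversal points, where frames can be compared.\<close>
  have leaf_at_all: "leaf_at u v m1 m2 b" if b: "b \<in> S" "transversal b" for b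
  proof (rule connected_induction[where P = transversal and Q = "leaf_at u v m1 m2", OF con _ _ a(1) b(1) a(2) b(2) La])
    show "\<exists>z. z \<in> T \<and> transversal z" if "openin (top_of_set S) T" "c \<in> T" for T c
      by (rule transversal_dense[OF ng that])
    fix c assume c: "c \<in> S"
    obtain U \<phi> r X Y where ch: "(U, \<phi>) \<in> \<A>" "c \<in> U" and r: "r > 0" "ball (\<phi> c) r \<subseteq> \<phi> ` U"
      and F: "adapted_frame (ball (\<phi> c) r) (rep U \<phi>) X Y"
      by (rule framed_chart[OF ng[OF c] c]) (rule that; assumption)
    let ?T = "U \<inter> \<phi> -` ball (\<phi> c) r"
    have T: "openin (top_of_set S) ?T" by (rule openin_chart_preimage[OF ch(1)]) simp
    have "leaf_at u v m1 m2 y" if "x \<in> ?T" "y \<in> ?T" "transversal x" "leaf_at u v m1 m2 x" for x y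
    proof -
      have "frame_on_leaf u v m1 m2 (rep U \<phi>) X Y (\<phi> y)"
        by (rule leaf_at_transfer[OF ch(1) F r(2) convex_ball _ _ that(3,4) uv]) (use that in auto)
      then show ?thesis unfolding leaf_at_def using ch(1) F r(2) that(2) by blast
    qed
    then show "\<exists>T. openin (top_of_set S) T \<and> c \<in> T \<and>
        (\<forall>x\<in>T. \<forall>y\<in>T. transversal x \<and> transversal y \<and> leaf_at u v m1 m2 x \<longrightarrow> leaf_at u v m1 m2 y)"
      using T ch(2) r(1) by (intro exI[of _ ?T]) auto
  qed
  have "(hm (\<Phi> b) u, hm (\<Phi> b) v) \<in> range (Phi (m1 / m2))" if b: "b \<in> S" for b
  proof -
    obtain U \<phi> r X Y where ch: "(U, \<phi>) \<in> \<A>" "b \<in> U" and r: "r > 0" "ball (\<phi> b) r \<subseteq> \<phi> ` U"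
      and F: "adapted_frame (ball (\<phi> b) r) (rep U \<phi>) X Y"
      by (rule framed_chart[OF ng[OF b] b]) (rule that; assumption)
    let ?f = "rep U \<phi>" and ?T = "U \<inter> \<phi> -` ball (\<phi> b) r"
    interpret C: lie_frame "ball (\<phi> b) r" ?f X Y by (rule lie_frame.intro[OF F])
    have b': "\<phi> b \<in> ball (\<phi> b) r" using r(1) by simp
    have T: "openin (top_of_set S) ?T" by (rule openin_chart_preimage[OF ch(1)]) simp
    \<comment> \<open>A point \<open>b\<close> whose plane may be horizontal inherits the leaf data
      from a transversal point of the same ball.\<close>
    obtain z where z: "z \<in> ?T" "transversal z" using transversal_dense[OF ng T, of b] ch(2) r(1) by auto
    have zS: "z \<in> S" using z(1) chart(4)[OF ch(1)] by auto
    have "frame_on_leaf u v m1 m2 ?f X Y (\<phi> b)"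
      by (rule leaf_at_transfer[OF ch(1) F r(2) convex_ball _ _ z(2) leaf_at_all[OF zS z(2)] uv b']) (use z in auto)
    then have "(hm (?f (\<phi> b)) u, hm (?f (\<phi> b)) v) \<in> range (Phi (m1 / m2))"
      unfolding frame_on_leaf_def by (rule on_leaf_imp_Phi[OF _ uv C.unitary_frame[OF b'] m2])
    then show ?thesis using par_chart(1)[OF ch] by simp
  qed
  then have "congruent_to_piece (\<Phi> ` S) (range (Phi (m1 / m2)))"
    unfolding congruent_to_piece_def using unitary_map_berger_isometry[OF uv] by (intro bexI) auto
  then show ?thesis ..
qed

end

theorem proposition1:
  fixes S :: "'a::{t2_space,second_countable_topology} set"
    and \<A> :: "'a chart set"
    and \<Phi> :: "'a \<Rightarrow> C2"
  assumes "smooth_surface S \<A>"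
    and "connected S"
    and "immersion_S3 S \<A> \<Phi>"
    and "\<And>\<kappa> \<tau>. \<kappa> > 0 \<Longrightarrow> \<tau> \<noteq> 0 \<Longrightarrow> minimal_immersion (berger_metric \<kappa> \<tau>) S \<A> \<Phi>"
  shows "\<exists>c::real. congruent_to_piece (\<Phi> ` S) (range (Phi c))"
proof -
  interpret minimal_surface S \<A> \<Phi> using assms by unfold_locales
  consider "S = {}" | a where "a \<in> S" "geodesic_at a" | "S \<noteq> {}" "\<And>x. x \<in> S \<Longrightarrow> \<not> geodesic_at x" by blast
  then show ?thesis
  proof cases
    case 1
    have "(\<lambda>p. p) \<in> berger_isometries" by (simp add: berger_isometries_def orthogonal_transformation_def linear_id[unfolded id_def])
    then show ?thesis using 1 by (auto simp: congruent_to_piece_def)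
  next
    case 2
    then show ?thesis using geodesic_congruent by blast
  next
    case 3
    then show ?thesis using ruled_congruent by blast
  qed
qed

end
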